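(* Let $(G,m,\Lambda)$ be a Poisson-Lie group. Then $(TG,Tm,d_T\Lambda)$ is also a Poisson-Lie group.
   Context: Everything is smooth. A Poisson manifold is a manifold with a bivector field $\Lambda$ with vanishing Schouten bracket $[\Lambda,\Lambda]=0$. A map $\varphi:(M,\Lambda)\to(N,\Pi)$ between Poisson manifolds is Poisson if $\bigwedge^2T\varphi\circ\Lambda=\Pi\circ\varphi$. The product Poisson structure on $M\times N$ is $\Lambda\oplus\Pi$. A Poisson-Lie group $(G,m,\Lambda)$ is a Lie group $(G,m)$ with a Poisson structure $\Lambda$ on $G$ such that the multiplication $m:(G\times G,\Lambda\oplus\Lambda)\to(G,\Lambda)$ is a Poisson map. $TG$ is a Lie group with multiplication the tangent map $Tm:TG\times TG\simeq T(G\times G)\to TG$. $d_T\Lambda$ is the tangent lift of $\Lambda$ to the tangent bundle: in coordinates $(x^i,\dot x^j)$ on $TG$ induced by coordinates $(x^i)$ on $G$, if $\Lambda=\frac12\Lambda^{ij}\partial_{x^i}\wedge\partial_{x^j}$ with $\Lambda^{ij}=-\Lambda^{ji}$, then $$d_T\Lambda=\Lambda^{ij}\,\partial_{x^i}\wedge\partial_{\dot x^j}+\tfrac12\tfrac{\partial\Lambda^{ij}}{\partial x^k}\dot x^k\,\partial_{\dot x^i}\wedge\partial_{\dot x^j}.$$ *)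

theory Defs
  imports "HOL-Analysis.Analysis" "HOL-Algebra.Group"
begin

section \<open>Model spaces and smooth functions\<close>

text \<open>
  The model space \<open>\<real>\<^sup>n\<close> is a real inner product space \<open>'e\<close> together with an orthonormal
  basis \<open>B\<close> of \<open>n\<close> vectors.  The coordinates of \<open>x\<close> are \<open>x \<bullet> i\<close> for \<open>i \<in> B\<close>, so basis vectors
  play the role of coordinate indices, and the partial derivative with respect to the
  coordinate \<open>i\<close> is the derivative in the direction \<open>i\<close>.  The class \<open>euclidean_space\<close>
  (with \<open>B = Basis\<close>) is the case \<open>n \<ge> 1\<close>; the present form also allows \<open>B = {}\<close>, that is
  manifolds of dimension \<open>0\<close>.
\<close>

definition coordinate_basis :: "'e::real_inner set \<Rightarrow> bool" where
  "coordinate_basis B \<longleftrightarrow>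
     finite B \<and> (\<forall>i\<in>B. \<forall>j\<in>B. i \<bullet> j = (if i = j then 1 else 0)) \<and> span B = UNIV"

definition prod_basis :: "'e::real_inner set \<Rightarrow> 'f::real_inner set \<Rightarrow> ('e \<times> 'f) set" where
  "prod_basis B C = (\<lambda>i. (i, 0)) ` B \<union> (\<lambda>j. (0, j)) ` C"

definition partial :: "'e::real_normed_vector \<Rightarrow> ('e \<Rightarrow> 'f::real_normed_vector) \<Rightarrow> 'e \<Rightarrow> 'f" where
  "partial v f x = frechet_derivative f (at x) v"

text \<open>On an open subset of a finite-dimensional space this is the class \<open>C\<^sup>k\<close>.\<close>

primrec higher_differentiable_on ::
    "'e::real_normed_vector set \<Rightarrow> ('e \<Rightarrow> 'f::real_normed_vector) \<Rightarrow> nat \<Rightarrow> bool" where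
  "higher_differentiable_on S f 0 \<longleftrightarrow> continuous_on S f"
| "higher_differentiable_on S f (Suc k) \<longleftrightarrow>
     (\<forall>x\<in>S. f differentiable (at x)) \<and> (\<forall>v. higher_differentiable_on S (partial v f) k)"

definition smooth_on :: "'e::real_normed_vector set \<Rightarrow> ('e \<Rightarrow> 'f::real_normed_vector) \<Rightarrow> bool" where
  "smooth_on S f \<longleftrightarrow> (\<forall>k. higher_differentiable_on S f k)"


section \<open>Manifolds\<close>

text \<open>
  A chart \<open>(U, f)\<close> has domain \<open>U\<close>; the values of \<open>f\<close> outside \<open>U\<close> are irrelevant.  A manifold is
  given by an atlas (not necessarily maximal), which determines its points, its topology and
  its smooth structure.
\<close>

type_synonym ('a, 'e) chart = "'a set \<times> ('a \<Rightarrow> 'e)"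

type_synonym ('a, 'e) atlas = "('a, 'e) chart set"

definition chart_inv :: "('a, 'e) chart \<Rightarrow> 'e \<Rightarrow> 'a" where
  "chart_inv c = inv_into (fst c) (snd c)"

definition points :: "('a, 'e) atlas \<Rightarrow> 'a set" where
  "points A = (\<Union>c\<in>A. fst c)"

definition smooth_atlas :: "('a, 'e::real_normed_vector) atlas \<Rightarrow> bool" where
  "smooth_atlas A \<longleftrightarrow>
     (\<forall>c\<in>A. inj_on (snd c) (fst c) \<and> open (snd c ` fst c)) \<and>
     (\<forall>c\<in>A. \<forall>d\<in>A. open (snd c ` (fst c \<inter> fst d)) \<and>
        smooth_on (snd c ` (fst c \<inter> fst d)) (snd d \<circ> chart_inv c))"

text \<open>The unique topology for which all charts are homeomorphisms between open sets.\<close>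

definition manifold_topology :: "('a, 'e::real_normed_vector) atlas \<Rightarrow> 'a topology" where
  "manifold_topology A =
     topology (\<lambda>W. W \<subseteq> points A \<and> (\<forall>c\<in>A. open (snd c ` (W \<inter> fst c))))"

lemma openin_manifold_topology:
  assumes "smooth_atlas A"
  shows "openin (manifold_topology A) W \<longleftrightarrow>
           W \<subseteq> points A \<and> (\<forall>c\<in>A. open (snd c ` (W \<inter> fst c)))"
proof -
  have "istopology (\<lambda>W. W \<subseteq> points A \<and> (\<forall>c\<in>A. open (snd c ` (W \<inter> fst c))))"
    unfolding istopology_def
  proof (intro conjI allI impI ballI; (elim conjE)?)
    fix S T c
    assume c: "c \<in> A" and S: "\<forall>c\<in>A. open (snd c ` (S \<inter> fst c))"
      and T: "\<forall>c\<in>A. open (snd c ` (T \<inter> fst c))"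
    have "inj_on (snd c) (fst c)"
      using assms c by (auto simp: smooth_atlas_def)
    then have "snd c ` (S \<inter> T \<inter> fst c) = snd c ` (S \<inter> fst c) \<inter> snd c ` (T \<inter> fst c)"
      by (auto dest: inj_onD)
    then show "open (snd c ` (S \<inter> T \<inter> fst c))"
      using c S T by auto
  next
    fix K c
    assume c: "c \<in> A"
      and K: "\<forall>W\<in>K. W \<subseteq> points A \<and> (\<forall>c\<in>A. open (snd c ` (W \<inter> fst c)))"
    have "snd c ` (\<Union>K \<inter> fst c) = (\<Union>W\<in>K. snd c ` (W \<inter> fst c))"
      by auto
    then show "open (snd c ` (\<Union>K \<inter> fst c))"
      using c K by auto
  qed auto
  then show ?thesis
    by (simp add: manifold_topology_def topology_inverse')
qed

definition smooth_manifold :: "'e::real_inner set \<Rightarrow> ('a, 'e) atlas \<Rightarrow> bool" where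
  "smooth_manifold B A \<longleftrightarrow>
     coordinate_basis B \<and> smooth_atlas A \<and>
     Hausdorff_space (manifold_topology A) \<and> second_countable (manifold_topology A)"

definition smooth_map ::
    "('a, 'e::real_normed_vector) atlas \<Rightarrow> ('b, 'f::real_normed_vector) atlas \<Rightarrow> ('a \<Rightarrow> 'b) \<Rightarrow> bool" where
  "smooth_map A A' \<phi> \<longleftrightarrow>
     continuous_map (manifold_topology A) (manifold_topology A') \<phi> \<and>
     (\<forall>c\<in>A. \<forall>d\<in>A'.
        smooth_on (snd c ` (fst c \<inter> \<phi> -` fst d)) (snd d \<circ> \<phi> \<circ> chart_inv c))"

definition prod_chart :: "('a, 'e) chart \<Rightarrow> ('b, 'f) chart \<Rightarrow> ('a \<times> 'b, 'e \<times> 'f) chart" where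
  "prod_chart c d = (fst c \<times> fst d, map_prod (snd c) (snd d))"

definition prod_atlas :: "('a, 'e) atlas \<Rightarrow> ('b, 'f) atlas \<Rightarrow> ('a \<times> 'b, 'e \<times> 'f) atlas" where
  "prod_atlas A A' = {prod_chart c d |c d. c \<in> A \<and> d \<in> A'}"


section \<open>Tangent vectors and the tangent bundle\<close>

text \<open>
  A tangent vector at \<open>p\<close> is the family of its coordinate representations in all charts
  around \<open>p\<close>, related by the derivatives of the transition maps (and extended by \<open>0\<close> to all
  other charts, so that equality of tangent vectors is equality of functions).
\<close>

type_synonym ('a, 'e) tangent_vector = "('a, 'e) chart \<Rightarrow> 'e"

definition tangent_space ::
    "('a, 'e::real_normed_vector) atlas \<Rightarrow> 'a \<Rightarrow> ('a, 'e) tangent_vector set" where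
  "tangent_space A p =
     {v. (\<forall>c. \<not> (c \<in> A \<and> p \<in> fst c) \<longrightarrow> v c = 0) \<and>
         (\<forall>c\<in>A. \<forall>d\<in>A. p \<in> fst c \<longrightarrow> p \<in> fst d \<longrightarrow>
            v d = frechet_derivative (snd d \<circ> chart_inv c) (at (snd c p)) (v c))}"

definition tangent_bundle ::
    "('a, 'e::real_normed_vector) atlas \<Rightarrow> ('a \<times> ('a, 'e) tangent_vector) set" where
  "tangent_bundle A = Sigma (points A) (tangent_space A)"

text \<open>The chart \<open>(x\<^sup>i, \<xi>\<^sup>j)\<close> of the tangent bundle induced by the chart \<open>c = (x\<^sup>i)\<close>.\<close>

definition tangent_chart ::
    "('a, 'e::real_normed_vector) atlas \<Rightarrow> ('a, 'e) chart
       \<Rightarrow> ('a \<times> ('a, 'e) tangent_vector, 'e \<times> 'e) chart" where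
  "tangent_chart A c = (Sigma (fst c) (tangent_space A), \<lambda>(p, v). (snd c p, v c))"

definition tangent_atlas ::
    "('a, 'e::real_normed_vector) atlas \<Rightarrow> ('a \<times> ('a, 'e) tangent_vector, 'e \<times> 'e) atlas" where
  "tangent_atlas A = tangent_chart A ` A"

lemma points_tangent_atlas: "points (tangent_atlas A) = tangent_bundle A"
  by (auto simp: points_def tangent_atlas_def tangent_chart_def tangent_bundle_def)

text \<open>
  The differential of \<open>\<phi>\<close> at \<open>p\<close>, with the target read in the chart \<open>d\<close> and the source read in
  some chart around \<open>p\<close>; the tangent map below does not depend on the choice of the latter.
\<close>

definition chart_at :: "('a, 'e) atlas \<Rightarrow> 'a \<Rightarrow> ('a, 'e) chart" where
  "chart_at A p = (SOME c. c \<in> A \<and> p \<in> fst c)"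

definition local_differential ::
    "('a \<Rightarrow> 'b) \<Rightarrow> 'a \<Rightarrow> ('a, 'e::real_normed_vector) chart \<Rightarrow> ('b, 'f::real_normed_vector) chart
       \<Rightarrow> 'e \<Rightarrow> 'f" where
  "local_differential \<phi> p c d = frechet_derivative (snd d \<circ> \<phi> \<circ> chart_inv c) (at (snd c p))"

definition tangent_map ::
    "('a, 'e::real_normed_vector) atlas \<Rightarrow> ('b, 'f::real_normed_vector) atlas \<Rightarrow> ('a \<Rightarrow> 'b)
       \<Rightarrow> 'a \<times> ('a, 'e) tangent_vector \<Rightarrow> 'b \<times> ('b, 'f) tangent_vector" where
  "tangent_map A A' \<phi> = (\<lambda>(p, v).
     (\<phi> p, \<lambda>d. if d \<in> A' \<and> \<phi> p \<in> fst d
                then local_differential \<phi> p (chart_at A p) d (v (chart_at A p)) else 0))"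

text \<open>
  The canonical identification of \<open>TM \<times> TN\<close> with \<open>T(M \<times> N)\<close>, the inverse of
  \<open>(T pr\<^sub>1, T pr\<^sub>2)\<close>.
\<close>

definition tangent_prod_iso ::
    "('a, 'e::real_normed_vector) atlas \<Rightarrow> ('b, 'f::real_normed_vector) atlas
       \<Rightarrow> ('a \<times> ('a, 'e) tangent_vector) \<times> ('b \<times> ('b, 'f) tangent_vector)
       \<Rightarrow> ('a \<times> 'b) \<times> ('a \<times> 'b, 'e \<times> 'f) tangent_vector" where
  "tangent_prod_iso A A' =
     inv_into (tangent_bundle (prod_atlas A A'))
       (\<lambda>w. (tangent_map (prod_atlas A A') A fst w, tangent_map (prod_atlas A A') A' snd w))"


section \<open>Bivector fields and Poisson manifolds\<close>

text \<open>
  A bivector at \<open>p\<close> is likewise the family of its coordinate representations: \<open>w c i j\<close> is the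
  component \<open>w\<^sup>i\<^sup>j = - w\<^sup>j\<^sup>i\<close> of \<open>w = 1/2 w\<^sup>i\<^sup>j \<partial>\<^sub>i \<and> \<partial>\<^sub>j\<close> in the chart \<open>c\<close>.
\<close>

type_synonym ('a, 'e) bivector = "('a, 'e) chart \<Rightarrow> 'e \<Rightarrow> 'e \<Rightarrow> real"

text \<open>The components of the image of a bivector on the space spanned by \<open>B\<close> under \<open>\<And>\<^sup>2L\<close>.\<close>

definition push_bivector ::
    "'e::real_inner set \<Rightarrow> ('e \<Rightarrow> 'f::real_inner) \<Rightarrow> ('e \<Rightarrow> 'e \<Rightarrow> real) \<Rightarrow> 'f \<Rightarrow> 'f \<Rightarrow> real" where
  "push_bivector B L w k l = (\<Sum>i\<in>B. \<Sum>j\<in>B. (L i \<bullet> k) * (L j \<bullet> l) * w i j)"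

definition bivector_space ::
    "'e::real_inner set \<Rightarrow> ('a, 'e) atlas \<Rightarrow> 'a \<Rightarrow> ('a, 'e) bivector set" where
  "bivector_space B A p =
     {w. (\<forall>c i j. \<not> (c \<in> A \<and> p \<in> fst c \<and> i \<in> B \<and> j \<in> B) \<longrightarrow> w c i j = 0) \<and>
         (\<forall>c i j. w c i j = - w c j i) \<and>
         (\<forall>c\<in>A. \<forall>d\<in>A. p \<in> fst c \<longrightarrow> p \<in> fst d \<longrightarrow> (\<forall>k\<in>B. \<forall>l\<in>B.
            w d k l =
              push_bivector B (frechet_derivative (snd d \<circ> chart_inv c) (at (snd c p))) (w c) k l))}"

definition components ::
    "('a, 'e) chart \<Rightarrow> ('a \<Rightarrow> ('a, 'e) bivector) \<Rightarrow> 'e \<Rightarrow> 'e \<Rightarrow> 'e \<Rightarrow> real" where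
  "components c \<Lambda> i j x = \<Lambda> (chart_inv c x) c i j"

definition bivector_field ::
    "'e::real_inner set \<Rightarrow> ('a, 'e) atlas \<Rightarrow> ('a \<Rightarrow> ('a, 'e) bivector) \<Rightarrow> bool" where
  "bivector_field B A \<Lambda> \<longleftrightarrow>
     (\<forall>p\<in>points A. \<Lambda> p \<in> bivector_space B A p) \<and>
     (\<forall>c\<in>A. \<forall>i\<in>B. \<forall>j\<in>B. smooth_on (snd c ` fst c) (components c \<Lambda> i j))"

text \<open>
  The component \<open>[P, Q]\<^sup>i\<^sup>j\<^sup>k\<close> at \<open>x\<close> of the Schouten bracket of the bivector fields
  \<open>P = 1/2 P\<^sup>i\<^sup>j \<partial>\<^sub>i \<and> \<partial>\<^sub>j\<close> and \<open>Q = 1/2 Q\<^sup>i\<^sup>j \<partial>\<^sub>i \<and> \<partial>\<^sub>j\<close> on an open subset of the model space.  This is the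
  bracket determined by biadditivity and
  \<open>[X\<^sub>1 \<and> X\<^sub>2, Y\<^sub>1 \<and> Y\<^sub>2] = \<Sum>\<^sub>s\<^sub>t (-1)\<^sup>s\<^sup>+\<^sup>t [X\<^sub>s, Y\<^sub>t] \<and> X\<^sub>3\<^sub>-\<^sub>s \<and> Y\<^sub>3\<^sub>-\<^sub>t\<close>; other conventions in the
  literature change it by a sign only.
\<close>

definition schouten ::
    "'e::real_inner set \<Rightarrow> ('e \<Rightarrow> 'e \<Rightarrow> 'e \<Rightarrow> real) \<Rightarrow> ('e \<Rightarrow> 'e \<Rightarrow> 'e \<Rightarrow> real)
       \<Rightarrow> 'e \<Rightarrow> 'e \<Rightarrow> 'e \<Rightarrow> 'e \<Rightarrow> real" where
  "schouten B P Q i j k x =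
     (\<Sum>l\<in>B. P i l x * partial l (Q j k) x + Q i l x * partial l (P j k) x
          + P j l x * partial l (Q k i) x + Q j l x * partial l (P k i) x
          + P k l x * partial l (Q i j) x + Q k l x * partial l (P i j) x)"

definition poisson_manifold ::
    "'e::real_inner set \<Rightarrow> ('a, 'e) atlas \<Rightarrow> ('a \<Rightarrow> ('a, 'e) bivector) \<Rightarrow> bool" where
  "poisson_manifold B A \<Lambda> \<longleftrightarrow>
     smooth_manifold B A \<and> bivector_field B A \<Lambda> \<and>
     (\<forall>c\<in>A. \<forall>x\<in>snd c ` fst c. \<forall>i\<in>B. \<forall>j\<in>B. \<forall>k\<in>B.
        schouten B (components c \<Lambda>) (components c \<Lambda>) i j k x = 0)"

text \<open>\<open>\<And>\<^sup>2T\<^sub>p\<phi>\<close>; \<open>B\<close> and \<open>B'\<close> are the coordinate bases of source and target.\<close>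

definition bivector_map ::
    "'e::real_inner set \<Rightarrow> ('a, 'e) atlas \<Rightarrow> 'f::real_inner set \<Rightarrow> ('b, 'f) atlas
       \<Rightarrow> ('a \<Rightarrow> 'b) \<Rightarrow> 'a \<Rightarrow> ('a, 'e) bivector \<Rightarrow> ('b, 'f) bivector" where
  "bivector_map B A B' A' \<phi> p w = (\<lambda>d k l.
     if d \<in> A' \<and> \<phi> p \<in> fst d \<and> k \<in> B' \<and> l \<in> B'
     then push_bivector B (local_differential \<phi> p (chart_at A p) d) (w (chart_at A p)) k l else 0)"

definition poisson_map ::
    "'e::real_inner set \<Rightarrow> ('a, 'e) atlas \<Rightarrow> ('a \<Rightarrow> ('a, 'e) bivector)
       \<Rightarrow> 'f::real_inner set \<Rightarrow> ('b, 'f) atlas \<Rightarrow> ('b \<Rightarrow> ('b, 'f) bivector)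
       \<Rightarrow> ('a \<Rightarrow> 'b) \<Rightarrow> bool" where
  "poisson_map B A \<Lambda> B' A' \<Lambda>' \<phi> \<longleftrightarrow>
     smooth_map A A' \<phi> \<and>
     (\<forall>p\<in>points A. bivector_map B A B' A' \<phi> p (\<Lambda> p) = \<Lambda>' (\<phi> p))"

text \<open>
  \<open>\<Lambda> \<oplus> \<Lambda>'\<close> at \<open>(p, q)\<close>: the sum of the images of \<open>\<Lambda> p\<close> and \<open>\<Lambda>' q\<close> under the inclusions
  \<open>x \<mapsto> (x, q)\<close> and \<open>y \<mapsto> (p, y)\<close>.
\<close>

definition prod_bivector ::
    "'e::real_inner set \<Rightarrow> ('a, 'e) atlas \<Rightarrow> ('a \<Rightarrow> ('a, 'e) bivector)
       \<Rightarrow> 'f::real_inner set \<Rightarrow> ('b, 'f) atlas \<Rightarrow> ('b \<Rightarrow> ('b, 'f) bivector)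
       \<Rightarrow> 'a \<times> 'b \<Rightarrow> ('a \<times> 'b, 'e \<times> 'f) bivector" where
  "prod_bivector B A \<Lambda> B' A' \<Lambda>' = (\<lambda>(p, q) c i j.
     bivector_map B A (prod_basis B B') (prod_atlas A A') (\<lambda>x. (x, q)) p (\<Lambda> p) c i j
   + bivector_map B' A' (prod_basis B B') (prod_atlas A A') (\<lambda>y. (p, y)) q (\<Lambda>' q) c i j)"


section \<open>The tangent lift of a bivector field\<close>

definition wedge :: "'e::real_inner \<Rightarrow> 'e \<Rightarrow> 'e \<Rightarrow> 'e \<Rightarrow> real" where
  "wedge u v i j = (u \<bullet> i) * (v \<bullet> j) - (u \<bullet> j) * (v \<bullet> i)"

text \<open>
  The components of
  \<open>\<Lambda>\<^sup>i\<^sup>j \<partial>x\<^sup>i \<and> \<partial>\<xi>\<^sup>j + 1/2 (\<partial>\<Lambda>\<^sup>i\<^sup>j/\<partial>x\<^sup>k) \<xi>\<^sup>k \<partial>\<xi>\<^sup>i \<and> \<partial>\<xi>\<^sup>j\<close> at \<open>(x, \<xi>)\<close>,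
  where the coordinate vectors of \<open>x\<^sup>i\<close> and of \<open>\<xi>\<^sup>j\<close> are \<open>(i, 0)\<close> and \<open>(0, j)\<close>.
\<close>

definition local_tangent_lift ::
    "'e::real_inner set \<Rightarrow> ('e \<Rightarrow> 'e \<Rightarrow> 'e \<Rightarrow> real) \<Rightarrow> 'e \<times> 'e \<Rightarrow> 'e \<times> 'e \<Rightarrow> 'e \<times> 'e \<Rightarrow> real" where
  "local_tangent_lift B P = (\<lambda>(x, \<xi>) I J.
     (\<Sum>i\<in>B. \<Sum>j\<in>B. P i j x * wedge (i, 0) (0, j) I J)
   + 1/2 * (\<Sum>i\<in>B. \<Sum>j\<in>B. \<Sum>k\<in>B. partial k (P i j) x * (\<xi> \<bullet> k) * wedge (0, i) (0, j) I J))"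

text \<open>
  \<open>d\<^sub>T\<Lambda>\<close>.  The map \<open>tangent_chart A\<close> is injective on an atlas \<open>A\<close>, so \<open>c\<close> below is the chart
  inducing the chart \<open>C\<close> of the tangent bundle.
\<close>

definition tangent_lift ::
    "'e::real_inner set \<Rightarrow> ('a, 'e) atlas \<Rightarrow> ('a \<Rightarrow> ('a, 'e) bivector)
       \<Rightarrow> 'a \<times> ('a, 'e) tangent_vector \<Rightarrow> ('a \<times> ('a, 'e) tangent_vector, 'e \<times> 'e) bivector" where
  "tangent_lift B A \<Lambda> = (\<lambda>P C I J.
     if C \<in> tangent_atlas A \<and> P \<in> fst C \<and> I \<in> prod_basis B B \<and> J \<in> prod_basis B B
     then (let c = inv_into A (tangent_chart A) C
           in local_tangent_lift B (components c \<Lambda>) (snd C P) I J)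
     else 0)"


section \<open>Lie groups and Poisson-Lie groups\<close>

text \<open>
  A Lie group is a pair \<open>(G, m)\<close> as usual; the neutral element needed for the record of
  \<open>HOL-Algebra\<close> is determined by \<open>m\<close>.
\<close>

definition group_of :: "'a set \<Rightarrow> ('a \<times> 'a \<Rightarrow> 'a) \<Rightarrow> 'a monoid" where
  "group_of S m =
     \<lparr>carrier = S, monoid.mult = (\<lambda>x y. m (x, y)),
      one = (THE e. e \<in> S \<and> (\<forall>x\<in>S. m (e, x) = x \<and> m (x, e) = x))\<rparr>"

definition lie_group :: "'e::real_inner set \<Rightarrow> ('a, 'e) atlas \<Rightarrow> ('a \<times> 'a \<Rightarrow> 'a) \<Rightarrow> bool" where
  "lie_group B A m \<longleftrightarrow>
     smooth_manifold B A \<and> group (group_of (points A) m) \<and>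
     smooth_map (prod_atlas A A) A m \<and>
     smooth_map A A (\<lambda>x. inv\<^bsub>group_of (points A) m\<^esub> x)"

text \<open>The group multiplication \<open>Tm : TG \<times> TG \<simeq> T(G \<times> G) \<rightarrow> TG\<close>.\<close>

definition tangent_mult ::
    "('a, 'e::real_normed_vector) atlas \<Rightarrow> ('a \<times> 'a \<Rightarrow> 'a)
       \<Rightarrow> ('a \<times> ('a, 'e) tangent_vector) \<times> ('a \<times> ('a, 'e) tangent_vector)
       \<Rightarrow> 'a \<times> ('a, 'e) tangent_vector" where
  "tangent_mult A m = tangent_map (prod_atlas A A) A m \<circ> tangent_prod_iso A A"

definition poisson_lie_group ::
    "'e::real_inner set \<Rightarrow> ('a, 'e) atlas \<Rightarrow> ('a \<times> 'a \<Rightarrow> 'a) \<Rightarrow> ('a \<Rightarrow> ('a, 'e) bivector) \<Rightarrow> bool" where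
  "poisson_lie_group B A m \<Lambda> \<longleftrightarrow>
     lie_group B A m \<and> poisson_manifold B A \<Lambda> \<and>
     poisson_map (prod_basis B B) (prod_atlas A A) (prod_bivector B A \<Lambda> B A \<Lambda>) B A \<Lambda> m"

end

theory Submission
  imports Defs
begin

text \<open>
  Tangent vectors, bivectors and the lift \<open>d\<^sub>T\<Lambda>\<close> are all read in charts.  At basis vectors \<open>I = (a, b)\<close> and
  \<open>J = (a', b')\<close> of \<open>E \<times> E\<close> (one entry of each pair is \<open>0\<close>) and with \<open>P\<^sup>0\<^sup>j = 0\<close>, the components of \<open>d\<^sub>TP\<close> at
  \<open>(x, \<xi>)\<close> have the uniform expression \<open>P a b' x + P b a' x + \<partial>\<^sub>\<xi>P b b' x\<close>.  Differentiating the relation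
  \<open>Q \<circ> f = \<And>\<^sup>2Df \<circ> P\<close> in the direction \<open>\<xi>\<close> and using symmetry of second derivatives shows that \<open>Tf\<close> relates
  \<open>d\<^sub>TP\<close> to \<open>d\<^sub>TQ\<close>.  Applied to transition maps, this makes \<open>d\<^sub>T\<Lambda>\<close> a bivector field; applied to a Poisson map
  \<open>\<phi>\<close>, it makes \<open>T\<phi>\<close> Poisson.  The Jacobi identity for \<open>d\<^sub>TP\<close> splits into three instances of the one for \<open>P\<close>
  and its derivative along \<open>\<xi>\<close>.  Finally \<open>TG \<times> TG \<simeq> T(G \<times> G)\<close> carries \<open>d\<^sub>T\<Lambda> \<oplus> d\<^sub>T\<Lambda>\<close> to \<open>d\<^sub>T(\<Lambda> \<oplus> \<Lambda>)\<close>, so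
  the multiplication \<open>Tm\<close> is a composition of two Poisson maps.  The group axioms for \<open>Tm\<close> follow from those
  for \<open>m\<close> by the chain rule.
\<close>

section \<open>Coordinates\<close>

text \<open>A basis vector of the doubled model space is \<open>(i, 0)\<close> or
  \<open>(0, j)\<close>, so its two entries lie in \<open>insert 0 B\<close>, and \<open>0\<close>
  is never a member of \<open>B\<close>. Components vanish at the index \<open>0\<close>; identities
  known for indices in \<open>B\<close> therefore extend to \<open>insert 0 B\<close>, and the four
  blocks of a component matrix are treated by one computation instead of a case split. Two further
  obstacles shape the proof. The definitions quantify over all charts, or pick one by
  \<open>SOME\<close> or \<open>inv_into\<close>; criteria such as \<open>smooth_mapI\<close> and
  \<open>poisson_mapI\<close> reduce a claim to one pair of charts near each point, because all
  objects transform by the cocycle of transition Jacobians. And the model space is just an inner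
  product space with a finite orthonormal basis, so facts of finite-dimensional calculus, such as
  the chain rule for the class \<open>C^k\<close> and the existence of a countable base, come from
  expansion in that basis.\<close>

lemma coordinate_basis_sum:
  assumes "coordinate_basis B"
  shows "(\<Sum>i\<in>B. (x \<bullet> i) *\<^sub>R i) = x"
proof -
  have fin: "finite B" and ort: "\<And>i j. i \<in> B \<Longrightarrow> j \<in> B \<Longrightarrow> i \<bullet> j = (if i = j then 1 else 0)"
    and sp: "x \<in> span B"
    using assms by (auto simp: coordinate_basis_def)
  show ?thesis
    using sp
  proof (induct rule: span_induct_alt)
    case (step c b y)
    have "(\<Sum>i\<in>B. (b \<bullet> i) *\<^sub>R i) = (\<Sum>i\<in>B. if b = i then i else 0)"
      using ort step(1) by (intro sum.cong) auto
    also have "\<dots> = b"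
      using fin step(1) by simp
    finally have "(\<Sum>i\<in>B. (b \<bullet> i) *\<^sub>R i) = b" .
    moreover have "(\<Sum>i\<in>B. ((c *\<^sub>R b + y) \<bullet> i) *\<^sub>R i)
        = c *\<^sub>R (\<Sum>i\<in>B. (b \<bullet> i) *\<^sub>R i) + (\<Sum>i\<in>B. (y \<bullet> i) *\<^sub>R i)"
      by (simp add: inner_left_distrib scaleR_left_distrib sum.distrib scaleR_right.sum)
    ultimately show ?case
      using step(2) by simp
  qed simp
qed

lemma finite_coordinate_basis: "coordinate_basis B \<Longrightarrow> finite B"
  by (simp add: coordinate_basis_def)

lemma inner_coordinate_basis:
  "coordinate_basis B \<Longrightarrow> i \<in> B \<Longrightarrow> j \<in> B \<Longrightarrow> i \<bullet> j = (if i = j then 1 else 0)"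
  by (simp add: coordinate_basis_def)

text \<open>The vector \<open>0\<close> pairs to 0 with itself, a basis vector to 1. This leaves
  \<open>0\<close> free to mark the empty slot in \<open>(i, 0)\<close> and
  \<open>(0, j)\<close>.\<close>

lemma zero_notin_coordinate_basis: "coordinate_basis B \<Longrightarrow> 0 \<notin> B"
  using inner_coordinate_basis[of B 0 0] by auto

lemma linear_coordinate_sum:
  assumes "coordinate_basis B" "linear L"
  shows "L x = (\<Sum>i\<in>B. (x \<bullet> i) *\<^sub>R L i)"
proof -
  have "L x = L (\<Sum>i\<in>B. (x \<bullet> i) *\<^sub>R i)"
    using coordinate_basis_sum[OF assms(1)] by simp
  also have "\<dots> = (\<Sum>i\<in>B. (x \<bullet> i) *\<^sub>R L i)"
    by (simp add: linear_sum[OF assms(2)] linear_scale[OF assms(2)])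
  finally show ?thesis .
qed

text \<open>Serves to fit coordinate boxes into balls in
  \<open>countable_coordinate_base\<close>.\<close>

lemma coordinate_basis_norm_le:
  assumes "coordinate_basis B"
  shows "norm x \<le> (\<Sum>i\<in>B. \<bar>x \<bullet> i\<bar>)"
proof -
  have "norm x = norm (\<Sum>i\<in>B. (x \<bullet> i) *\<^sub>R i)"
    using coordinate_basis_sum[OF assms] by simp
  also have "\<dots> \<le> (\<Sum>i\<in>B. norm ((x \<bullet> i) *\<^sub>R i))"
    by (rule norm_sum)
  also have "\<dots> = (\<Sum>i\<in>B. \<bar>x \<bullet> i\<bar>)"
    using inner_coordinate_basis[OF assms] by (intro sum.cong) (auto simp: norm_eq_sqrt_inner)
  finally show ?thesis .
qed

lemma sum_prod_basis:
  assumes "coordinate_basis B" "coordinate_basis C"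
  shows "(\<Sum>I\<in>prod_basis B C. g I) = (\<Sum>i\<in>B. g (i, 0)) + (\<Sum>j\<in>C. g (0, j))"
proof -
  \<comment> \<open>The two families could meet only in \<open>(0, 0)\<close>, which neither
    contains.\<close>
  have "(\<lambda>i. (i, 0)) ` B \<inter> (\<lambda>j. (0, j)) ` C = {}"
    using zero_notin_coordinate_basis assms by fastforce
  then show ?thesis
    using assms unfolding prod_basis_def
    by (subst sum.union_disjoint) (auto simp: sum.reindex inj_on_def finite_coordinate_basis)
qed

lemma prod_basis_cases:
  assumes "I \<in> prod_basis B C"
  obtains (left) i where "i \<in> B" "I = (i, 0)" | (right) j where "j \<in> C" "I = (0, j)"
  using assms by (auto simp: prod_basis_def)

lemma coordinate_basis_prod_basis:
  assumes "coordinate_basis B" "coordinate_basis C"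
  shows "coordinate_basis (prod_basis B C)"
proof -
  have "(x, y) \<in> span (prod_basis B C)" for x y
  proof -
    have "(x, y) = (\<Sum>i\<in>B. (x \<bullet> i) *\<^sub>R (i, 0)) + (\<Sum>j\<in>C. (y \<bullet> j) *\<^sub>R (0, j))"
      by (simp add: sum_prod coordinate_basis_sum[OF assms(1)] coordinate_basis_sum[OF assms(2)])
    also have "\<dots> \<in> span (prod_basis B C)"
      by (intro span_add span_sum span_scale span_base) (auto simp: prod_basis_def)
    finally show ?thesis .
  qed
  then have "span (prod_basis B C) = UNIV"
    by auto
  moreover have "finite (prod_basis B C)"
    using assms by (auto simp: prod_basis_def finite_coordinate_basis)
  moreover have "I \<bullet> J = (if I = J then 1 else 0)"
    if I: "I \<in> prod_basis B C" and J: "J \<in> prod_basis B C" for I J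
    using I J zero_notin_coordinate_basis[OF assms(1)] zero_notin_coordinate_basis[OF assms(2)]
    by (elim prod_basis_cases)
       (auto simp: inner_coordinate_basis[OF assms(1)] inner_coordinate_basis[OF assms(2)])
  ultimately show ?thesis
    by (auto simp: coordinate_basis_def)
qed

section \<open>Calculus of smooth functions\<close>

lemma has_derivative_partial:
  "f differentiable (at x) \<Longrightarrow> (f has_derivative (\<lambda>v. partial v f x)) (at x)"
  by (simp add: partial_def frechet_derivative_works[symmetric])

lemma partial_eqI: "(f has_derivative f') (at x) \<Longrightarrow> partial v f x = f' v"
  by (metis frechet_derivative_at partial_def)

lemma has_derivative_compose_fst:
  "(f has_derivative f') (at a) \<Longrightarrow> ((\<lambda>z. f (fst z)) has_derivative (\<lambda>z. f' (fst z))) (at (a, b))"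
  using has_derivative_compose[of fst fst "(a, b)" UNIV f f'] by (simp add: has_derivative_fst[OF has_derivative_ident])

lemma has_derivative_compose_snd:
  "(f has_derivative f') (at b) \<Longrightarrow> ((\<lambda>z. f (snd z)) has_derivative (\<lambda>z. f' (snd z))) (at (a, b))"
  using has_derivative_compose[of snd snd "(a, b)" UNIV f f'] by (simp add: has_derivative_snd[OF has_derivative_ident])

lemma linear_partial: "f differentiable (at x) \<Longrightarrow> linear (\<lambda>v. partial v f x)"
  using linear_frechet_derivative by (simp add: partial_def)

lemma partial_coordinate_sum:
  assumes "coordinate_basis B" "f differentiable (at x)"
  shows "partial v f x = (\<Sum>i\<in>B. (v \<bullet> i) *\<^sub>R partial i f x)"
  using linear_coordinate_sum[OF assms(1) linear_partial[OF assms(2)]] .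

section \<open>Locality and closure properties of the class \<open>C^k\<close>\<close>

lemma differentiable_transform_open:
  assumes "f differentiable (at x)" "open S" "x \<in> S" "\<And>y. y \<in> S \<Longrightarrow> f y = g y"
  shows "g differentiable (at x)"
  using assms unfolding differentiable_def by (metis has_derivative_transform_within_open)

text \<open>All derivatives are taken in the ambient space, so on an open set they depend only on
  the values there. This lets a function be replaced by a formula valid merely on
  \<open>S\<close>.\<close>

lemma higher_differentiable_on_cong:
  assumes "open S" "higher_differentiable_on S f k" "\<And>x. x \<in> S \<Longrightarrow> f x = g x"
  shows "higher_differentiable_on S g k"
  using assms(2,3)
proof (induction k arbitrary: f g)
  case 0
  then show ?case
    using continuous_on_cong by force
next
  case (Suc k)
  have "partial v f x = partial v g x" if "x \<in> S" for v x
    using Suc.prems frechet_derivative_transform_within_open[OF _ assms(1) that, of f g] that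
    by (simp add: partial_def)
  moreover have "g differentiable (at x)" if "x \<in> S" for x
    using Suc.prems differentiable_transform_open[OF _ assms(1) that, of f g] that by simp
  ultimately show ?case
    using Suc.IH Suc.prems(1) by (auto intro: Suc.IH)
qed

lemma higher_differentiable_on_subset:
  "higher_differentiable_on S f k \<Longrightarrow> T \<subseteq> S \<Longrightarrow> higher_differentiable_on T f k"
  by (induction k arbitrary: f) (auto intro: continuous_on_subset)

lemma higher_differentiable_on_SucD:
  "higher_differentiable_on S f (Suc k) \<Longrightarrow> higher_differentiable_on S f k"
proof (induction k arbitrary: f)
  case 0
  then show ?case
    by (auto intro!: continuous_at_imp_continuous_on differentiable_imp_continuous_within)
qed auto

text \<open>Differentiability is a condition at single points, and continuity is local too. The
  lemma patches smoothness together from small neighbourhoods in charts.\<close>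

lemma higher_differentiable_on_local:
  assumes "\<And>x. x \<in> S \<Longrightarrow> \<exists>T. open T \<and> x \<in> T \<and> higher_differentiable_on T f k"
  shows "higher_differentiable_on S f k"
  using assms
proof (induction k arbitrary: f)
  case 0
  then have "continuous (at x) f" if "x \<in> S" for x
    using that by (metis continuous_on_eq_continuous_at higher_differentiable_on.simps(1))
  then show ?case
    by (simp add: continuous_at_imp_continuous_on)
next
  case (Suc k)
  show ?case
    unfolding higher_differentiable_on.simps
  proof (intro conjI ballI allI)
    fix x assume "x \<in> S"
    then show "f differentiable at x"
      using Suc.prems by (metis higher_differentiable_on.simps(2))
  next
    fix v
    show "higher_differentiable_on S (partial v f) k"
      using Suc.prems by (intro Suc.IH) (meson higher_differentiable_on.simps(2))
  qed
qed

lemma higher_differentiable_on_const: "higher_differentiable_on S (\<lambda>x. c) k"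
  by (induction k arbitrary: c) (auto simp: partial_def[abs_def])

lemma higher_differentiable_on_linear:
  assumes "open S" "bounded_linear L" "higher_differentiable_on S f k"
  shows "higher_differentiable_on S (\<lambda>x. L (f x)) k"
  using assms(3)
proof (induction k arbitrary: f)
  case 0
  then show ?case
    using assms(2) by (auto intro: linear_continuous_on_compose bounded_linear.continuous_on)
next
  case (Suc k)
  have D: "((\<lambda>x. L (f x)) has_derivative (\<lambda>v. L (partial v f x))) (at x)" if "x \<in> S" for x
    using Suc.prems that
    by (intro bounded_linear.has_derivative[OF assms(2)] has_derivative_partial) auto
  have "higher_differentiable_on S (partial v (\<lambda>x. L (f x))) k" for v
    using Suc.prems
    by (rule_tac higher_differentiable_on_cong[OF assms(1) Suc.IH[of "partial v f"]])
       (auto intro: partial_eqI[OF D, symmetric])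
  then show ?case
    by (auto intro: differentiableI[OF D])
qed

lemma higher_differentiable_on_add:
  assumes "open S" "higher_differentiable_on S f k" "higher_differentiable_on S g k"
  shows "higher_differentiable_on S (\<lambda>x. f x + g x) k"
  using assms(2,3)
proof (induction k arbitrary: f g)
  case (Suc k)
  have D: "((\<lambda>x. f x + g x) has_derivative (\<lambda>v. partial v f x + partial v g x)) (at x)" if "x \<in> S" for x
    using Suc.prems that
    by (intro has_derivative_add has_derivative_partial) auto
  have "higher_differentiable_on S (partial v (\<lambda>x. f x + g x)) k" for v
    using Suc.prems
    by (rule_tac higher_differentiable_on_cong[OF assms(1) Suc.IH[of "partial v f" "partial v g"]])
       (auto intro: partial_eqI[OF D, symmetric])
  then show ?case
    by (auto intro: differentiableI[OF D])
qed (auto intro: continuous_intros)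

lemma higher_differentiable_on_bilinear:
  assumes "open S" "bounded_bilinear p" "higher_differentiable_on S f k" "higher_differentiable_on S g k"
  shows "higher_differentiable_on S (\<lambda>x. p (f x) (g x)) k"
  using assms(3,4)
proof (induction k arbitrary: f g)
  case 0
  then show ?case
    using bounded_bilinear.continuous_on[OF assms(2)] by auto
next
  case (Suc k)
  have D: "((\<lambda>x. p (f x) (g x)) has_derivative
      (\<lambda>v. p (f x) (partial v g x) + p (partial v f x) (g x))) (at x)" if "x \<in> S" for x
    using Suc.prems that
    by (intro bounded_bilinear.FDERIV[OF assms(2)] has_derivative_partial) auto
  have "higher_differentiable_on S (partial v (\<lambda>x. p (f x) (g x))) k" for v
  proof (rule higher_differentiable_on_cong[OF assms(1)])
    show "higher_differentiable_on S (\<lambda>x. p (f x) (partial v g x) + p (partial v f x) (g x)) k"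
      \<comment> \<open>In each summand the undifferentiated factor has class \<open>Suc k\<close>
        and is lowered to class \<open>k\<close> for the induction hypothesis.\<close>
      using Suc.prems Suc.prems[THEN higher_differentiable_on_SucD]
      by (intro higher_differentiable_on_add[OF assms(1)] Suc.IH) auto
  qed (rule partial_eqI[OF D, symmetric])
  then show ?case
    by (auto intro: differentiableI[OF D])
qed

lemma higher_differentiable_on_sum:
  assumes "open S" "\<And>i. i \<in> I \<Longrightarrow> higher_differentiable_on S (f i) k"
  shows "higher_differentiable_on S (\<lambda>x. \<Sum>i\<in>I. f i x) k"
proof (cases "finite I")
  case True
  then show ?thesis
    using assms(2)
    by (induction I rule: finite_induct)
       (auto intro: higher_differentiable_on_const higher_differentiable_on_add[OF assms(1)])
qed (simp add: higher_differentiable_on_const)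

text \<open>In the chain rule the direction \<open>partial v g x\<close> varies with
  \<open>x\<close>. Expanding it in \<open>C\<close> leaves the fixed-direction derivatives
  \<open>partial i f\<close>, composed with \<open>g\<close>, to which the induction hypothesis
  applies; the coefficients are handled by the product rule.\<close>

lemma higher_differentiable_on_compose:
  fixes g :: "'e::real_normed_vector \<Rightarrow> 'f::real_inner" and C :: "'f set"
  assumes "coordinate_basis C" "open S" "open T" "g ` S \<subseteq> T"
    and "higher_differentiable_on S g k" "higher_differentiable_on T f k"
  shows "higher_differentiable_on S (f \<circ> g) k"
  using assms(5,6)
proof (induction k arbitrary: f)
  case 0
  then show ?case
    using assms(4) by (auto simp: o_def intro: continuous_on_compose2)
next
  case (Suc k)
  have D: "((f \<circ> g) has_derivative (\<lambda>v. partial (partial v g x) f (g x))) (at x)" if "x \<in> S" for x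
  proof -
    have "(g has_derivative (\<lambda>v. partial v g x)) (at x)"
      using Suc.prems that by (auto intro: has_derivative_partial)
    moreover have "(f has_derivative (\<lambda>v. partial v f (g x))) (at (g x))"
      using Suc.prems(2) that assms(4) by (intro has_derivative_partial) auto
    ultimately show ?thesis
      using diff_chain_at by (fastforce simp: o_def)
  qed
  have "higher_differentiable_on S (partial v (f \<circ> g)) k" for v
  proof (rule higher_differentiable_on_cong[OF assms(2)])
    show "higher_differentiable_on S
        (\<lambda>x. \<Sum>i\<in>C. (partial v g x \<bullet> i) *\<^sub>R (partial i f \<circ> g) x) k"
      using Suc.prems Suc.prems(1)[THEN higher_differentiable_on_SucD]
      by (intro higher_differentiable_on_sum[OF assms(2)]
          higher_differentiable_on_bilinear[OF assms(2) bounded_bilinear_scaleR]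
          higher_differentiable_on_linear[OF assms(2) bounded_linear_inner_left] Suc.IH) auto
  next
    fix x assume x: "x \<in> S"
    have "f differentiable (at (g x))"
      using Suc.prems(2) x assms(4) by auto
    from partial_coordinate_sum[OF assms(1) this, of "partial v g x"] D[OF x]
    show "(\<Sum>i\<in>C. (partial v g x \<bullet> i) *\<^sub>R (partial i f \<circ> g) x) = partial v (f \<circ> g) x"
      by (simp add: partial_eqI)
  qed
  then show ?case
    using differentiableI[OF D] by (simp only: higher_differentiable_on.simps) blast
qed

section \<open>Closure properties of smooth functions\<close>

lemma smooth_on_cong:
  "open S \<Longrightarrow> smooth_on S f \<Longrightarrow> (\<And>x. x \<in> S \<Longrightarrow> f x = g x) \<Longrightarrow> smooth_on S g"
  unfolding smooth_on_def using higher_differentiable_on_cong by blast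

lemma smooth_on_subset: "smooth_on S f \<Longrightarrow> T \<subseteq> S \<Longrightarrow> smooth_on T f"
  unfolding smooth_on_def using higher_differentiable_on_subset by blast

lemma smooth_on_local:
  "(\<And>x. x \<in> S \<Longrightarrow> \<exists>T. open T \<and> x \<in> T \<and> smooth_on T f) \<Longrightarrow> smooth_on S f"
  unfolding smooth_on_def by (meson higher_differentiable_on_local)

lemma smooth_on_differentiable: "smooth_on S f \<Longrightarrow> x \<in> S \<Longrightarrow> f differentiable (at x)"
  unfolding smooth_on_def by (metis higher_differentiable_on.simps(2))

lemma smooth_on_partial: "smooth_on S f \<Longrightarrow> smooth_on S (partial v f)"
  unfolding smooth_on_def by (metis higher_differentiable_on.simps(2))

lemma smooth_on_continuous_on: "smooth_on S f \<Longrightarrow> continuous_on S f"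
  unfolding smooth_on_def by (metis higher_differentiable_on.simps(1))

lemma smooth_on_has_derivative:
  "smooth_on S f \<Longrightarrow> x \<in> S \<Longrightarrow> (f has_derivative frechet_derivative f (at x)) (at x)"
  using smooth_on_differentiable frechet_derivative_works by blast

lemma smooth_on_const: "smooth_on S (\<lambda>x. c)"
  unfolding smooth_on_def by (intro allI higher_differentiable_on_const)

lemma smooth_on_linear_comp:
  "open S \<Longrightarrow> bounded_linear L \<Longrightarrow> smooth_on S f \<Longrightarrow> smooth_on S (\<lambda>x. L (f x))"
  unfolding smooth_on_def using higher_differentiable_on_linear by blast

lemma smooth_on_add:
  "open S \<Longrightarrow> smooth_on S f \<Longrightarrow> smooth_on S g \<Longrightarrow> smooth_on S (\<lambda>x. f x + g x)"
  unfolding smooth_on_def using higher_differentiable_on_add by blast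

lemma smooth_on_bilinear:
  "open S \<Longrightarrow> bounded_bilinear p \<Longrightarrow> smooth_on S f \<Longrightarrow> smooth_on S g \<Longrightarrow>
    smooth_on S (\<lambda>x. p (f x) (g x))"
  unfolding smooth_on_def using higher_differentiable_on_bilinear by blast

lemma smooth_on_sum:
  "open S \<Longrightarrow> (\<And>i. i \<in> I \<Longrightarrow> smooth_on S (f i)) \<Longrightarrow> smooth_on S (\<lambda>x. \<Sum>i\<in>I. f i x)"
  unfolding smooth_on_def using higher_differentiable_on_sum[of S I f] by blast

lemma smooth_on_compose:
  fixes g :: "'e::real_normed_vector \<Rightarrow> 'f::real_inner" and C :: "'f set"
  shows "coordinate_basis C \<Longrightarrow> open S \<Longrightarrow> open T \<Longrightarrow> smooth_on S g \<Longrightarrow> smooth_on T f \<Longrightarrow> g ` S \<subseteq> T \<Longrightarrow>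
    smooth_on S (f \<circ> g)"
  unfolding smooth_on_def using higher_differentiable_on_compose[of C S T g] by blast

lemma smooth_on_bounded_linear:
  assumes "bounded_linear L"
  shows "smooth_on S L"
  unfolding smooth_on_def
proof
  fix k
  have D: "(L has_derivative L) (at x)" for x
    using bounded_linear.has_derivative[OF assms has_derivative_ident] by simp
  then have "partial v L = (\<lambda>x. L v)" for v
    by (auto simp: partial_eqI)
  then show "higher_differentiable_on S L k"
    using D linear_continuous_on[OF assms]
    by (cases k) (auto simp: differentiable_def higher_differentiable_on_const)
qed

text \<open>The pair is a sum of images under the two linear inclusions, which reduces the claim to
  sums and linear maps.\<close>

lemma smooth_on_Pair:
  assumes "open S" "smooth_on S f" "smooth_on S g"
  shows "smooth_on S (\<lambda>x. (f x, g x))"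
proof -
  have "smooth_on S (\<lambda>x. (f x, 0) + (0, g x))"
    by (intro smooth_on_add assms smooth_on_linear_comp[OF assms(1), of "\<lambda>y. (y, 0)"]
        smooth_on_linear_comp[OF assms(1), of "\<lambda>y. (0, y)"] bounded_linear_Pair
        bounded_linear_zero bounded_linear_ident)
  then show ?thesis by simp
qed

lemma smooth_on_compose_fst:
  fixes f :: "'e::real_inner \<Rightarrow> 'g::real_normed_vector" and T :: "'f::real_normed_vector set"
    and B :: "'e set"
  assumes "coordinate_basis B" "open S" "open T" "smooth_on S f"
  shows "smooth_on (S \<times> T) (\<lambda>z. f (fst z))"
  using smooth_on_compose[OF assms(1) open_Times[OF assms(2,3)] assms(2)
      smooth_on_bounded_linear[OF bounded_linear_fst] assms(4)]
  by (auto simp: o_def)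

lemma smooth_on_compose_snd:
  fixes f :: "'e::real_inner \<Rightarrow> 'g::real_normed_vector" and S :: "'f::real_normed_vector set"
    and B :: "'e set"
  assumes "coordinate_basis B" "open S" "open T" "smooth_on T f"
  shows "smooth_on (S \<times> T) (\<lambda>z. f (snd z))"
  using smooth_on_compose[OF assms(1) open_Times[OF assms(2,3)] assms(3)
      smooth_on_bounded_linear[OF bounded_linear_snd] assms(4)]
  by (auto simp: o_def)

subsection \<open>Symmetry of second derivatives\<close>

lemma has_real_derivative_along:
  fixes f :: "'e::real_normed_vector \<Rightarrow> real"
  assumes "f differentiable (at (y + s *\<^sub>R v))"
  shows "((\<lambda>s. f (y + s *\<^sub>R v)) has_real_derivative partial v f (y + s *\<^sub>R v)) (at s)"
proof -
  have "((\<lambda>s. y + s *\<^sub>R v) has_derivative (\<lambda>h. h *\<^sub>R v)) (at s)"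
    by (auto intro!: derivative_eq_intros)
  from diff_chain_at[OF this has_derivative_partial[OF assms]]
  have "((\<lambda>s. f (y + s *\<^sub>R v)) has_derivative (\<lambda>h. partial (h *\<^sub>R v) f (y + s *\<^sub>R v))) (at s)"
    by (simp add: o_def)
  moreover have "partial (h *\<^sub>R v) f (y + s *\<^sub>R v) = partial v f (y + s *\<^sub>R v) * h" for h
    using linear_scale[OF linear_partial[OF assms]] by simp
  ultimately show ?thesis
    by (simp add: has_field_derivative_def)
qed

text \<open>The mean value theorem is applied twice: along \<open>v\<close> to the difference of two
  shifted copies of \<open>f\<close>, then along \<open>w\<close> to \<open>partial v f\<close>. The
  second difference is symmetric in \<open>v\<close> and \<open>w\<close>, the mixed derivative is
  not visibly so.\<close>

lemma second_difference_mvt: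
  fixes f :: "'e::real_normed_vector \<Rightarrow> real"
  assumes h: "0 < h"
    and S: "\<And>s t. 0 \<le> s \<Longrightarrow> s \<le> h \<Longrightarrow> 0 \<le> t \<Longrightarrow> t \<le> h \<Longrightarrow> x + s *\<^sub>R v + t *\<^sub>R w \<in> S"
    and f: "\<And>y. y \<in> S \<Longrightarrow> f differentiable (at y)"
    and fv: "\<And>y. y \<in> S \<Longrightarrow> partial v f differentiable (at y)"
  shows "\<exists>s t. 0 \<le> s \<and> s \<le> h \<and> 0 \<le> t \<and> t \<le> h \<and>
    f (x + h *\<^sub>R v + h *\<^sub>R w) - f (x + h *\<^sub>R v) - f (x + h *\<^sub>R w) + f x
      = h * h * partial w (partial v f) (x + s *\<^sub>R v + t *\<^sub>R w)"
proof -
  define g where "g s = f ((x + h *\<^sub>R w) + s *\<^sub>R v) - f (x + s *\<^sub>R v)" for s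
  have g: "(g has_real_derivative
      partial v f ((x + h *\<^sub>R w) + s *\<^sub>R v) - partial v f (x + s *\<^sub>R v)) (at s)"
    if "0 \<le> s" "s \<le> h" for s
  proof -
    have "(x + h *\<^sub>R w) + s *\<^sub>R v \<in> S"
      using S[OF that, of h] h by (simp add: algebra_simps)
    moreover have "x + s *\<^sub>R v \<in> S"
      using S[OF that, of 0] h by simp
    ultimately show ?thesis
      unfolding g_def[abs_def]
      by (intro DERIV_diff has_real_derivative_along f)
  qed
  obtain s where s: "0 < s" "s < h"
    and gs: "g h - g 0 = (h - 0) * (partial v f ((x + h *\<^sub>R w) + s *\<^sub>R v) - partial v f (x + s *\<^sub>R v))"
    using MVT2[OF h g] by blast
  have "((\<lambda>t. partial v f ((x + s *\<^sub>R v) + t *\<^sub>R w)) has_real_derivative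
      partial w (partial v f) ((x + s *\<^sub>R v) + t *\<^sub>R w)) (at t)" if "0 \<le> t" "t \<le> h" for t
    using S[of s t] s that by (intro has_real_derivative_along fv) auto
  from MVT2[OF h this] obtain t where t: "0 < t" "t < h"
    and pt: "partial v f ((x + s *\<^sub>R v) + h *\<^sub>R w) - partial v f ((x + s *\<^sub>R v) + 0 *\<^sub>R w)
      = (h - 0) * partial w (partial v f) ((x + s *\<^sub>R v) + t *\<^sub>R w)"
    by blast
  have "f (x + h *\<^sub>R v + h *\<^sub>R w) - f (x + h *\<^sub>R v) - f (x + h *\<^sub>R w) + f x = g h - g 0"
    by (simp add: g_def algebra_simps)
  also have "\<dots> = h * (partial v f ((x + s *\<^sub>R v) + h *\<^sub>R w) - partial v f (x + s *\<^sub>R v))"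
    using gs by (simp add: algebra_simps)
  also have "\<dots> = h * h * partial w (partial v f) (x + s *\<^sub>R v + t *\<^sub>R w)"
    using pt by simp
  finally show ?thesis
    using s t by (intro exI[of _ s] exI[of _ t]) auto
qed

text \<open>Evaluating the symmetric second difference in both orders makes the two mixed
  derivatives take equal values at two possibly different points close to \<open>x\<close>.
  Continuity then excludes a gap at \<open>x\<close>.\<close>

lemma partial_commute_real:
  fixes f :: "'e::real_normed_vector \<Rightarrow> real"
  assumes S: "open S" "x \<in> S" and f: "smooth_on S f"
  shows "partial v (partial w f) x = partial w (partial v f) x"
proof (rule ccontr)
  let ?a = "partial v (partial w f)" and ?b = "partial w (partial v f)"
  assume neq: "?a x \<noteq> ?b x"
  \<comment> \<open>Half of the supposed gap: a value within \<open>e\<close> of \<open>?a x\<close>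
    cannot equal one within \<open>e\<close> of \<open>?b x\<close>.\<close>
  define e where "e = \<bar>?a x - ?b x\<bar> / 2"
  have e: "e > 0"
    using neq by (simp add: e_def)
  have "isCont ?a x" "isCont ?b x"
    using S smooth_on_continuous_on smooth_on_partial f
    by (metis continuous_on_eq_continuous_at)+
  then obtain da db where da: "da > 0" "\<And>y. dist y x < da \<Longrightarrow> dist (?a y) (?a x) < e"
    and db: "db > 0" "\<And>y. dist y x < db \<Longrightarrow> dist (?b y) (?b x) < e"
    using e unfolding continuous_at_eps_delta by metis
  obtain ds where ds: "ds > 0" "ball x ds \<subseteq> S"
    using S openE by blast
  define d where "d = min ds (min da db)"
  \<comment> \<open>Displacements by \<open>s *\<^sub>R v + t *\<^sub>R w\<close> with
    \<open>s\<close> and \<open>t\<close> at most \<open>h\<close> stay shorter than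
    \<open>d\<close>; the summand 1 keeps the denominator positive when both directions
    vanish.\<close>
  define h where "h = d / (2 * (norm v + norm w + 1))"
  have d: "d > 0"
    using da db ds by (simp add: d_def)
  have h: "h > 0"
    unfolding h_def using d
    by (intro divide_pos_pos mult_pos_pos) (auto simp: add_nonneg_pos)
  \<comment> \<open>Stated for any two directions with the same total norm, so that it serves the
    order \<open>v\<close>, \<open>w\<close> as well as \<open>w\<close>, \<open>v\<close>.\<close>
  have near: "dist (x + s *\<^sub>R v' + t *\<^sub>R w') x < d"
    if "0 \<le> s" "s \<le> h" "0 \<le> t" "t \<le> h" "norm v' + norm w' = norm v + norm w" for s t v' w'
  proof -
    have "dist (x + s *\<^sub>R v' + t *\<^sub>R w') x \<le> norm (s *\<^sub>R v') + norm (t *\<^sub>R w')"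
      using norm_triangle_ineq[of "s *\<^sub>R v'" "t *\<^sub>R w'"] by (simp add: dist_norm add.assoc)
    also have "\<dots> \<le> h * norm v' + h * norm w'"
      using that by (auto intro!: add_mono mult_right_mono)
    also have "\<dots> = h * (norm v + norm w)"
      using that(5) by (simp add: distrib_left[symmetric])
    also have "\<dots> < h * (2 * (norm v + norm w + 1))"
      using h by (intro mult_strict_left_mono) (auto simp: add_nonneg_pos)
    also have "\<dots> = d"
      using norm_ge_zero[of v] norm_ge_zero[of w] by (simp add: h_def del: norm_ge_zero)
    finally show ?thesis .
  qed
  have inS: "x + s *\<^sub>R v' + t *\<^sub>R w' \<in> S"
    if "0 \<le> s" "s \<le> h" "0 \<le> t" "t \<le> h" "norm v' + norm w' = norm v + norm w" for s t v' w'
    using near[OF that] ds by (auto simp: d_def dist_commute subset_eq)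
  have "\<exists>s t. 0 \<le> s \<and> s \<le> h \<and> 0 \<le> t \<and> t \<le> h \<and>
      f (x + h *\<^sub>R v + h *\<^sub>R w) - f (x + h *\<^sub>R v) - f (x + h *\<^sub>R w) + f x
        = h * h * ?b (x + s *\<^sub>R v + t *\<^sub>R w)"
    using f by (intro second_difference_mvt[OF h inS])
      (auto intro: smooth_on_differentiable smooth_on_partial)
  then obtain s t where st: "0 \<le> s" "s \<le> h" "0 \<le> t" "t \<le> h"
    and B: "f (x + h *\<^sub>R v + h *\<^sub>R w) - f (x + h *\<^sub>R v) - f (x + h *\<^sub>R w) + f x
        = h * h * ?b (x + s *\<^sub>R v + t *\<^sub>R w)"
    by blast
  have "\<exists>s t. 0 \<le> s \<and> s \<le> h \<and> 0 \<le> t \<and> t \<le> h \<and>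
      f (x + h *\<^sub>R w + h *\<^sub>R v) - f (x + h *\<^sub>R w) - f (x + h *\<^sub>R v) + f x
        = h * h * ?a (x + s *\<^sub>R w + t *\<^sub>R v)"
    using f by (intro second_difference_mvt[OF h inS])
      (auto intro: smooth_on_differentiable smooth_on_partial)
  then obtain s' t' where st': "0 \<le> s'" "s' \<le> h" "0 \<le> t'" "t' \<le> h"
    and A: "f (x + h *\<^sub>R w + h *\<^sub>R v) - f (x + h *\<^sub>R w) - f (x + h *\<^sub>R v) + f x
        = h * h * ?a (x + s' *\<^sub>R w + t' *\<^sub>R v)"
    by blast
  have "x + h *\<^sub>R w + h *\<^sub>R v = x + h *\<^sub>R v + h *\<^sub>R w"
    by (simp add: algebra_simps)
  from A[unfolded this] B have "h * h * ?a (x + s' *\<^sub>R w + t' *\<^sub>R v) = h * h * ?b (x + s *\<^sub>R v + t *\<^sub>R w)"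
    by linarith
  then have ab: "?a (x + s' *\<^sub>R w + t' *\<^sub>R v) = ?b (x + s *\<^sub>R v + t *\<^sub>R w)"
    using h by simp
  have "dist (?a (x + s' *\<^sub>R w + t' *\<^sub>R v)) (?a x) < e"
    using near[OF st', of w v] by (intro da(2)) (simp add: d_def)
  moreover have "dist (?b (x + s *\<^sub>R v + t *\<^sub>R w)) (?b x) < e"
    using near[OF st, of v w] by (intro db(2)) (simp add: d_def)
  ultimately show False
    unfolding ab e_def dist_real_def by (simp add: field_simps abs_if split: if_splits)
qed

lemma partial_inner:
  "f differentiable (at x) \<Longrightarrow> partial v (\<lambda>x. f x \<bullet> k) x = partial v f x \<bullet> k"
  by (rule partial_eqI) (intro has_derivative_inner_left has_derivative_partial)

text \<open>Both sides are compared after pairing with an arbitrary vector \<open>k\<close>, which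
  reduces the claim to real-valued functions.\<close>

lemma partial_commute:
  fixes f :: "'e::real_normed_vector \<Rightarrow> 'f::real_inner"
  assumes S: "open S" "x \<in> S" and f: "smooth_on S f"
  shows "partial v (partial w f) x = partial w (partial v f) x"
proof -
  have *: "partial v (partial w f) x \<bullet> k = partial v (partial w (\<lambda>x. f x \<bullet> k)) x" for v w k
  proof -
    have "partial v (partial w f) x \<bullet> k = partial v (\<lambda>x. partial w f x \<bullet> k) x"
      using partial_inner[OF smooth_on_differentiable[OF smooth_on_partial[OF f] S(2)]] by simp
    also have "\<dots> = partial v (partial w (\<lambda>x. f x \<bullet> k)) x"
      unfolding partial_def[of v]
      using S smooth_on_differentiable[OF smooth_on_partial[OF f]]
      by (intro fun_cong[OF frechet_derivative_transform_within_open])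
         (auto simp: partial_inner[OF smooth_on_differentiable[OF f]] intro: differentiable_inner)
    finally show ?thesis .
  qed
  have "smooth_on S (\<lambda>x. f x \<bullet> k)" for k
    using smooth_on_linear_comp[OF S(1) bounded_linear_inner_left f] .
  from partial_commute_real[OF S this]
  have "partial v (partial w f) x \<bullet> k = partial w (partial v f) x \<bullet> k" for k
    by (simp add: *)
  then show ?thesis
    by (metis vector_eq_ldot inner_commute)
qed

subsection \<open>The tangent map of a function between model spaces\<close>

definition tangent_fun ::
    "('e::real_normed_vector \<Rightarrow> 'f::real_normed_vector) \<Rightarrow> 'e \<times> 'e \<Rightarrow> 'f \<times> 'f" where
  "tangent_fun f = (\<lambda>(x, \<xi>). (f x, frechet_derivative f (at x) \<xi>))"

text \<open>Expanding \<open>\<xi>\<close> in \<open>B\<close> exhibits the expression as a sum of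
  products of a linear function of \<open>\<xi>\<close> and a smooth function of \<open>x\<close>,
  which gives joint smoothness.\<close>

lemma smooth_on_frechet_derivative:
  fixes f :: "'e::real_inner \<Rightarrow> 'f::real_normed_vector" and B :: "'e set"
  assumes "coordinate_basis B" "open S" "smooth_on S f"
  shows "smooth_on (S \<times> UNIV) (\<lambda>(x, \<xi>). frechet_derivative f (at x) \<xi>)"
proof (rule smooth_on_cong)
  show o: "open (S \<times> (UNIV :: 'e set))"
    using assms(2) by (simp add: open_Times)
  show "smooth_on (S \<times> UNIV) (\<lambda>z. \<Sum>i\<in>B. (snd z \<bullet> i) *\<^sub>R partial i f (fst z))"
    by (intro smooth_on_sum[OF o] smooth_on_bilinear[OF o bounded_bilinear_scaleR]
        smooth_on_compose_fst[OF assms(1,2)] smooth_on_partial assms(3) open_UNIV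
        smooth_on_bounded_linear bounded_linear_compose[OF bounded_linear_inner_left]
        bounded_linear_snd)
  fix z assume "z \<in> S \<times> (UNIV :: 'e set)"
  then show "(\<Sum>i\<in>B. (snd z \<bullet> i) *\<^sub>R partial i f (fst z))
      = (case z of (x, \<xi>) \<Rightarrow> frechet_derivative f (at x) \<xi>)"
    using partial_coordinate_sum[OF assms(1) smooth_on_differentiable[OF assms(3)]]
    by (auto simp: partial_def)
qed

lemma smooth_on_tangent_fun:
  fixes f :: "'e::real_inner \<Rightarrow> 'f::real_normed_vector" and B :: "'e set"
  assumes "coordinate_basis B" "open S" "smooth_on S f"
  shows "smooth_on (S \<times> UNIV) (tangent_fun f)"
proof -
  have "smooth_on (S \<times> UNIV) (\<lambda>z. (f (fst z), (\<lambda>(x, \<xi>). frechet_derivative f (at x) \<xi>) z))"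
    by (intro smooth_on_Pair smooth_on_frechet_derivative[OF assms] smooth_on_compose_fst[OF assms(1,2)]
        open_UNIV assms open_Times)
  then show ?thesis
    by (simp add: tangent_fun_def split_def)
qed

text \<open>The expression is linear in \<open>\<xi>\<close>, so moving \<open>x\<close> yields a
  second derivative and moving \<open>\<xi>\<close> a first derivative. The expansion in
  \<open>B\<close> fixes the directions of differentiation, so that the product rule
  applies.\<close>

lemma frechet_derivative_fst_arg:
  fixes f :: "'e::real_inner \<Rightarrow> 'f::real_normed_vector" and B :: "'e set"
  assumes "coordinate_basis B" "open S" "smooth_on S f" "x \<in> S"
  shows "((\<lambda>(x, \<xi>). frechet_derivative f (at x) \<xi>) has_derivative
    (\<lambda>(a, b). partial a (partial \<xi> f) x + partial b f x)) (at (x, \<xi>))"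
proof -
  let ?g = "\<lambda>z. \<Sum>i\<in>B. (snd z \<bullet> i) *\<^sub>R partial i f (fst z)"
  have D: "((\<lambda>z. partial i f (fst z)) has_derivative (\<lambda>z. partial (fst z) (partial i f) x)) (at (x, \<xi>))" for i
    by (rule has_derivative_compose_fst[OF has_derivative_partial])
       (rule smooth_on_differentiable[OF smooth_on_partial[OF assms(3)] assms(4)])
  have "(?g has_derivative (\<lambda>z. \<Sum>i\<in>B. (\<xi> \<bullet> i) *\<^sub>R partial (fst z) (partial i f) x
      + (snd z \<bullet> i) *\<^sub>R partial i f x)) (at (x, \<xi>))"
    by (rule derivative_eq_intros D refl | simp)+
  moreover have "?g z = (case z of (x, \<xi>) \<Rightarrow> frechet_derivative f (at x) \<xi>)" if "z \<in> S \<times> UNIV" for z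
    using partial_coordinate_sum[OF assms(1) smooth_on_differentiable[OF assms(3)]] that
    by (auto simp: partial_def)
  moreover have "(\<lambda>z. \<Sum>i\<in>B. (\<xi> \<bullet> i) *\<^sub>R partial (fst z) (partial i f) x + (snd z \<bullet> i) *\<^sub>R partial i f x)
      = (\<lambda>(a, b). partial a (partial \<xi> f) x + partial b f x)"
  proof (clarsimp simp: fun_eq_iff sum.distrib)
    fix a b
    \<comment> \<open>Near \<open>x\<close> the sum with coefficients
      \<open>\<xi> \<bullet> i\<close> is \<open>partial \<xi> f\<close> itself, so its derivative
      can be read as a second directional derivative.\<close>
    have "((\<lambda>y. \<Sum>i\<in>B. (\<xi> \<bullet> i) *\<^sub>R partial i f y) has_derivative
        (\<lambda>a. \<Sum>i\<in>B. (\<xi> \<bullet> i) *\<^sub>R partial a (partial i f) x)) (at x)"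
      using smooth_on_differentiable[OF smooth_on_partial[OF assms(3)] assms(4)]
      by (intro has_derivative_sum has_derivative_scaleR_right has_derivative_partial) auto
    then have "(partial \<xi> f has_derivative (\<lambda>a. \<Sum>i\<in>B. (\<xi> \<bullet> i) *\<^sub>R partial a (partial i f) x)) (at x)"
      using partial_coordinate_sum[OF assms(1) smooth_on_differentiable[OF assms(3)], symmetric] assms(2,4)
      by (blast intro: has_derivative_transform_within_open)
    then have "(\<Sum>i\<in>B. (\<xi> \<bullet> i) *\<^sub>R partial a (partial i f) x) = partial a (partial \<xi> f) x"
      by (simp add: partial_eqI)
    moreover have "(\<Sum>i\<in>B. (b \<bullet> i) *\<^sub>R partial i f x) = partial b f x"
      using partial_coordinate_sum[OF assms(1) smooth_on_differentiable[OF assms(3,4)], symmetric] .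
    ultimately show "(\<Sum>i\<in>B. (\<xi> \<bullet> i) *\<^sub>R partial a (partial i f) x) + (\<Sum>i\<in>B. (b \<bullet> i) *\<^sub>R partial i f x)
        = partial a (partial \<xi> f) x + partial b f x"
      by simp
  qed
  ultimately show ?thesis
    using has_derivative_transform_within_open[of ?g _ "(x, \<xi>)" UNIV "S \<times> UNIV"] assms(2,4)
    by (auto simp: open_Times)
qed

text \<open>This is the block Jacobian of the tangent map. Symmetry of second derivatives puts
  \<open>\<xi>\<close> outermost, so that the lower left block is the derivative along
  \<open>\<xi>\<close> of the columns \<open>partial a f\<close> of the Jacobian of
  \<open>f\<close>.\<close>

lemma has_derivative_tangent_fun:
  fixes f :: "'e::real_inner \<Rightarrow> 'f::real_inner" and B :: "'e set"
  assumes "coordinate_basis B" "open S" "smooth_on S f" "x \<in> S"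
  shows "(tangent_fun f has_derivative
    (\<lambda>(a, b). (partial a f x, partial \<xi> (partial a f) x + partial b f x))) (at (x, \<xi>))"
proof -
  have "((\<lambda>z. f (fst z)) has_derivative (\<lambda>z. partial (fst z) f x)) (at (x, \<xi>))"
    by (rule has_derivative_compose_fst[OF has_derivative_partial])
       (rule smooth_on_differentiable[OF assms(3,4)])
  from has_derivative_Pair[OF this frechet_derivative_fst_arg[OF assms]]
  show ?thesis
    by (simp add: tangent_fun_def split_def partial_commute[OF assms(2,4,3)])
qed

section \<open>Charts and smooth maps\<close>

lemma smooth_atlas_inj: "smooth_atlas A \<Longrightarrow> c \<in> A \<Longrightarrow> inj_on (snd c) (fst c)"
  by (simp add: smooth_atlas_def)

lemma smooth_atlas_open: "smooth_atlas A \<Longrightarrow> c \<in> A \<Longrightarrow> open (snd c ` fst c)"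
  by (simp add: smooth_atlas_def)

lemma smooth_atlas_open_Int: "smooth_atlas A \<Longrightarrow> c \<in> A \<Longrightarrow> d \<in> A \<Longrightarrow> open (snd c ` (fst c \<inter> fst d))"
  by (simp add: smooth_atlas_def)

lemma smooth_atlas_transition:
  "smooth_atlas A \<Longrightarrow> c \<in> A \<Longrightarrow> d \<in> A \<Longrightarrow>
    smooth_on (snd c ` (fst c \<inter> fst d)) (snd d \<circ> chart_inv c)"
  by (simp add: smooth_atlas_def)

lemma chart_inv_left: "smooth_atlas A \<Longrightarrow> c \<in> A \<Longrightarrow> p \<in> fst c \<Longrightarrow> chart_inv c (snd c p) = p"
  by (simp add: chart_inv_def inv_into_f_f smooth_atlas_inj)

lemma chart_inv_right: "x \<in> snd c ` fst c \<Longrightarrow> snd c (chart_inv c x) = x"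
  by (simp add: chart_inv_def f_inv_into_f)

lemma chart_inv_in: "x \<in> snd c ` fst c \<Longrightarrow> chart_inv c x \<in> fst c"
  by (simp add: chart_inv_def inv_into_into)

lemma mem_chart_image:
  assumes "smooth_atlas A" "c \<in> A"
  shows "x \<in> snd c ` (fst c \<inter> W) \<longleftrightarrow> x \<in> snd c ` fst c \<and> chart_inv c x \<in> W"
proof
  assume "x \<in> snd c ` fst c \<and> chart_inv c x \<in> W"
  then have "x = snd c (chart_inv c x)" "chart_inv c x \<in> fst c \<inter> W"
    by (auto simp: chart_inv_right chart_inv_in)
  then show "x \<in> snd c ` (fst c \<inter> W)"
    by (rule image_eqI)
qed (auto simp: chart_inv_left[OF assms])

lemma pointsE:
  assumes "p \<in> points A"
  obtains c where "c \<in> A" "p \<in> fst c"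
  using assms unfolding points_def by blast

lemma in_points: "c \<in> A \<Longrightarrow> p \<in> fst c \<Longrightarrow> p \<in> points A"
  by (auto simp: points_def)

lemma chart_subset_points: "c \<in> A \<Longrightarrow> fst c \<subseteq> points A"
  by (auto simp: points_def)

lemma topspace_manifold_topology:
  assumes "smooth_atlas A"
  shows "topspace (manifold_topology A) = points A"
proof -
  have "openin (manifold_topology A) (points A)"
    using assms by (auto simp: openin_manifold_topology Int_absorb1 chart_subset_points smooth_atlas_open)
  then show ?thesis
    by (metis openin_manifold_topology[OF assms] openin_subset openin_topspace subset_antisym)
qed

text \<open>In any chart of the atlas the set becomes the preimage of \<open>V\<close> under a
  continuous transition map.\<close>

lemma openin_chart_vimage:
  assumes "smooth_atlas A" "c \<in> A" "open V"
  shows "openin (manifold_topology A) {p \<in> fst c. snd c p \<in> V}"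
  unfolding openin_manifold_topology[OF assms(1)]
proof (intro conjI ballI)
  fix d assume d: "d \<in> A"
  have "snd d ` ({p \<in> fst c. snd c p \<in> V} \<inter> fst d)
      = snd d ` (fst d \<inter> fst c) \<inter> (snd c \<circ> chart_inv d) -` V"
    using chart_inv_left[OF assms(1) d] by force
  moreover have "open \<dots>"
    using d assms by (intro continuous_open_preimage smooth_on_continuous_on
        smooth_atlas_transition smooth_atlas_open_Int)
  ultimately show "open (snd d ` ({p \<in> fst c. snd c p \<in> V} \<inter> fst d))"
    by simp
qed (use assms(2) in \<open>auto simp: points_def\<close>)

lemma openin_chart: "smooth_atlas A \<Longrightarrow> c \<in> A \<Longrightarrow> openin (manifold_topology A) (fst c)"
  using openin_chart_vimage[of A c UNIV] by simp

lemma smooth_map_in_points: "smooth_map A A' \<phi> \<Longrightarrow> smooth_atlas A \<Longrightarrow> smooth_atlas A' \<Longrightarrow>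
    p \<in> points A \<Longrightarrow> \<phi> p \<in> points A'"
  unfolding smooth_map_def
  by (metis continuous_map_image_subset_topspace imageI subsetD topspace_manifold_topology)

lemma smooth_map_open:
  assumes "smooth_atlas A" "smooth_atlas A'" "smooth_map A A' \<phi>" "c \<in> A" "d \<in> A'"
  shows "open (snd c ` (fst c \<inter> \<phi> -` fst d))"
proof -
  have "openin (manifold_topology A) {p \<in> topspace (manifold_topology A). \<phi> p \<in> fst d}"
    using assms(3) openin_continuous_map_preimage[OF _ openin_chart[OF assms(2,5)]]
    by (auto simp: smooth_map_def)
  then have "open (snd c ` ({p \<in> points A. \<phi> p \<in> fst d} \<inter> fst c))"
    using assms by (simp add: openin_manifold_topology topspace_manifold_topology)
  moreover have "{p \<in> points A. \<phi> p \<in> fst d} \<inter> fst c = fst c \<inter> \<phi> -` fst d"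
    using assms(4) by (auto simp: points_def)
  ultimately show ?thesis
    by simp
qed

lemma smooth_map_smooth_on:
  "smooth_map A A' \<phi> \<Longrightarrow> c \<in> A \<Longrightarrow> d \<in> A' \<Longrightarrow>
    smooth_on (snd c ` (fst c \<inter> \<phi> -` fst d)) (snd d \<circ> \<phi> \<circ> chart_inv c)"
  by (simp add: smooth_map_def)

text \<open>\<open>smooth_map\<close> demands continuity and smoothness in all pairs of charts. One
  pair of charts and one neighbourhood per point suffice, since transition maps are smooth;
  continuity follows from that of the local representatives.\<close>

lemma smooth_mapI:
  fixes A :: "('a, 'e::real_inner) atlas" and A' :: "('b, 'f::real_inner) atlas"
  assumes B: "coordinate_basis (B :: 'e set)" "coordinate_basis (B' :: 'f set)"
    and A: "smooth_atlas A" "smooth_atlas A'"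
    and loc: "\<And>p. p \<in> points A \<Longrightarrow> \<exists>c\<in>A. \<exists>d\<in>A'. \<exists>V. p \<in> fst c \<and> open V \<and> snd c p \<in> V \<and>
      V \<subseteq> snd c ` fst c \<and> \<phi> ` chart_inv c ` V \<subseteq> fst d \<and> smooth_on V (snd d \<circ> \<phi> \<circ> chart_inv c)"
  shows "smooth_map A A' \<phi>"
proof -
  \<comment> \<open>Change of the source chart: the chart \<open>c\<close> supplied by
    \<open>loc\<close> gives way to an arbitrary chart \<open>c0\<close> around \<open>p\<close>, at
    the price of shrinking the neighbourhood.\<close>
  have nbhd: "\<exists>c\<in>A. \<exists>d\<in>A'. \<exists>V. p \<in> fst c \<and> open V \<and> snd c0 p \<in> V \<and> V \<subseteq> snd c0 ` (fst c0 \<inter> fst c) \<and>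
      \<phi> ` chart_inv c0 ` V \<subseteq> fst d \<and> smooth_on V (snd d \<circ> \<phi> \<circ> chart_inv c0)"
    if c0: "c0 \<in> A" and p: "p \<in> fst c0" for p c0
  proof -
    obtain c d V where c: "c \<in> A" "p \<in> fst c" and d: "d \<in> A'" and V: "open V" "snd c p \<in> V"
      "V \<subseteq> snd c ` fst c" "\<phi> ` chart_inv c ` V \<subseteq> fst d" "smooth_on V (snd d \<circ> \<phi> \<circ> chart_inv c)"
      using loc[OF in_points[OF c0 p]] by blast
    let ?t = "snd c \<circ> chart_inv c0"
    define N where "N = snd c0 ` (fst c0 \<inter> fst c) \<inter> ?t -` V"
    have inv: "chart_inv c (?t x) = chart_inv c0 x" if "x \<in> N" for x
      using that c0 c A by (auto simp: N_def chart_inv_left)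
    have N: "open N"
      unfolding N_def using c c0 V A
      by (intro continuous_open_preimage smooth_on_continuous_on smooth_atlas_transition smooth_atlas_open_Int)
    have tN: "smooth_on N ?t"
      using smooth_atlas_transition[OF A(1) c0 c(1)] by (rule smooth_on_subset) (auto simp: N_def)
    have "smooth_on N ((snd d \<circ> \<phi> \<circ> chart_inv c) \<circ> ?t)"
      by (rule smooth_on_compose[OF B(1) N V(1) tN V(5)]) (auto simp: N_def)
    then have "smooth_on N (snd d \<circ> \<phi> \<circ> chart_inv c0)"
      by (rule smooth_on_cong[OF N]) (use inv in simp)
    moreover have "snd c0 p \<in> N"
      using c0 c p V A by (auto simp: N_def chart_inv_left)
    moreover have "\<phi> ` chart_inv c0 ` N \<subseteq> fst d"
    proof clarify
      fix x assume "x \<in> N"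
      then show "\<phi> (chart_inv c0 x) \<in> fst d"
        using inv[of x] V(4) by (auto simp: N_def image_subset_iff)
    qed
    ultimately show ?thesis
      using c d N by (intro bexI[of _ c] bexI[of _ d] exI[of _ N]) (auto simp: N_def)
  qed
  \<comment> \<open>Change of the target chart. Smoothness and openness of preimages use the same
    neighbourhood, cut down to where the image, read in \<open>d\<close>, lies in the prescribed
    set.\<close>
  have sm: "smooth_on (snd c0 ` (fst c0 \<inter> \<phi> -` fst d0)) (snd d0 \<circ> \<phi> \<circ> chart_inv c0)"
    and op: "W \<subseteq> points A' \<Longrightarrow> (\<And>d. d \<in> A' \<Longrightarrow> open (snd d ` (W \<inter> fst d))) \<Longrightarrow>
      open (snd c0 ` (fst c0 \<inter> \<phi> -` W))"
    if c0: "c0 \<in> A" and d0: "d0 \<in> A'" for c0 d0 W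
  proof -
    show "smooth_on (snd c0 ` (fst c0 \<inter> \<phi> -` fst d0)) (snd d0 \<circ> \<phi> \<circ> chart_inv c0)"
    proof (rule smooth_on_local, clarsimp)
      fix p assume p: "p \<in> fst c0" "\<phi> p \<in> fst d0"
      obtain c d V where c: "c \<in> A" "p \<in> fst c" and d: "d \<in> A'" and V: "open V" "snd c0 p \<in> V"
        "V \<subseteq> snd c0 ` (fst c0 \<inter> fst c)" "\<phi> ` chart_inv c0 ` V \<subseteq> fst d" "smooth_on V (snd d \<circ> \<phi> \<circ> chart_inv c0)"
        using nbhd[OF c0 p(1)] by blast
      let ?D = "snd d ` (fst d \<inter> fst d0)"
      define N where "N = V \<inter> (snd d \<circ> \<phi> \<circ> chart_inv c0) -` ?D"
      have D: "open ?D"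
        using A d d0 by (simp add: smooth_atlas_open_Int)
      have N: "open N"
        unfolding N_def using V D by (intro continuous_open_preimage smooth_on_continuous_on)
      have "smooth_on N ((snd d0 \<circ> chart_inv d) \<circ> (snd d \<circ> \<phi> \<circ> chart_inv c0))"
        by (rule smooth_on_compose[OF B(2) N D smooth_on_subset[OF V(5)]
            smooth_atlas_transition[OF A(2) d d0]]) (auto simp: N_def)
      then have "smooth_on N (snd d0 \<circ> \<phi> \<circ> chart_inv c0)"
      proof (rule smooth_on_cong[OF N])
        fix x assume "x \<in> N"
        then have "\<phi> (chart_inv c0 x) \<in> fst d"
          using V(4) by (auto simp: N_def)
        then show "((snd d0 \<circ> chart_inv d) \<circ> (snd d \<circ> \<phi> \<circ> chart_inv c0)) x = (snd d0 \<circ> \<phi> \<circ> chart_inv c0) x"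
          using chart_inv_left[OF A(2) d] by simp
      qed
      moreover have "snd c0 p \<in> N"
        using V p chart_inv_left[OF A(1) c0 p(1)] by (force simp: N_def)
      ultimately show "\<exists>T. open T \<and> snd c0 p \<in> T \<and> smooth_on T (snd d0 \<circ> \<phi> \<circ> chart_inv c0)"
        using N by blast
    qed
    show "open (snd c0 ` (fst c0 \<inter> \<phi> -` W))"
      if W: "W \<subseteq> points A'" "\<And>d. d \<in> A' \<Longrightarrow> open (snd d ` (W \<inter> fst d))"
    proof (subst open_subopen, clarsimp)
      fix p assume p: "p \<in> fst c0" "\<phi> p \<in> W"
      obtain c d V where c: "c \<in> A" "p \<in> fst c" and d: "d \<in> A'" and V: "open V" "snd c0 p \<in> V"
        "V \<subseteq> snd c0 ` (fst c0 \<inter> fst c)" "\<phi> ` chart_inv c0 ` V \<subseteq> fst d" "smooth_on V (snd d \<circ> \<phi> \<circ> chart_inv c0)"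
        using nbhd[OF c0 p(1)] by blast
      let ?D = "snd d ` (W \<inter> fst d)"
      define N where "N = V \<inter> (snd d \<circ> \<phi> \<circ> chart_inv c0) -` ?D"
      have "open N"
        unfolding N_def using V W(2)[OF d] by (intro continuous_open_preimage smooth_on_continuous_on)
      moreover have "snd c0 p \<in> N"
        using V p chart_inv_left[OF A(1) c0 p(1)] by (force simp: N_def)
      moreover have "N \<subseteq> snd c0 ` (fst c0 \<inter> \<phi> -` W)"
      proof
        fix x assume x: "x \<in> N"
        then obtain q where q: "q \<in> W" "q \<in> fst d" "snd d (\<phi> (chart_inv c0 x)) = snd d q"
          by (auto simp: N_def)
        moreover have "\<phi> (chart_inv c0 x) \<in> fst d"
          using x V(4) by (auto simp: N_def)
        ultimately have "\<phi> (chart_inv c0 x) \<in> W"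
          using smooth_atlas_inj[OF A(2) d] by (metis inj_onD)
        moreover have "x \<in> snd c0 ` fst c0"
          using x V(3) by (auto simp: N_def)
        ultimately show "x \<in> snd c0 ` (fst c0 \<inter> \<phi> -` W)"
          using mem_chart_image[OF A(1) c0] by blast
      qed
      ultimately show "\<exists>T. open T \<and> snd c0 p \<in> T \<and> T \<subseteq> snd c0 ` (fst c0 \<inter> \<phi> -` W)"
        by blast
    qed
  qed
  have pts: "\<phi> p \<in> points A'" if p: "p \<in> points A" for p
  proof -
    obtain c d V where c: "c \<in> A" "p \<in> fst c" and d: "d \<in> A'" and "snd c p \<in> V" "\<phi> ` chart_inv c ` V \<subseteq> fst d"
      using loc[OF p] by blast
    then have "\<phi> (chart_inv c (snd c p)) \<in> fst d"
      by blast
    then show ?thesis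
      using chart_inv_left[OF A(1) c] in_points[OF d] by simp
  qed
  have "openin (manifold_topology A) {p \<in> points A. \<phi> p \<in> W}"
    if W: "W \<subseteq> points A'" "\<forall>d\<in>A'. open (snd d ` (W \<inter> fst d))" for W
    unfolding openin_manifold_topology[OF A(1)]
  proof (intro conjI ballI)
    fix c0 assume c0: "c0 \<in> A"
    have "snd c0 ` ({p \<in> points A. \<phi> p \<in> W} \<inter> fst c0) = snd c0 ` (fst c0 \<inter> \<phi> -` W)"
      using c0 by (auto simp: points_def)
    moreover have "open \<dots>"
    \<comment> \<open>\<open>op\<close> presupposes some target chart; if the source chart has a
      point, the image of that point lies in one.\<close>
    proof (cases "fst c0 = {}")
      case False
      then obtain d0 where "d0 \<in> A'"
        using pts in_points[OF c0] by (fastforce simp: points_def)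
      then show ?thesis
        using op[OF c0 _ W(1)] W(2) by blast
    qed simp
    ultimately show "open (snd c0 ` ({p \<in> points A. \<phi> p \<in> W} \<inter> fst c0))"
      by simp
  qed auto
  then show ?thesis
    unfolding smooth_map_def continuous_map topspace_manifold_topology[OF A(1)]
      topspace_manifold_topology[OF A(2)] openin_manifold_topology[OF A(2)]
    using pts sm by blast
qed

text \<open>Variant for maps that send a whole chart into a chart and have an explicit formula
  \<open>f\<close> in coordinates: projections, inclusions and the identification of tangent bundles
  of products.\<close>

lemma smooth_map_chartI:
  fixes A :: "('a, 'e::real_inner) atlas" and A' :: "('b, 'f::real_inner) atlas"
  assumes B: "coordinate_basis (B :: 'e set)" "coordinate_basis (B' :: 'f set)"
    and A: "smooth_atlas A" "smooth_atlas A'"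
    and loc: "\<And>p. p \<in> points A \<Longrightarrow> \<exists>c\<in>A. \<exists>d\<in>A'. \<exists>f. p \<in> fst c \<and> \<phi> ` fst c \<subseteq> fst d \<and>
      smooth_on (snd c ` fst c) f \<and> (\<forall>q\<in>fst c. f (snd c q) = snd d (\<phi> q))"
  shows "smooth_map A A' \<phi>"
proof (rule smooth_mapI[OF B A])
  fix p assume "p \<in> points A"
  then obtain c d f where c: "c \<in> A" "p \<in> fst c" and d: "d \<in> A'" "\<phi> ` fst c \<subseteq> fst d"
    and f: "smooth_on (snd c ` fst c) f" "\<And>q. q \<in> fst c \<Longrightarrow> f (snd c q) = snd d (\<phi> q)"
    using loc by meson
  note V = smooth_atlas_open[OF A(1) c(1)] and inv = chart_inv_left[OF A(1) c(1)]
  have "smooth_on (snd c ` fst c) (snd d \<circ> \<phi> \<circ> chart_inv c)"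
    by (rule smooth_on_cong[OF V f(1)]) (auto simp: f(2) inv)
  then show "\<exists>c\<in>A. \<exists>d\<in>A'. \<exists>V. p \<in> fst c \<and> open V \<and> snd c p \<in> V \<and> V \<subseteq> snd c ` fst c \<and>
      \<phi> ` chart_inv c ` V \<subseteq> fst d \<and> smooth_on V (snd d \<circ> \<phi> \<circ> chart_inv c)"
    using c d V
    by (intro bexI[of _ c] bexI[of _ d] exI[of _ "snd c ` fst c"]) (auto simp: inv)
qed

lemma smooth_map_local_chart:
  assumes A: "smooth_atlas A" "smooth_atlas A'" and \<phi>: "smooth_map A A' \<phi>"
    and p: "p \<in> points A"
  obtains c d where "c \<in> A" "d \<in> A'" "p \<in> fst c" "\<phi> p \<in> fst d"
  using pointsE[OF p] pointsE[OF smooth_map_in_points[OF \<phi> A p]] by metis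

lemma smooth_map_id:
  assumes "smooth_atlas A"
  shows "smooth_map A A (\<lambda>x. x)"
  using smooth_atlas_transition[OF assms]
  by (auto simp: smooth_map_def o_def vimage_def)

lemma smooth_map_compose:
  fixes A :: "('a, 'e::real_inner) atlas" and A' :: "('b, 'f::real_inner) atlas"
    and A'' :: "('c, 'g::real_inner) atlas"
  assumes B: "coordinate_basis (B :: 'e set)" "coordinate_basis (B' :: 'f set)"
      "coordinate_basis (B'' :: 'g set)"
    and A: "smooth_atlas A" "smooth_atlas A'" "smooth_atlas A''"
    and \<phi>: "smooth_map A A' \<phi>" and \<psi>: "smooth_map A' A'' \<psi>"
  shows "smooth_map A A'' (\<psi> \<circ> \<phi>)"
proof (rule smooth_mapI[OF B(1,3) A(1,3)])
  fix p assume p: "p \<in> points A"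
  obtain c d where cd: "c \<in> A" "d \<in> A'" "p \<in> fst c" "\<phi> p \<in> fst d"
    using smooth_map_local_chart[OF A(1,2) \<phi> p] .
  obtain e where e: "e \<in> A''" "\<psi> (\<phi> p) \<in> fst e"
    using pointsE[OF smooth_map_in_points[OF \<psi> A(2,3) smooth_map_in_points[OF \<phi> A(1,2) p]]] .
  let ?f = "snd d \<circ> \<phi> \<circ> chart_inv c" and ?g = "snd e \<circ> \<psi> \<circ> chart_inv d"
  let ?S = "snd c ` (fst c \<inter> \<phi> -` fst d)" and ?T = "snd d ` (fst d \<inter> \<psi> -` fst e)"
  \<comment> \<open>Here the intermediate point lies in the chart \<open>d\<close> and its image in
    \<open>e\<close>, so both representatives can be composed.\<close>
  define V where "V = ?S \<inter> ?f -` ?T"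
  have S: "open ?S" and T: "open ?T"
    using smooth_map_open A \<phi> \<psi> cd e by blast+
  have fS: "smooth_on ?S ?f" and gT: "smooth_on ?T ?g"
    using smooth_map_smooth_on \<phi> \<psi> cd e by blast+
  have V: "open V"
    unfolding V_def by (intro continuous_open_preimage smooth_on_continuous_on fS S T)
  have inv: "chart_inv d (?f x) = \<phi> (chart_inv c x)" "\<psi> (\<phi> (chart_inv c x)) \<in> fst e"
    if "x \<in> V" for x
  proof -
    have *: "x \<in> ?S" "?f x \<in> ?T"
      using that by (auto simp: V_def)
    then have "\<phi> (chart_inv c x) \<in> fst d"
      using chart_inv_left[OF A(1) cd(1)] by auto
    then show "chart_inv d (?f x) = \<phi> (chart_inv c x)"
      using chart_inv_left[OF A(2) cd(2)] by simp
    with *(2) show "\<psi> (\<phi> (chart_inv c x)) \<in> fst e"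
      unfolding mem_chart_image[OF A(2) cd(2)] by simp
  qed
  have "smooth_on V (?g \<circ> ?f)"
    by (rule smooth_on_compose[OF B(2) V T smooth_on_subset[OF fS] gT]) (auto simp: V_def)
  then have "smooth_on V (snd e \<circ> (\<psi> \<circ> \<phi>) \<circ> chart_inv c)"
    by (rule smooth_on_cong[OF V]) (use inv(1) in simp)
  moreover have "snd c p \<in> V"
    using cd e chart_inv_left[OF A(1) cd(1,3)] by (auto simp: V_def)
  ultimately show "\<exists>c\<in>A. \<exists>d\<in>A''. \<exists>V. p \<in> fst c \<and> open V \<and> snd c p \<in> V \<and> V \<subseteq> snd c ` fst c \<and>
      (\<psi> \<circ> \<phi>) ` chart_inv c ` V \<subseteq> fst d \<and> smooth_on V (snd d \<circ> (\<psi> \<circ> \<phi>) \<circ> chart_inv c)"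
    using cd e V inv(2) by (intro bexI[of _ c] bexI[of _ e] exI[of _ V]) (auto simp: V_def)
qed

text \<open>Maps are total functions, but only their values at points of the manifold matter. In
  \<open>lie_group_tangent\<close> the group inverse and the tangent map of the inversion are shown
  to agree on the bundle only.\<close>

lemma smooth_map_cong:
  assumes A: "smooth_atlas A" "smooth_atlas A'"
    and "smooth_map A A' \<phi>" "\<And>p. p \<in> points A \<Longrightarrow> \<phi> p = \<psi> p"
  shows "smooth_map A A' \<psi>"
  unfolding smooth_map_def
proof (intro conjI ballI)
  show "continuous_map (manifold_topology A) (manifold_topology A') \<psi>"
    using assms by (auto simp: smooth_map_def topspace_manifold_topology intro: continuous_map_eq)
  fix c d assume cd: "c \<in> A" "d \<in> A'"
  have eq: "fst c \<inter> \<phi> -` fst d = fst c \<inter> \<psi> -` fst d"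
    using assms(4) in_points[OF cd(1)] by auto
  have "smooth_on (snd c ` (fst c \<inter> \<phi> -` fst d)) (snd d \<circ> \<psi> \<circ> chart_inv c)"
    using smooth_map_open[OF A assms(3) cd] smooth_map_smooth_on[OF assms(3) cd]
  proof (rule smooth_on_cong)
    fix x assume "x \<in> snd c ` (fst c \<inter> \<phi> -` fst d)"
    then have "chart_inv c x \<in> points A"
      using chart_inv_left[OF A(1) cd(1)] in_points[OF cd(1)] by auto
    then show "(snd d \<circ> \<phi> \<circ> chart_inv c) x = (snd d \<circ> \<psi> \<circ> chart_inv c) x"
      using assms(4) by simp
  qed
  then show "smooth_on (snd c ` (fst c \<inter> \<psi> -` fst d)) (snd d \<circ> \<psi> \<circ> chart_inv c)"
    by (simp add: eq)
qed

subsection \<open>Differentials in charts\<close>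

lemma local_differential_has_derivative:
  assumes "smooth_atlas A" "smooth_map A A' \<phi>" "c \<in> A" "d \<in> A'" "p \<in> fst c" "\<phi> p \<in> fst d"
  shows "(snd d \<circ> \<phi> \<circ> chart_inv c has_derivative local_differential \<phi> p c d) (at (snd c p))"
  unfolding local_differential_def
  using smooth_on_has_derivative[OF smooth_map_smooth_on[OF assms(2-4)]] assms(5,6) by blast

lemma linear_local_differential:
  assumes "smooth_atlas A" "smooth_map A A' \<phi>" "c \<in> A" "d \<in> A'" "p \<in> fst c" "\<phi> p \<in> fst d"
  shows "linear (local_differential \<phi> p c d)"
  using local_differential_has_derivative[OF assms] has_derivative_linear by blast

text \<open>The maps only have to agree near \<open>p\<close>, hence the open set \<open>W\<close> in the chart \<open>c\<close>.\<close>

lemma local_differential_eqI: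
  assumes "(f has_derivative D) (at (snd c p))" "open W" "snd c p \<in> W"
    and "\<And>x. x \<in> W \<Longrightarrow> f x = snd d (\<phi> (chart_inv c x))"
  shows "local_differential \<phi> p c d = D"
  using has_derivative_transform_within_open[OF assms(1-3), of "snd d \<circ> \<phi> \<circ> chart_inv c"] assms(4)
  unfolding local_differential_def by (simp add: frechet_derivative_at[symmetric])

lemma local_differential_compose:
  assumes A: "smooth_atlas A" "smooth_atlas A'" "smooth_atlas A''"
    and \<phi>: "smooth_map A A' \<phi>" and \<psi>: "smooth_map A' A'' \<psi>"
    and c: "c \<in> A" "p \<in> fst c" and d: "d \<in> A'" "\<phi> p \<in> fst d" and e: "e \<in> A''" "\<psi> (\<phi> p) \<in> fst e"
  shows "local_differential (\<lambda>x. \<psi> (\<phi> x)) p c e = local_differential \<psi> (\<phi> p) d e \<circ> local_differential \<phi> p c d"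
proof (rule local_differential_eqI)
  let ?f = "snd d \<circ> \<phi> \<circ> chart_inv c" and ?g = "snd e \<circ> \<psi> \<circ> chart_inv d"
  have "?f (snd c p) = snd d (\<phi> p)"
    using chart_inv_left[OF A(1) c] by simp
  then show "(?g \<circ> ?f has_derivative local_differential \<psi> (\<phi> p) d e \<circ> local_differential \<phi> p c d) (at (snd c p))"
    using local_differential_has_derivative[OF A(1) \<phi> c(1) d(1) c(2) d(2)]
      local_differential_has_derivative[OF A(2) \<psi> d(1) e(1) d(2) e(2)]
    by (intro diff_chain_at) auto
  show "open (snd c ` (fst c \<inter> \<phi> -` fst d))"
    using smooth_map_open[OF A(1,2) \<phi> c(1) d(1)] .
  show "snd c p \<in> snd c ` (fst c \<inter> \<phi> -` fst d)"
    using c d by simp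
  fix x assume "x \<in> snd c ` (fst c \<inter> \<phi> -` fst d)"
  then show "(?g \<circ> ?f) x = snd e (\<psi> (\<phi> (chart_inv c x)))"
    using chart_inv_left[OF A(1) c(1)] chart_inv_left[OF A(2) d(1)] by auto
qed

abbreviation jac :: "('a, 'e::real_normed_vector) chart \<Rightarrow> ('a, 'e) chart \<Rightarrow> 'a \<Rightarrow> 'e \<Rightarrow> 'e" where
  "jac c d p \<equiv> frechet_derivative (snd d \<circ> chart_inv c) (at (snd c p))"

text \<open>With the Jacobian of a transition map seen as the local differential of the identity,
  its cocycle rules are cases of the chain rule.\<close>

lemma local_differential_id: "local_differential (\<lambda>x. x) p c d = jac c d p"
  by (simp add: local_differential_def o_def)

lemma jac_self:
  assumes "smooth_atlas A" "c \<in> A" "p \<in> fst c"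
  shows "jac c c p = (\<lambda>v. v)"
  unfolding local_differential_id[symmetric]
  by (rule local_differential_eqI[OF has_derivative_ident smooth_atlas_open[OF assms(1,2)]])
     (use assms in \<open>auto simp: chart_inv_left\<close>)

lemma jac_trans:
  assumes A: "smooth_atlas A" and "c \<in> A" "d \<in> A" "e \<in> A" "p \<in> fst c" "p \<in> fst d" "p \<in> fst e"
  shows "jac d e p (jac c d p v) = jac c e p v"
  using local_differential_compose[OF A A A smooth_map_id[OF A] smooth_map_id[OF A], of c p d e] assms
  by (simp add: local_differential_id)

lemma jac_has_derivative:
  assumes A: "smooth_atlas A" and "c \<in> A" "d \<in> A" "p \<in> fst c" "p \<in> fst d"
  shows "(snd d \<circ> chart_inv c has_derivative jac c d p) (at (snd c p))"
  using local_differential_has_derivative[OF A smooth_map_id[OF A] assms(2-)]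
  by (simp add: local_differential_id o_def)

lemma linear_jac:
  assumes "smooth_atlas A" and "c \<in> A" "d \<in> A" "p \<in> fst c" "p \<in> fst d"
  shows "linear (jac c d p)"
  using jac_has_derivative[OF assms] has_derivative_linear by blast

text \<open>The chain rule with the identity of the source or of the target as one factor.\<close>

lemma local_differential_change_chart:
  assumes A: "smooth_atlas A" "smooth_atlas A'" and \<phi>: "smooth_map A A' \<phi>"
    and "c \<in> A" "c' \<in> A" "d \<in> A'" "d' \<in> A'"
    and "p \<in> fst c" "p \<in> fst c'" "\<phi> p \<in> fst d" "\<phi> p \<in> fst d'"
  shows "local_differential \<phi> p c' d (jac c c' p v) = local_differential \<phi> p c d v"
    and "jac d d' (\<phi> p) (local_differential \<phi> p c d v) = local_differential \<phi> p c d' v"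
  using local_differential_compose[OF A(1,1,2) smooth_map_id[OF A(1)] \<phi>, of c p c' d]
    local_differential_compose[OF A(1,2,2) \<phi> smooth_map_id[OF A(2)], of c p d d'] assms
  by (simp_all add: local_differential_id)

lemma chart_at:
  assumes "p \<in> points A"
  shows "chart_at A p \<in> A" "p \<in> fst (chart_at A p)"
proof -
  have "\<exists>c. c \<in> A \<and> p \<in> fst c"
    using assms by (auto simp: points_def)
  then have "chart_at A p \<in> A \<and> p \<in> fst (chart_at A p)"
    unfolding chart_at_def by (rule someI_ex)
  then show "chart_at A p \<in> A" "p \<in> fst (chart_at A p)"
    by auto
qed

section \<open>Product manifolds\<close>

lemma fst_prod_chart [simp]: "fst (prod_chart c d) = fst c \<times> fst d"
  by (simp add: prod_chart_def)

lemma snd_prod_chart [simp]: "snd (prod_chart c d) (p, q) = (snd c p, snd d q)"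
  by (simp add: prod_chart_def)

lemma prod_chart_image: "snd (prod_chart c d) ` (S \<times> T) = (snd c ` S) \<times> (snd d ` T)"
  by (force simp: prod_chart_def)

lemma prod_chart_in: "c \<in> A \<Longrightarrow> d \<in> A' \<Longrightarrow> prod_chart c d \<in> prod_atlas A A'"
  unfolding prod_atlas_def by blast

lemma prod_atlasE:
  assumes "C \<in> prod_atlas A A'"
  obtains c d where "c \<in> A" "d \<in> A'" "C = prod_chart c d"
  using assms unfolding prod_atlas_def by blast

lemma points_prod_atlas: "points (prod_atlas A A') = points A \<times> points A'"
proof (rule Set.set_eqI, rule iffI)
  fix z assume "z \<in> points (prod_atlas A A')"
  then show "z \<in> points A \<times> points A'"
    by (elim pointsE prod_atlasE) (auto intro: in_points)
next
  fix z assume "z \<in> points A \<times> points A'"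
  then obtain c d where "c \<in> A" "fst z \<in> fst c" "d \<in> A'" "snd z \<in> fst d"
    using pointsE by (metis mem_Times_iff)
  then show "z \<in> points (prod_atlas A A')"
    using in_points[OF prod_chart_in, of c A d A' z] by (simp add: mem_Times_iff)
qed

lemma chart_inv_prod_chart:
  assumes "smooth_atlas A" "smooth_atlas A'" "c \<in> A" "d \<in> A'"
    and "x \<in> snd c ` fst c" "y \<in> snd d ` fst d"
  shows "chart_inv (prod_chart c d) (x, y) = (chart_inv c x, chart_inv d y)"
proof -
  have "inj_on (snd (prod_chart c d)) (fst (prod_chart c d))"
    using smooth_atlas_inj[OF assms(1,3)] smooth_atlas_inj[OF assms(2,4)]
    by (auto simp: inj_on_def)
  then show ?thesis
    unfolding chart_inv_def[of "prod_chart c d"] using assms(5,6)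
    by (intro inv_into_f_eq) (auto simp: chart_inv_in chart_inv_right)
qed

lemma smooth_atlas_prod:
  fixes A :: "('a, 'e::real_inner) atlas" and A' :: "('b, 'f::real_inner) atlas"
  assumes B: "coordinate_basis (B :: 'e set)" "coordinate_basis (B' :: 'f set)"
    and A: "smooth_atlas A" "smooth_atlas A'"
  shows "smooth_atlas (prod_atlas A A')"
  unfolding smooth_atlas_def
proof (intro conjI ballI; elim prod_atlasE; hypsubst)
  fix c1 c2 assume c: "c1 \<in> A" "c2 \<in> A'"
  show "inj_on (snd (prod_chart c1 c2)) (fst (prod_chart c1 c2))"
    using smooth_atlas_inj[OF A(1) c(1)] smooth_atlas_inj[OF A(2) c(2)] by (auto simp: inj_on_def)
  show "open (snd (prod_chart c1 c2) ` fst (prod_chart c1 c2))"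
    using smooth_atlas_open[OF A(1) c(1)] smooth_atlas_open[OF A(2) c(2)]
    by (simp add: prod_chart_image open_Times)
  fix d1 d2 assume d: "d1 \<in> A" "d2 \<in> A'"
  let ?S = "snd c1 ` (fst c1 \<inter> fst d1)" and ?T = "snd c2 ` (fst c2 \<inter> fst d2)"
  have im: "snd (prod_chart c1 c2) ` (fst (prod_chart c1 c2) \<inter> fst (prod_chart d1 d2)) = ?S \<times> ?T"
    by (simp add: Times_Int_Times prod_chart_image)
  have ST: "open ?S" "open ?T"
    using smooth_atlas_open_Int A c d by blast+
  then show op: "open (snd (prod_chart c1 c2) ` (fst (prod_chart c1 c2) \<inter> fst (prod_chart d1 d2)))"
    unfolding im by (rule open_Times)
  have "smooth_on (?S \<times> ?T) (\<lambda>z. ((snd d1 \<circ> chart_inv c1) (fst z), (snd d2 \<circ> chart_inv c2) (snd z)))"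
    by (intro smooth_on_Pair open_Times ST smooth_on_compose_fst[OF B(1)] smooth_on_compose_snd[OF B(2)]
        smooth_atlas_transition[OF A(1) c(1) d(1)] smooth_atlas_transition[OF A(2) c(2) d(2)])
  then show "smooth_on (snd (prod_chart c1 c2) ` (fst (prod_chart c1 c2) \<inter> fst (prod_chart d1 d2)))
      (snd (prod_chart d1 d2) \<circ> chart_inv (prod_chart c1 c2))"
    unfolding im
    by (rule smooth_on_cong[OF open_Times[OF ST]]) (auto simp: chart_inv_prod_chart[OF A c])
qed

lemma smooth_map_fst:
  fixes A :: "('a, 'e::real_inner) atlas" and A' :: "('b, 'f::real_inner) atlas"
  assumes B: "coordinate_basis (B :: 'e set)" "coordinate_basis (B' :: 'f set)"
    and A: "smooth_atlas A" "smooth_atlas A'"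
  shows "smooth_map (prod_atlas A A') A fst"
proof (rule smooth_map_chartI[OF coordinate_basis_prod_basis[OF B] B(1) smooth_atlas_prod[OF B A] A(1)])
  fix z assume "z \<in> points (prod_atlas A A')"
  then obtain c d where "c \<in> A" "d \<in> A'" "z \<in> fst c \<times> fst d"
    unfolding points_prod_atlas using pointsE by (metis mem_Times_iff)
  then show "\<exists>C\<in>prod_atlas A A'. \<exists>d\<in>A. \<exists>f. z \<in> fst C \<and> fst ` fst C \<subseteq> fst d \<and>
      smooth_on (snd C ` fst C) f \<and> (\<forall>w\<in>fst C. f (snd C w) = snd d (fst w))"
    by (intro bexI[of _ "prod_chart c d"] bexI[of _ c] exI[of _ fst])
      (auto simp: prod_chart_in smooth_on_bounded_linear bounded_linear_fst)
qed

lemma smooth_map_snd: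
  fixes A :: "('a, 'e::real_inner) atlas" and A' :: "('b, 'f::real_inner) atlas"
  assumes B: "coordinate_basis (B :: 'e set)" "coordinate_basis (B' :: 'f set)"
    and A: "smooth_atlas A" "smooth_atlas A'"
  shows "smooth_map (prod_atlas A A') A' snd"
proof (rule smooth_map_chartI[OF coordinate_basis_prod_basis[OF B] B(2) smooth_atlas_prod[OF B A] A(2)])
  fix z assume "z \<in> points (prod_atlas A A')"
  then obtain c d where "c \<in> A" "d \<in> A'" "z \<in> fst c \<times> fst d"
    unfolding points_prod_atlas using pointsE by (metis mem_Times_iff)
  then show "\<exists>C\<in>prod_atlas A A'. \<exists>d\<in>A'. \<exists>f. z \<in> fst C \<and> snd ` fst C \<subseteq> fst d \<and>
      smooth_on (snd C ` fst C) f \<and> (\<forall>w\<in>fst C. f (snd C w) = snd d (snd w))"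
    by (intro bexI[of _ "prod_chart c d"] bexI[of _ d] exI[of _ snd])
      (auto simp: prod_chart_in smooth_on_bounded_linear bounded_linear_snd)
qed

lemma local_differential_fst_prod:
  assumes A: "smooth_atlas A" "smooth_atlas A'"
    and "c1 \<in> A" "c2 \<in> A'" "d \<in> A" "p \<in> fst c1" "q \<in> fst c2" "p \<in> fst d"
  shows "local_differential fst (p, q) (prod_chart c1 c2) d = (\<lambda>z. jac c1 d p (fst z))"
proof (rule local_differential_eqI)
  show "((\<lambda>z. (snd d \<circ> chart_inv c1) (fst z)) has_derivative (\<lambda>z. jac c1 d p (fst z))) (at (snd (prod_chart c1 c2) (p, q)))"
    using has_derivative_compose_fst[OF jac_has_derivative[OF A(1), of c1 d p]] assms by simp
  show "open ((snd c1 ` fst c1) \<times> (snd c2 ` fst c2))"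
    using assms by (simp add: open_Times smooth_atlas_open)
qed (use assms in \<open>auto simp: chart_inv_prod_chart chart_inv_left\<close>)

lemma local_differential_snd_prod:
  assumes A: "smooth_atlas A" "smooth_atlas A'"
    and "c1 \<in> A" "c2 \<in> A'" "d \<in> A'" "p \<in> fst c1" "q \<in> fst c2" "q \<in> fst d"
  shows "local_differential snd (p, q) (prod_chart c1 c2) d = (\<lambda>z. jac c2 d q (snd z))"
proof (rule local_differential_eqI)
  show "((\<lambda>z. (snd d \<circ> chart_inv c2) (snd z)) has_derivative (\<lambda>z. jac c2 d q (snd z))) (at (snd (prod_chart c1 c2) (p, q)))"
    using has_derivative_compose_snd[OF jac_has_derivative[OF A(2), of c2 d q]] assms by simp
  show "open ((snd c1 ` fst c1) \<times> (snd c2 ` fst c2))"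
    using assms by (simp add: open_Times smooth_atlas_open)
qed (use assms in \<open>auto simp: chart_inv_prod_chart chart_inv_left\<close>)

lemma jac_prod_chart:
  assumes A: "smooth_atlas A" "smooth_atlas A'"
    and "c1 \<in> A" "c2 \<in> A'" "d1 \<in> A" "d2 \<in> A'" "p \<in> fst c1" "q \<in> fst c2" "p \<in> fst d1" "q \<in> fst d2"
  shows "jac (prod_chart c1 c2) (prod_chart d1 d2) (p, q) = (\<lambda>z. (jac c1 d1 p (fst z), jac c2 d2 q (snd z)))"
  unfolding local_differential_id[symmetric, where p = "(p, q)"]
proof (rule local_differential_eqI)
  have 1: "((\<lambda>z. (snd d1 \<circ> chart_inv c1) (fst z)) has_derivative (\<lambda>z. jac c1 d1 p (fst z))) (at (snd c1 p, snd c2 q))"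
    using has_derivative_compose_fst[OF jac_has_derivative[OF A(1), of c1 d1 p]] assms by simp
  have 2: "((\<lambda>z. (snd d2 \<circ> chart_inv c2) (snd z)) has_derivative (\<lambda>z. jac c2 d2 q (snd z))) (at (snd c1 p, snd c2 q))"
    using has_derivative_compose_snd[OF jac_has_derivative[OF A(2), of c2 d2 q]] assms by simp
  show "((\<lambda>z. ((snd d1 \<circ> chart_inv c1) (fst z), (snd d2 \<circ> chart_inv c2) (snd z))) has_derivative
      (\<lambda>z. (jac c1 d1 p (fst z), jac c2 d2 q (snd z)))) (at (snd (prod_chart c1 c2) (p, q)))"
    using has_derivative_Pair[OF 1 2] by simp
  show "open ((snd c1 ` fst c1) \<times> (snd c2 ` fst c2))"
    using assms by (simp add: open_Times smooth_atlas_open)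
qed (use assms in \<open>auto simp: chart_inv_prod_chart\<close>)

section \<open>The tangent bundle\<close>

lemma tangent_space_jac:
  "v \<in> tangent_space A p \<Longrightarrow> c \<in> A \<Longrightarrow> d \<in> A \<Longrightarrow> p \<in> fst c \<Longrightarrow> p \<in> fst d \<Longrightarrow> jac c d p (v c) = v d"
  unfolding tangent_space_def mem_Collect_eq by metis

lemma tangent_space_outside:
  "v \<in> tangent_space A p \<Longrightarrow> \<not> (c \<in> A \<and> p \<in> fst c) \<Longrightarrow> v c = 0"
  unfolding tangent_space_def mem_Collect_eq by blast

text \<open>The Jacobians carry the component in one chart to all others around \<open>p\<close>,
  and outside these a tangent vector is \<open>0\<close> by definition. Equalities of tangent
  vectors can thus be checked in a single chart.\<close>

lemma tangent_space_eqI: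
  assumes "v \<in> tangent_space A p" "w \<in> tangent_space A p" "c \<in> A" "p \<in> fst c" "v c = w c"
  shows "v = w"
proof
  fix d
  show "v d = w d"
  proof (cases "d \<in> A \<and> p \<in> fst d")
    case True
    then have "v d = jac c d p (v c)" "w d = jac c d p (w c)"
      using tangent_space_jac assms by metis+
    then show ?thesis
      using assms(5) by simp
  qed (metis tangent_space_outside assms(1,2))
qed

text \<open>Inverse to reading off the component at \<open>c\<close>; it shows that tangent charts
  are onto the full fibre.\<close>

definition tangent_vec ::
    "('a, 'e::real_normed_vector) atlas \<Rightarrow> 'a \<Rightarrow> ('a, 'e) chart \<Rightarrow> 'e \<Rightarrow> ('a, 'e) tangent_vector" where
  "tangent_vec A p c \<xi> = (\<lambda>d. if d \<in> A \<and> p \<in> fst d then jac c d p \<xi> else 0)"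

lemma tangent_vec_self:
  "smooth_atlas A \<Longrightarrow> c \<in> A \<Longrightarrow> p \<in> fst c \<Longrightarrow> tangent_vec A p c \<xi> c = \<xi>"
  by (simp add: tangent_vec_def jac_self)

lemma tangent_vec_in:
  "smooth_atlas A \<Longrightarrow> c \<in> A \<Longrightarrow> p \<in> fst c \<Longrightarrow> tangent_vec A p c \<xi> \<in> tangent_space A p"
  unfolding tangent_space_def tangent_vec_def by (auto simp: jac_trans)

lemma fst_tangent_chart: "fst (tangent_chart A c) = Sigma (fst c) (tangent_space A)"
  by (simp add: tangent_chart_def)

lemma snd_tangent_chart: "snd (tangent_chart A c) z = (snd c (fst z), snd z c)"
  by (simp add: tangent_chart_def split_def)

lemma tangent_chart_in: "c \<in> A \<Longrightarrow> tangent_chart A c \<in> tangent_atlas A"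
  by (simp add: tangent_atlas_def)

lemma tangent_atlasE:
  assumes "C \<in> tangent_atlas A"
  obtains c where "c \<in> A" "C = tangent_chart A c"
  using assms unfolding tangent_atlas_def by blast

lemma mem_tangent_chart: "z \<in> fst (tangent_chart A c) \<longleftrightarrow> fst z \<in> fst c \<and> snd z \<in> tangent_space A (fst z)"
  by (cases z) (simp add: fst_tangent_chart)

lemma mem_tangent_bundle: "z \<in> tangent_bundle A \<longleftrightarrow> fst z \<in> points A \<and> snd z \<in> tangent_space A (fst z)"
  by (cases z) (simp add: tangent_bundle_def)

lemma tangent_chart_image:
  assumes "smooth_atlas A" "c \<in> A" "W \<subseteq> fst c"
  shows "snd (tangent_chart A c) ` Sigma W (tangent_space A) = (snd c ` W) \<times> UNIV"
proof safe
  fix x \<xi> p assume "p \<in> W"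
  then show "(snd c p, \<xi>) \<in> snd (tangent_chart A c) ` Sigma W (tangent_space A)"
    using assms by (intro image_eqI[of _ _ "(p, tangent_vec A p c \<xi>)"])
      (auto simp: snd_tangent_chart tangent_vec_self tangent_vec_in subset_iff)
qed (auto simp: snd_tangent_chart)

lemma inj_on_tangent_chart:
  assumes "smooth_atlas A" "c \<in> A"
  shows "inj_on (snd (tangent_chart A c)) (fst (tangent_chart A c))"
proof (rule inj_onI)
  fix z w assume z: "z \<in> fst (tangent_chart A c)" and w: "w \<in> fst (tangent_chart A c)"
    and eq: "snd (tangent_chart A c) z = snd (tangent_chart A c) w"
  have "fst z = fst w"
    using inj_onD[OF smooth_atlas_inj[OF assms]] z w eq by (auto simp: mem_tangent_chart snd_tangent_chart)
  then show "z = w"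
    using tangent_space_eqI[OF _ _ assms(2), of "snd z" "fst z" "snd w"] z w eq
    by (auto simp: mem_tangent_chart snd_tangent_chart prod_eq_iff)
qed

lemma chart_inv_tangent_chart:
  assumes "smooth_atlas A" "c \<in> A" "x \<in> snd c ` fst c"
  shows "chart_inv (tangent_chart A c) (x, \<xi>) = (chart_inv c x, tangent_vec A (chart_inv c x) c \<xi>)"
  unfolding chart_inv_def[of "tangent_chart A c"]
  using assms chart_inv_in[OF assms(3)]
  by (intro inv_into_f_eq inj_on_tangent_chart)
     (auto simp: mem_tangent_chart snd_tangent_chart tangent_vec_in tangent_vec_self chart_inv_right)

text \<open>Carries smoothness of the atlas over to the tangent atlas, and makes the transformation
  law of the lifted bivector a case of \<open>tangent_lift_poisson_map\<close>.\<close>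

lemma tangent_chart_transition:
  assumes A: "smooth_atlas A" "c \<in> A" "d \<in> A" and x: "x \<in> snd c ` (fst c \<inter> fst d)"
  shows "snd (tangent_chart A d) (chart_inv (tangent_chart A c) (x, \<xi>))
    = tangent_fun (snd d \<circ> chart_inv c) (x, \<xi>)"
  using x chart_inv_tangent_chart[OF A(1,2), of x \<xi>] chart_inv_left[OF A(1,2)] A
  by (auto simp: snd_tangent_chart tangent_fun_def tangent_vec_def)

lemma tangent_chart_image_Int:
  assumes "smooth_atlas A" "c \<in> A"
  shows "snd (tangent_chart A c) ` (fst (tangent_chart A c) \<inter> fst (tangent_chart A d))
    = (snd c ` (fst c \<inter> fst d)) \<times> UNIV"
proof -
  have "fst (tangent_chart A c) \<inter> fst (tangent_chart A d) = Sigma (fst c \<inter> fst d) (tangent_space A)"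
    by (auto simp: fst_tangent_chart)
  then show ?thesis
    by (simp add: tangent_chart_image[OF assms])
qed

lemma smooth_atlas_tangent:
  fixes A :: "('a, 'e::real_inner) atlas"
  assumes B: "coordinate_basis (B :: 'e set)" and A: "smooth_atlas A"
  shows "smooth_atlas (tangent_atlas A)"
  unfolding smooth_atlas_def
proof (intro conjI ballI; elim tangent_atlasE; hypsubst)
  fix c assume c: "c \<in> A"
  show "inj_on (snd (tangent_chart A c)) (fst (tangent_chart A c))"
    by (rule inj_on_tangent_chart[OF A c])
  show "open (snd (tangent_chart A c) ` fst (tangent_chart A c))"
    using tangent_chart_image_Int[OF A c, of c] smooth_atlas_open[OF A c] by (simp add: open_Times)
  fix d assume d: "d \<in> A"
  let ?S = "snd c ` (fst c \<inter> fst d)"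
  have S: "open ?S"
    using smooth_atlas_open_Int[OF A c d] .
  show "open (snd (tangent_chart A c) ` (fst (tangent_chart A c) \<inter> fst (tangent_chart A d)))"
    unfolding tangent_chart_image_Int[OF A c] using S by (simp add: open_Times)
  have "smooth_on (?S \<times> UNIV) (tangent_fun (snd d \<circ> chart_inv c))"
    using smooth_on_tangent_fun[OF B S smooth_atlas_transition[OF A c d]] .
  then show "smooth_on (snd (tangent_chart A c) ` (fst (tangent_chart A c) \<inter> fst (tangent_chart A d)))
     (snd (tangent_chart A d) \<circ> chart_inv (tangent_chart A c))"
    unfolding tangent_chart_image_Int[OF A c]
    by (rule smooth_on_cong[OF open_Times[OF S open_UNIV]])
      (auto simp: tangent_chart_transition[OF A c d])
qed

section \<open>Separation and countability of the tangent bundle\<close>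

lemma openin_tangent_bundle:
  fixes A :: "('a, 'e::real_inner) atlas"
  assumes B: "coordinate_basis (B :: 'e set)" and A: "smooth_atlas A"
    and U: "openin (manifold_topology A) U"
  shows "openin (manifold_topology (tangent_atlas A)) (Sigma U (tangent_space A))"
  unfolding openin_manifold_topology[OF smooth_atlas_tangent[OF B A]] points_tangent_atlas
proof (intro conjI ballI)
  show "Sigma U (tangent_space A) \<subseteq> tangent_bundle A"
    using U by (auto simp: openin_manifold_topology[OF A] tangent_bundle_def)
  fix C assume "C \<in> tangent_atlas A"
  then obtain c where c: "c \<in> A" "C = tangent_chart A c"
    by (rule tangent_atlasE)
  have "Sigma U (tangent_space A) \<inter> fst C = Sigma (U \<inter> fst c) (tangent_space A)"
    by (auto simp: c fst_tangent_chart)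
  moreover have "open ((snd c ` (U \<inter> fst c)) \<times> (UNIV :: 'e set))"
    using U c by (simp add: openin_manifold_topology[OF A] open_Times)
  ultimately show "open (snd C ` (Sigma U (tangent_space A) \<inter> fst C))"
    using tangent_chart_image[OF A c(1), of "U \<inter> fst c"] c(2) by simp
qed

text \<open>Vectors over different points are separated by the preimages of separating sets in the
  base; vectors over the same point lie in one tangent chart and are separated there.\<close>

lemma Hausdorff_space_tangent:
  fixes A :: "('a, 'e::real_inner) atlas"
  assumes B: "coordinate_basis (B :: 'e set)" and A: "smooth_atlas A"
    and H: "Hausdorff_space (manifold_topology A)"
  shows "Hausdorff_space (manifold_topology (tangent_atlas A))"
  unfolding Hausdorff_space_def
proof (intro allI impI; elim conjE)
  let ?X = "manifold_topology (tangent_atlas A)"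
  note TA = smooth_atlas_tangent[OF B A]
  fix z w assume "z \<in> topspace ?X" "w \<in> topspace ?X" and ne: "z \<noteq> w"
  then have z: "fst z \<in> points A" "snd z \<in> tangent_space A (fst z)"
    and w: "fst w \<in> points A" "snd w \<in> tangent_space A (fst w)"
    by (auto simp: topspace_manifold_topology[OF TA] points_tangent_atlas mem_tangent_bundle)
  show "\<exists>U V. openin ?X U \<and> openin ?X V \<and> z \<in> U \<and> w \<in> V \<and> disjnt U V"
  proof (cases "fst z = fst w")
    case False
    then obtain U V where "openin (manifold_topology A) U" "openin (manifold_topology A) V"
      "fst z \<in> U" "fst w \<in> V" "disjnt U V"
      using H z w unfolding Hausdorff_space_def topspace_manifold_topology[OF A] by blast
    then show ?thesis
      using z w
      by (intro exI[of _ "Sigma U (tangent_space A)"] exI[of _ "Sigma V (tangent_space A)"])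
        (auto simp: openin_tangent_bundle[OF B A] disjnt_iff mem_Sigma_iff[of "fst z" "snd z", simplified]
          mem_Sigma_iff[of "fst w" "snd w", simplified])
  next
    case True
    obtain c where c: "c \<in> A" "fst z \<in> fst c"
      using pointsE[OF z(1)] .
    let ?C = "tangent_chart A c"
    have mem: "z \<in> fst ?C" "w \<in> fst ?C"
      using c z w True by (auto simp: mem_tangent_chart)
    then have neq: "snd ?C z \<noteq> snd ?C w"
      using inj_onD[OF inj_on_tangent_chart[OF A c(1)]] ne by blast
    obtain U V where UV: "open U" "open V" "snd ?C z \<in> U" "snd ?C w \<in> V" "U \<inter> V = {}"
      using hausdorff[OF neq] by blast
    show ?thesis
      using UV mem openin_chart_vimage[OF TA tangent_chart_in[OF c(1)]]
      by (intro exI[of _ "{p \<in> fst ?C. snd ?C p \<in> U}"] exI[of _ "{p \<in> fst ?C. snd ?C p \<in> V}"])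
        (auto simp: disjnt_iff)
  qed
qed

lemma countable_coordinate_base:
  fixes B :: "'e::real_inner set"
  assumes B: "coordinate_basis B"
  shows "\<exists>\<O> :: 'e set set. countable \<O> \<and> (\<forall>V\<in>\<O>. open V) \<and>
    (\<forall>U x. open U \<and> x \<in> U \<longrightarrow> (\<exists>V\<in>\<O>. x \<in> V \<and> V \<subseteq> U))"
proof -
  define bx where "bx a b = (\<Inter>i\<in>B. {x. a i < x \<bullet> i} \<inter> {x. x \<bullet> i < b i})" for a b :: "'e \<Rightarrow> real"
  \<comment> \<open>Extensional functions: for a box only the bounds on \<open>B\<close> matter, and
    finitely many rational values form a countable index set.\<close>
  let ?Q = "B \<rightarrow>\<^sub>E (\<rat> :: real set)"
  have fin: "finite B"
    using B by (rule finite_coordinate_basis)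
  have "countable (?Q \<times> ?Q)"
    using fin by (intro countable_SIGMA countable_PiE) (auto simp: countable_rat)
  then have 1: "countable ((\<lambda>(a, b). bx a b) ` (?Q \<times> ?Q))"
    by (rule countable_image)
  have 2: "open V" if "V \<in> (\<lambda>(a, b). bx a b) ` (?Q \<times> ?Q)" for V
    using that fin unfolding bx_def
    by (auto intro!: open_INT open_Int open_Collect_less continuous_intros)
  have 3: "\<exists>V\<in>(\<lambda>(a, b). bx a b) ` (?Q \<times> ?Q). x \<in> V \<and> V \<subseteq> U" if Ux: "open U" "x \<in> U" for U x
  proof -
    obtain e where e: "e > 0" "ball x e \<subseteq> U"
      using openE[OF Ux] by blast
    \<comment> \<open>With half-width \<open>h\<close> the coordinate distances add up to at most
      \<open>card B * h\<close>; the extra 1 makes this smaller than \<open>e\<close> and covers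
      \<open>B = {}\<close>.\<close>
    define h where "h = e / (card B + 1)"
    have h: "h > 0"
      using e by (simp add: h_def)
    have "\<forall>i. \<exists>q\<in>\<rat>. x \<bullet> i - h < q \<and> q < x \<bullet> i" "\<forall>i. \<exists>q\<in>\<rat>. x \<bullet> i < q \<and> q < x \<bullet> i + h"
      using h Rats_dense_in_real by auto
    then obtain a b where a: "\<And>i. a i \<in> \<rat>" "\<And>i. x \<bullet> i - h < a i" "\<And>i. a i < x \<bullet> i"
      and b: "\<And>i. b i \<in> \<rat>" "\<And>i. x \<bullet> i < b i" "\<And>i. b i < x \<bullet> i + h"
      by metis
    have "bx (restrict a B) (restrict b B) \<subseteq> ball x e"
    proof
      fix y assume y: "y \<in> bx (restrict a B) (restrict b B)"
      have "\<bar>(y - x) \<bullet> i\<bar> \<le> h" if "i \<in> B" for i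
      proof -
        have "a i < y \<bullet> i" "y \<bullet> i < b i"
          using y that by (auto simp: bx_def)
        then show ?thesis
          using a(2)[of i] b(3)[of i] by (simp add: inner_diff_left abs_le_iff)
      qed
      then have "(\<Sum>i\<in>B. \<bar>(y - x) \<bullet> i\<bar>) \<le> (\<Sum>i\<in>B. h)"
        by (intro sum_mono)
      also have "\<dots> = card B * h"
        by simp
      also have "\<dots> < e"
        using e by (simp add: h_def field_simps)
      finally show "y \<in> ball x e"
        using coordinate_basis_norm_le[OF B, of "y - x"] by (simp add: dist_norm norm_minus_commute)
    qed
    moreover have "x \<in> bx (restrict a B) (restrict b B)"
      using a b by (auto simp: bx_def)
    moreover have "bx (restrict a B) (restrict b B) \<in> (\<lambda>(a, b). bx a b) ` (?Q \<times> ?Q)"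
      using a b by (intro image_eqI[of _ _ "(restrict a B, restrict b B)"]) auto
    ultimately show ?thesis
      using e(2) by (meson order_trans)
  qed
  show ?thesis
  proof (intro exI conjI ballI allI impI)
    show "countable ((\<lambda>(a, b). bx a b) ` (?Q \<times> ?Q))"
      by (rule 1)
  qed (rule 2, assumption, rule 3, (elim conjE, assumption)+)
qed

text \<open>Turns second countability into a property of the atlas that passes to the tangent
  bundle, because the tangent charts of a countable covering subatlas cover again. One direction
  selects a chart for each basic open set inside a chart, the other pulls a countable base of the
  model space back along the charts.\<close>

lemma second_countable_manifold_topology_iff:
  fixes A :: "('a, 'e::real_inner) atlas"
  assumes B: "coordinate_basis (B :: 'e set)" and A: "smooth_atlas A"
  shows "second_countable (manifold_topology A) \<longleftrightarrow> (\<exists>F\<subseteq>A. countable F \<and> points A \<subseteq> points F)"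
proof
  assume "second_countable (manifold_topology A)"
  then obtain \<B> where \<B>: "countable \<B>"
    "\<forall>U x. openin (manifold_topology A) U \<and> x \<in> U \<longrightarrow> (\<exists>V\<in>\<B>. x \<in> V \<and> V \<subseteq> U)"
    unfolding second_countable_def by auto
  define \<U> where "\<U> = {V \<in> \<B>. \<exists>c\<in>A. V \<subseteq> fst c}"
  have "\<forall>V\<in>\<U>. \<exists>c\<in>A. V \<subseteq> fst c"
    by (simp add: \<U>_def)
  then obtain c where c: "\<And>V. V \<in> \<U> \<Longrightarrow> c V \<in> A \<and> V \<subseteq> fst (c V)"
    by metis
  have "p \<in> points (c ` \<U>)" if p: "p \<in> points A" for p
  proof -
    obtain d where d: "d \<in> A" "p \<in> fst d"
      using pointsE[OF p] .
    then obtain V where "V \<in> \<B>" "p \<in> V" "V \<subseteq> fst d"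
      using \<B>(2) openin_chart[OF A d(1)] by blast
    then have "V \<in> \<U>" "p \<in> V"
      using d by (auto simp: \<U>_def)
    then show ?thesis
      using c unfolding points_def by blast
  qed
  moreover have "countable (c ` \<U>)"
    using \<B>(1) by (simp add: \<U>_def)
  ultimately show "\<exists>F\<subseteq>A. countable F \<and> points A \<subseteq> points F"
    using c by (intro exI[of _ "c ` \<U>"]) blast
next
  assume "\<exists>F\<subseteq>A. countable F \<and> points A \<subseteq> points F"
  then obtain F where F: "F \<subseteq> A" "countable F" "points A \<subseteq> points F"
    by blast
  obtain \<O> :: "'e set set" where \<O>: "countable \<O>" "\<forall>V\<in>\<O>. open V"
    "\<forall>U x. open U \<and> x \<in> U \<longrightarrow> (\<exists>V\<in>\<O>. x \<in> V \<and> V \<subseteq> U)"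
    using countable_coordinate_base[OF B] by auto
  let ?S = "\<lambda>(c, V). {p \<in> fst c. snd c p \<in> V}"
  show "second_countable (manifold_topology A)"
    unfolding second_countable_def
  proof (intro exI[of _ "?S ` (F \<times> \<O>)"] conjI ballI allI impI)
    show "countable (?S ` (F \<times> \<O>))"
      using F \<O> by (intro countable_image countable_SIGMA)
    fix U assume "U \<in> ?S ` (F \<times> \<O>)"
    then obtain c V where "c \<in> F" "V \<in> \<O>" "U = {p \<in> fst c. snd c p \<in> V}"
      by blast
    then show "openin (manifold_topology A) U"
      using openin_chart_vimage[OF A] F(1) \<O>(2) by blast
  next
    fix U p assume Up: "openin (manifold_topology A) U \<and> p \<in> U"
    then have p: "p \<in> points A"
      unfolding openin_manifold_topology[OF A] by blast
    obtain c where c: "c \<in> F" "p \<in> fst c"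
      using pointsE[OF subsetD[OF F(3) p]] .
    then have cA: "c \<in> A"
      using F(1) by blast
    have "open (snd c ` (U \<inter> fst c))" "snd c p \<in> snd c ` (U \<inter> fst c)"
      using Up cA c by (auto simp: openin_manifold_topology[OF A])
    then obtain V where V: "V \<in> \<O>" "snd c p \<in> V" "V \<subseteq> snd c ` (U \<inter> fst c)"
      using \<O>(3) by meson
    have "{q \<in> fst c. snd c q \<in> V} \<subseteq> U"
    proof clarify
      fix q assume "q \<in> fst c" "snd c q \<in> V"
      then show "q \<in> U"
        using V(3) inj_onD[OF smooth_atlas_inj[OF A cA]] by blast
    qed
    then show "\<exists>W\<in>?S ` (F \<times> \<O>). p \<in> W \<and> W \<subseteq> U"
      using c V by (intro bexI[of _ "?S (c, V)"]) auto
  qed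
qed

lemma smooth_manifold_tangent:
  assumes "smooth_manifold B A"
  shows "smooth_manifold (prod_basis B B) (tangent_atlas A)"
proof -
  have B: "coordinate_basis B" and A: "smooth_atlas A" and H: "Hausdorff_space (manifold_topology A)"
    and S: "second_countable (manifold_topology A)"
    using assms by (auto simp: smooth_manifold_def)
  note TB = coordinate_basis_prod_basis[OF B B] and TA = smooth_atlas_tangent[OF B A]
  obtain F where F: "F \<subseteq> A" "countable F" "points A \<subseteq> points F"
    using S second_countable_manifold_topology_iff[OF B A] by blast
  have "points (tangent_atlas A) \<subseteq> points (tangent_chart A ` F)"
  proof
    fix z assume "z \<in> points (tangent_atlas A)"
    then have z: "fst z \<in> points A" "snd z \<in> tangent_space A (fst z)"
      by (auto simp: points_tangent_atlas mem_tangent_bundle)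
    obtain c where "c \<in> F" "fst z \<in> fst c"
      using pointsE[OF subsetD[OF F(3) z(1)]] .
    then show "z \<in> points (tangent_chart A ` F)"
      using z by (intro in_points[of "tangent_chart A c"]) (simp_all add: mem_tangent_chart)
  qed
  moreover have "tangent_chart A ` F \<subseteq> tangent_atlas A"
    using F(1) by (auto simp: tangent_atlas_def)
  ultimately have "second_countable (manifold_topology (tangent_atlas A))"
    unfolding second_countable_manifold_topology_iff[OF TB TA] using F(2) by blast
  then show ?thesis
    using TB TA Hausdorff_space_tangent[OF B A H] by (simp add: smooth_manifold_def)
qed

section \<open>The tangent functor\<close>

lemma fst_tangent_map [simp]: "fst (tangent_map A A' \<phi> z) = \<phi> (fst z)"
  by (simp add: tangent_map_def split_def)

text \<open>\<open>tangent_map\<close> reads the vector in a chart chosen by \<open>SOME\<close>.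
  The Jacobian between two charts cancels between the vector and the differential, so any chart
  \<open>c\<close> may be used.\<close>

lemma snd_tangent_map:
  assumes A: "smooth_atlas A" "smooth_atlas A'" and \<phi>: "smooth_map A A' \<phi>"
    and c: "c \<in> A" "fst z \<in> fst c" and v: "snd z \<in> tangent_space A (fst z)"
  shows "snd (tangent_map A A' \<phi> z) d = (if d \<in> A' \<and> \<phi> (fst z) \<in> fst d
    then local_differential \<phi> (fst z) c d (snd z c) else 0)"
proof -
  let ?p = "fst z"
  note c' = chart_at[OF in_points[OF c]]
  have "local_differential \<phi> ?p (chart_at A ?p) d (snd z (chart_at A ?p)) = local_differential \<phi> ?p c d (snd z c)"
    if "d \<in> A'" "\<phi> ?p \<in> fst d"
    using local_differential_change_chart(1)[OF A \<phi> c(1) c'(1) that(1,1) c(2) c'(2) that(2,2), of "snd z c"]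
      tangent_space_jac[OF v c(1) c'(1) c(2) c'(2)] by simp
  then show ?thesis
    by (simp add: tangent_map_def split_def)
qed

lemma tangent_map_in:
  assumes A: "smooth_atlas A" "smooth_atlas A'" and \<phi>: "smooth_map A A' \<phi>"
    and z: "z \<in> tangent_bundle A"
  shows "tangent_map A A' \<phi> z \<in> tangent_bundle A'"
proof -
  have p: "fst z \<in> points A" and v: "snd z \<in> tangent_space A (fst z)"
    using z by (auto simp: mem_tangent_bundle)
  obtain c where c: "c \<in> A" "fst z \<in> fst c"
    using pointsE[OF p] .
  have "snd (tangent_map A A' \<phi> z) \<in> tangent_space A' (\<phi> (fst z))"
    unfolding tangent_space_def mem_Collect_eq snd_tangent_map[OF A \<phi> c v]
    using local_differential_change_chart(2)[OF A \<phi> c(1,1) _ _ c(2,2)] by auto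
  then show ?thesis
    using smooth_map_in_points[OF \<phi> A p] by (simp add: mem_tangent_bundle)
qed

lemma tangent_map_chart:
  assumes A: "smooth_atlas A" "smooth_atlas A'" and \<phi>: "smooth_map A A' \<phi>"
    and c: "c \<in> A" "d \<in> A'" and x: "x \<in> snd c ` (fst c \<inter> \<phi> -` fst d)"
  shows "snd (tangent_chart A' d) (tangent_map A A' \<phi> (chart_inv (tangent_chart A c) (x, \<xi>)))
    = tangent_fun (snd d \<circ> \<phi> \<circ> chart_inv c) (x, \<xi>)"
proof -
  obtain p where p: "p \<in> fst c" "\<phi> p \<in> fst d" "x = snd c p"
    using x by auto
  have inv: "chart_inv (tangent_chart A c) (x, \<xi>) = (p, tangent_vec A p c \<xi>)"
    using p by (simp add: chart_inv_tangent_chart[OF A(1) c(1)] chart_inv_left[OF A(1) c(1)])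
  show ?thesis
    unfolding inv
    using p c snd_tangent_map[OF A \<phi> c(1), of "(p, tangent_vec A p c \<xi>)" d]
    by (simp add: snd_tangent_chart tangent_fun_def tangent_vec_in[OF A(1)] tangent_vec_self[OF A(1)]
        local_differential_def chart_inv_left[OF A(1)])
qed

lemma smooth_map_tangent:
  fixes A :: "('a, 'e::real_inner) atlas" and A' :: "('b, 'f::real_inner) atlas"
  assumes B: "coordinate_basis (B :: 'e set)" "coordinate_basis (B' :: 'f set)"
    and A: "smooth_atlas A" "smooth_atlas A'" and \<phi>: "smooth_map A A' \<phi>"
  shows "smooth_map (tangent_atlas A) (tangent_atlas A') (tangent_map A A' \<phi>)"
proof (rule smooth_mapI[OF coordinate_basis_prod_basis[OF B(1,1)] coordinate_basis_prod_basis[OF B(2,2)]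
      smooth_atlas_tangent[OF B(1) A(1)] smooth_atlas_tangent[OF B(2) A(2)]])
  fix z assume "z \<in> points (tangent_atlas A)"
  then have z: "fst z \<in> points A" "snd z \<in> tangent_space A (fst z)"
    by (auto simp: points_tangent_atlas mem_tangent_bundle)
  obtain c d where cd: "c \<in> A" "d \<in> A'" "fst z \<in> fst c" "\<phi> (fst z) \<in> fst d"
    using smooth_map_local_chart[OF A \<phi> z(1)] .
  let ?S = "snd c ` (fst c \<inter> \<phi> -` fst d)"
  let ?C = "tangent_chart A c" and ?D = "tangent_chart A' d"
  have S: "open ?S"
    using smooth_map_open[OF A \<phi> cd(1,2)] .
  then have V: "open (?S \<times> (UNIV :: 'e set))"
    by (simp add: open_Times)
  have "smooth_on (?S \<times> UNIV) (tangent_fun (snd d \<circ> \<phi> \<circ> chart_inv c))"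
    using smooth_on_tangent_fun[OF B(1) S smooth_map_smooth_on[OF \<phi> cd(1,2)]] .
  then have "smooth_on (?S \<times> UNIV) (snd ?D \<circ> tangent_map A A' \<phi> \<circ> chart_inv ?C)"
    by (rule smooth_on_cong[OF V]) (auto simp del: imageE simp: tangent_map_chart[OF A \<phi> cd(1,2)])
  moreover have "tangent_map A A' \<phi> ` chart_inv ?C ` (?S \<times> UNIV) \<subseteq> fst ?D"
  proof -
    have "tangent_map A A' \<phi> (chart_inv ?C (snd c p, \<xi>)) \<in> fst ?D"
      if p: "p \<in> fst c" "\<phi> p \<in> fst d" for p \<xi>
    proof -
      from p have inv: "chart_inv ?C (snd c p, \<xi>) = (p, tangent_vec A p c \<xi>)"
        by (simp add: chart_inv_tangent_chart[OF A(1) cd(1)] chart_inv_left[OF A(1) cd(1)])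
      have "(p, tangent_vec A p c \<xi>) \<in> tangent_bundle A"
        using p cd tangent_vec_in[OF A(1) cd(1)] by (simp add: mem_tangent_bundle in_points)
      from tangent_map_in[OF A \<phi> this]
      show ?thesis
        unfolding inv using p by (simp add: mem_tangent_chart mem_tangent_bundle)
    qed
    then show ?thesis
      by auto
  qed
  moreover have "snd ?C z \<in> ?S \<times> UNIV"
    using cd by (simp add: snd_tangent_chart)
  moreover have "?S \<times> UNIV \<subseteq> snd ?C ` fst ?C"
    using tangent_chart_image[OF A(1) cd(1), of "fst c"] by (auto simp: fst_tangent_chart)
  ultimately show "\<exists>C\<in>tangent_atlas A. \<exists>D\<in>tangent_atlas A'. \<exists>V. z \<in> fst C \<and> open V \<and> snd C z \<in> V \<and>
      V \<subseteq> snd C ` fst C \<and> tangent_map A A' \<phi> ` chart_inv C ` V \<subseteq> fst D \<and>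
      smooth_on V (snd D \<circ> tangent_map A A' \<phi> \<circ> chart_inv C)"
    using cd z V
    by (intro bexI[of _ ?C] bexI[of _ ?D] exI[of _ "?S \<times> UNIV"] conjI)
      (auto simp: tangent_chart_in mem_tangent_chart)
qed

text \<open>Surjectivity of \<open>(T pr\<^sub>1, T pr\<^sub>2)\<close> is all that is needed to invert it with \<open>inv_into\<close>.\<close>

lemma tangent_prod_iso:
  fixes A :: "('a, 'e::real_inner) atlas" and A' :: "('b, 'f::real_inner) atlas"
  assumes B: "coordinate_basis (B :: 'e set)" "coordinate_basis (B' :: 'f set)"
    and A: "smooth_atlas A" "smooth_atlas A'"
    and z: "z \<in> tangent_bundle A" and w: "w \<in> tangent_bundle A'"
  shows "tangent_prod_iso A A' (z, w) \<in> tangent_bundle (prod_atlas A A')"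
    and "fst (tangent_prod_iso A A' (z, w)) = (fst z, fst w)"
    and "c \<in> A \<Longrightarrow> d \<in> A' \<Longrightarrow> fst z \<in> fst c \<Longrightarrow> fst w \<in> fst d \<Longrightarrow>
      snd (tangent_prod_iso A A' (z, w)) (prod_chart c d) = (snd z c, snd w d)"
proof -
  let ?P = "prod_atlas A A'" and ?p = "fst z" and ?q = "fst w"
  let ?T = "\<lambda>u. (tangent_map ?P A fst u, tangent_map ?P A' snd u)"
  let ?u = "tangent_prod_iso A A' (z, w)"
  note P = smooth_atlas_prod[OF B A] and f = smooth_map_fst[OF B A] and s = smooth_map_snd[OF B A]
  have pq: "?p \<in> points A" "?q \<in> points A'" and v: "snd z \<in> tangent_space A ?p" "snd w \<in> tangent_space A' ?q"
    using z w by (auto simp: mem_tangent_bundle)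
  \<comment> \<open>Coordinates of the two projections of any \<open>u\<close>: in a product chart
    the differentials of \<open>fst\<close> and \<open>snd\<close> pick out one component, up to a
    transition Jacobian.\<close>
  have snd_T: "snd (tangent_map ?P A fst u) e = (if e \<in> A \<and> fst (fst u) \<in> fst e then jac c e (fst (fst u)) (fst (snd u (prod_chart c d))) else 0)"
     "snd (tangent_map ?P A' snd u) e' = (if e' \<in> A' \<and> snd (fst u) \<in> fst e' then jac d e' (snd (fst u)) (snd (snd u (prod_chart c d))) else 0)"
    if "c \<in> A" "d \<in> A'" "fst (fst u) \<in> fst c" "snd (fst u) \<in> fst d" "snd u \<in> tangent_space ?P (fst u)" for u c d e e'
  proof -
    have "fst u \<in> fst (prod_chart c d)" and u: "fst u = (fst (fst u), snd (fst u))"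
      using that by (auto simp: mem_Times_iff)
    note T = snd_tangent_map[OF P A(1) f prod_chart_in[OF that(1,2)] this(1) that(5)]
      snd_tangent_map[OF P A(2) s prod_chart_in[OF that(1,2)] this(1) that(5)]
    show "snd (tangent_map ?P A fst u) e = (if e \<in> A \<and> fst (fst u) \<in> fst e then jac c e (fst (fst u)) (fst (snd u (prod_chart c d))) else 0)"
      using local_differential_fst_prod[OF A that(1,2) _ that(3,4), of e] u by (simp add: T(1))
    show "snd (tangent_map ?P A' snd u) e' = (if e' \<in> A' \<and> snd (fst u) \<in> fst e' then jac d e' (snd (fst u)) (snd (snd u (prod_chart c d))) else 0)"
      using local_differential_snd_prod[OF A that(1,2) _ that(3,4), of e'] u by (simp add: T(2))
  qed
  obtain c d where cd: "c \<in> A" "?p \<in> fst c" "d \<in> A'" "?q \<in> fst d"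
    using pointsE[OF pq(1)] pointsE[OF pq(2)] by metis
  \<comment> \<open>An explicit preimage: the vector whose coordinates in a product chart are the
    pair of given coordinates.\<close>
  define u where "u = ((?p, ?q), tangent_vec ?P (?p, ?q) (prod_chart c d) (snd z c, snd w d))"
  have u: "fst u = (?p, ?q)" "snd u (prod_chart c d) = (snd z c, snd w d)" "snd u \<in> tangent_space ?P (?p, ?q)"
    using cd prod_chart_in[OF cd(1,3)]
    by (auto simp: u_def intro!: tangent_vec_self tangent_vec_in P)
  have "snd (tangent_map ?P A fst u) = snd z"
  proof
    fix e show "snd (tangent_map ?P A fst u) e = snd z e"
      using snd_T(1)[OF cd(1,3), of u e] cd u v(1) tangent_space_jac[OF v(1) cd(1) _ cd(2)]
      by (auto simp: tangent_space_outside[OF v(1)])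
  qed
  moreover have "snd (tangent_map ?P A' snd u) = snd w"
  proof
    fix e show "snd (tangent_map ?P A' snd u) e = snd w e"
      using snd_T(2)[OF cd(1,3), of u e] cd u v(2) tangent_space_jac[OF v(2) cd(3) _ cd(4)]
      by (auto simp: tangent_space_outside[OF v(2)])
  qed
  ultimately have "?T u = (z, w)"
    using u(1) by (simp add: prod_eq_iff)
  moreover have "u \<in> tangent_bundle ?P"
    using u pq by (simp add: mem_tangent_bundle points_prod_atlas)
  ultimately have "(z, w) \<in> ?T ` tangent_bundle ?P"
    by (metis (no_types, lifting) image_eqI)
  then have iso: "?u \<in> tangent_bundle ?P" "?T ?u = (z, w)"
    unfolding tangent_prod_iso_def by (rule inv_into_into, rule f_inv_into_f)
  show "?u \<in> tangent_bundle ?P"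
    by (rule iso(1))
  have "fst (fst (?T ?u)) = ?p" "fst (snd (?T ?u)) = ?q"
    unfolding iso(2) by simp_all
  then show fu: "fst ?u = (?p, ?q)"
    by (simp add: prod_eq_iff)
  have su: "snd ?u \<in> tangent_space ?P (fst ?u)"
    using iso(1) by (simp add: mem_tangent_bundle)
  \<comment> \<open>Whatever preimage \<open>inv_into\<close> picks, its coordinates can be read off
    from its projections, because \<open>jac c c\<close> and \<open>jac d d\<close> are
    identities.\<close>
  show "snd ?u (prod_chart c d) = (snd z c, snd w d)"
    if "c \<in> A" "d \<in> A'" "fst z \<in> fst c" "fst w \<in> fst d" for c d
  proof -
    have "snd z c = snd (fst (?T ?u)) c" "snd w d = snd (snd (?T ?u)) d"
      unfolding iso(2) by simp_all
    then show ?thesis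
      using snd_T(1)[OF that(1,2) _ _ su, of c] snd_T(2)[OF that(1,2) _ _ su, of d] that fu
      by (simp add: prod_eq_iff jac_self[OF A(1)] jac_self[OF A(2)])
  qed
qed

text \<open>Coordinate form of the identification of tangent bundles:
  \<open>((x, \<xi>), (y, \<eta>))\<close> becomes \<open>((x, y), (\<xi>, \<eta>))\<close>. Applied
  to basis vectors, it also translates indices.\<close>

definition tangent_swap :: "('a \<times> 'b) \<times> ('c \<times> 'd) \<Rightarrow> ('a \<times> 'c) \<times> ('b \<times> 'd)" where
  "tangent_swap z = ((fst (fst z), fst (snd z)), (snd (fst z), snd (snd z)))"

lemma tangent_swap_swap [simp]: "tangent_swap (tangent_swap z) = z"
  by (simp add: tangent_swap_def)

lemma bounded_linear_tangent_swap: "bounded_linear tangent_swap"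
  unfolding tangent_swap_def
  by (intro bounded_linear_Pair bounded_linear_compose[OF bounded_linear_fst]
      bounded_linear_compose[OF bounded_linear_snd] bounded_linear_fst bounded_linear_snd)

lemma tangent_prod_iso_chart:
  fixes A :: "('a, 'e::real_inner) atlas" and A' :: "('b, 'f::real_inner) atlas"
  assumes B: "coordinate_basis (B :: 'e set)" "coordinate_basis (B' :: 'f set)"
    and A: "smooth_atlas A" "smooth_atlas A'"
    and cd: "c \<in> A" "d \<in> A'" and X: "X \<in> (snd c ` fst c \<times> UNIV) \<times> (snd d ` fst d \<times> UNIV)"
  defines "z \<equiv> tangent_prod_iso A A' (chart_inv (prod_chart (tangent_chart A c) (tangent_chart A' d)) X)"
  shows "z \<in> fst (tangent_chart (prod_atlas A A') (prod_chart c d))"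
    and "snd (tangent_chart (prod_atlas A A') (prod_chart c d)) z = tangent_swap X"
proof -
  obtain p \<xi> q \<eta> where X: "X = ((snd c p, \<xi>), (snd d q, \<eta>))" and p: "p \<in> fst c" and q: "q \<in> fst d"
    using X by auto
  let ?p = "(p, tangent_vec A p c \<xi>)" and ?q = "(q, tangent_vec A' q d \<eta>)"
  have "(snd c p, \<xi>) \<in> snd (tangent_chart A c) ` fst (tangent_chart A c)"
    "(snd d q, \<eta>) \<in> snd (tangent_chart A' d) ` fst (tangent_chart A' d)"
    using p q by (auto simp: fst_tangent_chart tangent_chart_image[OF A(1) cd(1)] tangent_chart_image[OF A(2) cd(2)])
  then have "chart_inv (prod_chart (tangent_chart A c) (tangent_chart A' d)) X = (?p, ?q)"
    using cd p q A unfolding X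
    by (simp add: chart_inv_prod_chart[OF smooth_atlas_tangent[OF B(1) A(1)] smooth_atlas_tangent[OF B(2) A(2)]]
        tangent_chart_in chart_inv_tangent_chart chart_inv_left)
  then have z: "z = tangent_prod_iso A A' (?p, ?q)"
    by (simp add: z_def)
  have pq: "?p \<in> tangent_bundle A" "?q \<in> tangent_bundle A'"
    using p q cd tangent_vec_in[OF A(1) cd(1) p] tangent_vec_in[OF A(2) cd(2) q]
    by (simp_all add: mem_tangent_bundle in_points)
  note iso = tangent_prod_iso[OF B A pq]
  show "z \<in> fst (tangent_chart (prod_atlas A A') (prod_chart c d))"
    using iso(1,2) p q by (simp add: z mem_tangent_chart mem_tangent_bundle)
  show "snd (tangent_chart (prod_atlas A A') (prod_chart c d)) z = tangent_swap X"
    using iso(2) iso(3)[OF cd] p q cd A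
    by (simp add: z snd_tangent_chart tangent_swap_def X tangent_vec_self)
qed

lemma smooth_map_tangent_prod_iso:
  fixes A :: "('a, 'e::real_inner) atlas" and A' :: "('b, 'f::real_inner) atlas"
  assumes B: "coordinate_basis (B :: 'e set)" "coordinate_basis (B' :: 'f set)"
    and A: "smooth_atlas A" "smooth_atlas A'"
  shows "smooth_map (prod_atlas (tangent_atlas A) (tangent_atlas A')) (tangent_atlas (prod_atlas A A'))
    (tangent_prod_iso A A')"
proof (rule smooth_map_chartI[OF coordinate_basis_prod_basis[OF coordinate_basis_prod_basis[OF B(1,1)] coordinate_basis_prod_basis[OF B(2,2)]]
      coordinate_basis_prod_basis[OF coordinate_basis_prod_basis[OF B] coordinate_basis_prod_basis[OF B]]
      smooth_atlas_prod[OF coordinate_basis_prod_basis[OF B(1,1)] coordinate_basis_prod_basis[OF B(2,2)]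
        smooth_atlas_tangent[OF B(1) A(1)] smooth_atlas_tangent[OF B(2) A(2)]]
      smooth_atlas_tangent[OF coordinate_basis_prod_basis[OF B] smooth_atlas_prod[OF B A]]])
  fix z assume "z \<in> points (prod_atlas (tangent_atlas A) (tangent_atlas A'))"
  then have z: "fst z \<in> tangent_bundle A" "snd z \<in> tangent_bundle A'"
    by (auto simp: points_prod_atlas points_tangent_atlas)
  obtain c d where cd: "c \<in> A" "d \<in> A'" and zcd: "fst (fst z) \<in> fst c" "fst (snd z) \<in> fst d"
    using z pointsE unfolding mem_tangent_bundle by metis
  let ?C = "prod_chart (tangent_chart A c) (tangent_chart A' d)"
  let ?D = "tangent_chart (prod_atlas A A') (prod_chart c d)"
  have im: "snd ?C ` fst ?C = (snd c ` fst c \<times> UNIV) \<times> (snd d ` fst d \<times> UNIV)"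
    by (simp add: prod_chart_image fst_tangent_chart tangent_chart_image[OF A(1) cd(1)] tangent_chart_image[OF A(2) cd(2)])
  note C = prod_chart_in[OF tangent_chart_in[OF cd(1)] tangent_chart_in[OF cd(2)]]
  have iso: "tangent_prod_iso A A' w \<in> fst ?D" "snd ?D (tangent_prod_iso A A' w) = tangent_swap (snd ?C w)" if "w \<in> fst ?C" for w
    using tangent_prod_iso_chart[OF B A cd, of "snd ?C w"] that
      chart_inv_left[OF smooth_atlas_prod[OF coordinate_basis_prod_basis[OF B(1,1)] coordinate_basis_prod_basis[OF B(2,2)]
        smooth_atlas_tangent[OF B(1) A(1)] smooth_atlas_tangent[OF B(2) A(2)]] C that]
    unfolding im[symmetric] by (metis imageI)+
  moreover have "z \<in> fst ?C"
    using z zcd by (simp add: mem_Times_iff mem_tangent_chart mem_tangent_bundle)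
  ultimately show "\<exists>C\<in>prod_atlas (tangent_atlas A) (tangent_atlas A'). \<exists>D\<in>tangent_atlas (prod_atlas A A'). \<exists>f.
      z \<in> fst C \<and> tangent_prod_iso A A' ` fst C \<subseteq> fst D \<and> smooth_on (snd C ` fst C) f \<and>
      (\<forall>w\<in>fst C. f (snd C w) = snd D (tangent_prod_iso A A' w))"
    using C tangent_chart_in[OF prod_chart_in[OF cd]] smooth_on_bounded_linear[OF bounded_linear_tangent_swap]
    by (intro bexI[of _ ?C] bexI[of _ ?D] exI[of _ tangent_swap] conjI ballI image_subsetI) simp_all
qed

section \<open>The group structure of the tangent bundle\<close>

lemma carrier_group_of [simp]: "carrier (group_of S m) = S"
  by (simp add: group_of_def)

lemma mult_group_of [simp]: "x \<otimes>\<^bsub>group_of S m\<^esub> y = m (x, y)"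
  by (simp add: group_of_def)

text \<open>\<open>group_of\<close> recovers the unit by a definite description. The record with the
  explicit unit \<open>e\<close> is a group by the one-sided axioms, which makes \<open>e\<close> a
  two-sided unit and hence the described element.\<close>

lemma group_ofI:
  assumes closed: "\<And>x y. x \<in> S \<Longrightarrow> y \<in> S \<Longrightarrow> m (x, y) \<in> S"
    and assoc: "\<And>x y z. x \<in> S \<Longrightarrow> y \<in> S \<Longrightarrow> z \<in> S \<Longrightarrow> m (m (x, y), z) = m (x, m (y, z))"
    and e: "e \<in> S" "\<And>x. x \<in> S \<Longrightarrow> m (e, x) = x"
    and inv: "\<And>x. x \<in> S \<Longrightarrow> \<exists>y\<in>S. m (y, x) = e"
  shows "group (group_of S m)" and "\<one>\<^bsub>group_of S m\<^esub> = e"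
proof -
  let ?M = "\<lparr>carrier = S, monoid.mult = (\<lambda>x y. m (x, y)), one = e\<rparr>"
  have M: "group ?M"
    by (rule groupI) (use assms in auto)
  then have r: "m (x, e) = x" if "x \<in> S" for x
    using monoid.r_one[OF group.is_monoid[OF M], of x] that by simp
  then have "(THE e. e \<in> S \<and> (\<forall>x\<in>S. m (e, x) = x \<and> m (x, e) = x)) = e"
    using e by (intro the_equality) metis+
  then have "group_of S m = ?M"
    by (simp add: group_of_def)
  with M show "group (group_of S m)" and "\<one>\<^bsub>group_of S m\<^esub> = e"
    by simp_all
qed

lemma tangent_mult:
  fixes A :: "('a, 'e::real_inner) atlas"
  assumes B: "coordinate_basis (B :: 'e set)" and A: "smooth_atlas A"
    and m: "smooth_map (prod_atlas A A) A m"
    and z: "z \<in> tangent_bundle A" and w: "w \<in> tangent_bundle A"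
  shows "tangent_mult A m (z, w) \<in> tangent_bundle A"
    and "fst (tangent_mult A m (z, w)) = m (fst z, fst w)"
    and "c \<in> A \<Longrightarrow> c' \<in> A \<Longrightarrow> fst z \<in> fst c \<Longrightarrow> fst w \<in> fst c' \<Longrightarrow> d \<in> A \<Longrightarrow> m (fst z, fst w) \<in> fst d \<Longrightarrow>
      snd (tangent_mult A m (z, w)) d
        = local_differential m (fst z, fst w) (prod_chart c c') d (snd z c, snd w c')"
proof -
  let ?u = "tangent_prod_iso A A (z, w)"
  note P = smooth_atlas_prod[OF B B A A] and iso = tangent_prod_iso[OF B B A A z w]
  show "tangent_mult A m (z, w) \<in> tangent_bundle A"
    using tangent_map_in[OF P A m iso(1)] by (simp add: tangent_mult_def)
  show "fst (tangent_mult A m (z, w)) = m (fst z, fst w)"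
    using iso(2) by (simp add: tangent_mult_def)
  assume c: "c \<in> A" "c' \<in> A" "fst z \<in> fst c" "fst w \<in> fst c'" and d: "d \<in> A" "m (fst z, fst w) \<in> fst d"
  have "fst ?u \<in> fst (prod_chart c c')" "snd ?u \<in> tangent_space (prod_atlas A A) (fst ?u)"
    using iso(1,2) c by (auto simp: mem_tangent_bundle)
  from snd_tangent_map[OF P A m prod_chart_in[OF c(1,2)] this, of d]
  show "snd (tangent_mult A m (z, w)) d
        = local_differential m (fst z, fst w) (prod_chart c c') d (snd z c, snd w c')"
    using iso(2) iso(3)[OF c] d by (simp add: tangent_mult_def)
qed

lemma smooth_map_tangent_mult:
  fixes A :: "('a, 'e::real_inner) atlas"
  assumes B: "coordinate_basis (B :: 'e set)" and A: "smooth_atlas A"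
    and m: "smooth_map (prod_atlas A A) A m"
  shows "smooth_map (prod_atlas (tangent_atlas A) (tangent_atlas A)) (tangent_atlas A) (tangent_mult A m)"
proof -
  note BB = coordinate_basis_prod_basis[OF B B] and P = smooth_atlas_prod[OF B B A A]
    and TA = smooth_atlas_tangent[OF B A]
  show ?thesis
    unfolding tangent_mult_def
    by (rule smooth_map_compose[OF coordinate_basis_prod_basis[OF BB BB] coordinate_basis_prod_basis[OF BB BB] BB
        smooth_atlas_prod[OF BB BB TA TA] smooth_atlas_tangent[OF BB P] TA
        smooth_map_tangent_prod_iso[OF B B A A] smooth_map_tangent[OF BB B P A m]])
qed

section \<open>The group axioms on the tangent bundle\<close>

context
  fixes B :: "'e::real_inner set" and A :: "('a, 'e) atlas" and m :: "'a \<times> 'a \<Rightarrow> 'a"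
  assumes lie: "lie_group B A m"
begin

private abbreviation (input) "G \<equiv> group_of (points A) m"

private lemma B: "coordinate_basis B" and A: "smooth_atlas A" and G: "group G"
  and sm: "smooth_map (prod_atlas A A) A m" and si: "smooth_map A A (\<lambda>x. inv\<^bsub>G\<^esub> x)"
  using lie by (auto simp: lie_group_def smooth_manifold_def)

private lemma m_closed: "x \<in> points A \<Longrightarrow> y \<in> points A \<Longrightarrow> m (x, y) \<in> points A"
  using group.is_monoid[OF G] monoid.m_closed[of G x y] by simp

private lemma m_assoc:
  "x \<in> points A \<Longrightarrow> y \<in> points A \<Longrightarrow> z \<in> points A \<Longrightarrow> m (m (x, y), z) = m (x, m (y, z))"
  using group.is_monoid[OF G] monoid.m_assoc[of G x y z] by simp

private lemma m_one: "\<one>\<^bsub>G\<^esub> \<in> points A"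
  "x \<in> points A \<Longrightarrow> m (\<one>\<^bsub>G\<^esub>, x) = x" "x \<in> points A \<Longrightarrow> m (x, \<one>\<^bsub>G\<^esub>) = x"
  using group.is_monoid[OF G] monoid.one_closed[of G] monoid.l_one[of G x] monoid.r_one[of G x] by simp_all

private lemma m_inv: "x \<in> points A \<Longrightarrow> inv\<^bsub>G\<^esub> x \<in> points A"
  "x \<in> points A \<Longrightarrow> m (inv\<^bsub>G\<^esub> x, x) = \<one>\<^bsub>G\<^esub>"
  using group.inv_closed[OF G, of x] group.l_inv[OF G, of x] by simp_all

private lemma P: "smooth_atlas (prod_atlas A A)"
  by (rule smooth_atlas_prod[OF B B A A])

private lemma mult_has_derivative:
  assumes "c \<in> A" "c' \<in> A" "d \<in> A" "p \<in> fst c" "q \<in> fst c'" "m (p, q) \<in> fst d"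
  shows "(snd d \<circ> m \<circ> chart_inv (prod_chart c c') has_derivative
    local_differential m (p, q) (prod_chart c c') d) (at (snd c p, snd c' q))"
  using local_differential_has_derivative[OF P sm prod_chart_in[OF assms(1,2)] assms(3), of "(p, q)"] assms
  by simp

text \<open>Both bracketings are derivatives of one function, the triple product in coordinates,
  factored in two ways. Uniqueness of the derivative makes them agree, without recourse to an atlas
  on the triple product.\<close>

lemma tangent_mult_assoc:
  assumes z: "z \<in> tangent_bundle A" "w \<in> tangent_bundle A" "u \<in> tangent_bundle A"
  shows "tangent_mult A m (tangent_mult A m (z, w), u) = tangent_mult A m (z, tangent_mult A m (w, u))"
    (is "?L = ?R")
proof -
  note T = tangent_mult[OF B A sm]
  let ?p = "fst z" and ?q = "fst w" and ?r = "fst u"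
  have pts: "?p \<in> points A" "?q \<in> points A" "?r \<in> points A"
    using z by (auto simp: mem_tangent_bundle)
  note zw = T(1)[OF z(1,2)] and wu = T(1)[OF z(2,3)]
  obtain c1 c2 c3 where c: "c1 \<in> A" "?p \<in> fst c1" "c2 \<in> A" "?q \<in> fst c2" "c3 \<in> A" "?r \<in> fst c3"
    using pointsE[OF pts(1)] pointsE[OF pts(2)] pointsE[OF pts(3)] by metis
  obtain d where d: "d \<in> A" "m (?p, ?q) \<in> fst d"
    using pointsE[OF m_closed[OF pts(1,2)]] .
  obtain d' where d': "d' \<in> A" "m (?q, ?r) \<in> fst d'"
    using pointsE[OF m_closed[OF pts(2,3)]] .
  obtain e where e: "e \<in> A" "m (m (?p, ?q), ?r) \<in> fst e"
    using pointsE[OF m_closed[OF m_closed[OF pts(1,2)] pts(3)]] .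
  have e': "m (?p, m (?q, ?r)) \<in> fst e"
    using e(2) m_assoc[OF pts] by simp
  define f where "f = snd d \<circ> m \<circ> chart_inv (prod_chart c1 c2)"
  define g where "g = snd e \<circ> m \<circ> chart_inv (prod_chart d c3)"
  define f' where "f' = snd d' \<circ> m \<circ> chart_inv (prod_chart c2 c3)"
  define g' where "g' = snd e \<circ> m \<circ> chart_inv (prod_chart c1 d')"
  define F where "F = local_differential m (?p, ?q) (prod_chart c1 c2) d"
  define K where "K = local_differential m (m (?p, ?q), ?r) (prod_chart d c3) e"
  define F' where "F' = local_differential m (?q, ?r) (prod_chart c2 c3) d'"
  define K' where "K' = local_differential m (?p, m (?q, ?r)) (prod_chart c1 d') e"
  define X where "X = ((snd c1 ?p, snd c2 ?q), snd c3 ?r)"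
  \<comment> \<open>The left bracketing in coordinates, with no reference to the intermediate charts
    \<open>d\<close> and \<open>d'\<close>. By associativity of \<open>m\<close> the right
    bracketing gives the same function near \<open>X\<close>.\<close>
  define H where "H = (\<lambda>((x, y), t). snd e (m (m (chart_inv c1 x, chart_inv c2 y), chart_inv c3 t)))"
  let ?S = "snd (prod_chart c1 c2) ` (fst (prod_chart c1 c2) \<inter> m -` fst d)"
  let ?S' = "snd (prod_chart c2 c3) ` (fst (prod_chart c2 c3) \<inter> m -` fst d')"
  have f: "(f has_derivative F) (at (fst X))" and f': "(f' has_derivative F') (at (snd (fst X), snd X))"
    unfolding f_def F_def f'_def F'_def X_def fst_conv snd_conv
    using c d d' by (intro mult_has_derivative; simp)+
  have fX: "f (fst X) = snd d (m (?p, ?q))" "f' (snd (fst X), snd X) = snd d' (m (?q, ?r))"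
    using c by (auto simp: f_def f'_def X_def chart_inv_prod_chart[OF A A] chart_inv_left[OF A])
  have g: "(g has_derivative K) (at (f (fst X), snd X))" and g': "(g' has_derivative K') (at (fst (fst X), f' (snd (fst X), snd X)))"
    unfolding fX unfolding g_def K_def g'_def K'_def X_def fst_conv snd_conv
    using c d d' e e' by (intro mult_has_derivative; simp)+
  have "((\<lambda>Y. (f (fst Y), snd Y)) has_derivative (\<lambda>Y. (F (fst Y), snd Y))) (at X)"
    using has_derivative_Pair[OF has_derivative_compose_fst[OF f] has_derivative_snd[OF has_derivative_ident], of "snd X"]
    by simp
  from has_derivative_compose[OF this g]
  have "((\<lambda>Y. g (f (fst Y), snd Y)) has_derivative (\<lambda>Y. K (F (fst Y), snd Y))) (at X)" .
  moreover have "open (?S \<times> snd c3 ` fst c3)"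
    by (intro open_Times smooth_map_open[OF P A sm] prod_chart_in c d smooth_atlas_open[OF A])
  moreover have "X \<in> ?S \<times> snd c3 ` fst c3"
    unfolding X_def using c d by (auto intro!: image_eqI[of _ _ "(?p, ?q)"])
  moreover have "g (f (fst Y), snd Y) = H Y" if Y: "Y \<in> ?S \<times> snd c3 ` fst c3" for Y
  proof -
    obtain x y t where Y: "Y = ((snd c1 x, snd c2 y), snd c3 t)" "x \<in> fst c1" "y \<in> fst c2" "t \<in> fst c3" "m (x, y) \<in> fst d"
      using Y by auto
    then show ?thesis
      using c d by (simp add: f_def g_def H_def chart_inv_prod_chart[OF A A] chart_inv_left[OF A])
  qed
  ultimately have 1: "(H has_derivative (\<lambda>Y. K (F (fst Y), snd Y))) (at X)"
    by (rule has_derivative_transform_within_open)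
  \<comment> \<open>Regroups the coordinates: the second factorization is valid on a set described
    with the last two factors paired.\<close>
  let ?\<rho> = "\<lambda>Y. (fst (fst Y), (snd (fst Y), snd Y))"
  have "bounded_linear (\<lambda>Y :: ('e \<times> 'e) \<times> 'e. (snd (fst Y), snd Y))"
    by (intro bounded_linear_Pair bounded_linear_compose[OF bounded_linear_snd] bounded_linear_fst bounded_linear_snd)
  from bounded_linear.has_derivative[OF this has_derivative_ident]
  have "((\<lambda>Y. (snd (fst Y), snd Y)) has_derivative (\<lambda>Y. (snd (fst Y), snd Y))) (at X)" .
  from has_derivative_compose[OF this f']
  have "((\<lambda>Y. f' (snd (fst Y), snd Y)) has_derivative (\<lambda>Y. F' (snd (fst Y), snd Y))) (at X)" .
  from has_derivative_Pair[OF has_derivative_fst[OF has_derivative_fst[OF has_derivative_ident]] this]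
  have "((\<lambda>Y. (fst (fst Y), f' (snd (fst Y), snd Y))) has_derivative (\<lambda>Y. (fst (fst Y), F' (snd (fst Y), snd Y)))) (at X)" .
  from has_derivative_compose[OF this g']
  have "((\<lambda>Y. g' (fst (fst Y), f' (snd (fst Y), snd Y))) has_derivative (\<lambda>Y. K' (fst (fst Y), F' (snd (fst Y), snd Y)))) (at X)" .
  moreover have "open (?\<rho> -` (snd c1 ` fst c1 \<times> ?S'))"
    by (intro open_vimage open_Times smooth_map_open[OF P A sm] prod_chart_in c d' smooth_atlas_open[OF A] continuous_intros)
  moreover have "X \<in> ?\<rho> -` (snd c1 ` fst c1 \<times> ?S')"
    unfolding X_def using c d' by (auto intro!: image_eqI[of _ _ "(?q, ?r)"])
  moreover have "g' (fst (fst Y), f' (snd (fst Y), snd Y)) = H Y" if Y: "Y \<in> ?\<rho> -` (snd c1 ` fst c1 \<times> ?S')" for Y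
  proof -
    obtain x y t where "?\<rho> Y = (snd c1 x, (snd c2 y, snd c3 t))" and xyt: "x \<in> fst c1" "y \<in> fst c2" "t \<in> fst c3" "m (y, t) \<in> fst d'"
      using Y by auto
    then have Y: "Y = ((snd c1 x, snd c2 y), snd c3 t)"
      by (simp add: prod_eq_iff)
    have "m (m (x, y), t) = m (x, m (y, t))"
      by (intro m_assoc in_points[OF c(1) xyt(1)] in_points[OF c(3) xyt(2)] in_points[OF c(5) xyt(3)])
    then show ?thesis
      using c d' xyt unfolding Y
      by (simp add: f'_def g'_def H_def chart_inv_prod_chart[OF A A] chart_inv_left[OF A])
  qed
  ultimately have 2: "(H has_derivative (\<lambda>Y. K' (fst (fst Y), F' (snd (fst Y), snd Y)))) (at X)"
    by (rule has_derivative_transform_within_open)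
  \<comment> \<open>Comparison of the two derivatives of \<open>H\<close> at \<open>X\<close>; the
    coordinates of the three tangent vectors will be put for \<open>a\<close>, \<open>b\<close> and
    \<open>v\<close>.\<close>
  have "K (F (a, b), v) = K' (a, F' (b, v))" for a b v
    using fun_cong[OF has_derivative_unique[OF 1 2], of "((a, b), v)"] by simp
  moreover have "snd ?L e = K (F (snd z c1, snd w c2), snd u c3)"
    using T(3)[OF zw z(3), of d c3 e] T(3)[OF z(1,2), of c1 c2 d] T(2)[OF z(1,2)] c d e
    by (simp add: K_def F_def)
  moreover have "snd ?R e = K' (snd z c1, F' (snd w c2, snd u c3))"
    using T(3)[OF z(1) wu, of c1 d' e] T(3)[OF z(2,3), of c2 c3 d'] T(2)[OF z(2,3)] c d' e e'
    by (simp add: K'_def F'_def)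
  ultimately have eq: "snd ?L e = snd ?R e"
    by simp
  have fst_eq: "fst ?L = m (m (?p, ?q), ?r)" "fst ?R = m (m (?p, ?q), ?r)"
    using T(2)[OF zw z(3)] T(2)[OF z(1,2)] T(2)[OF z(1) wu] T(2)[OF z(2,3)] m_assoc[OF pts] by simp_all
  have "snd ?L = snd ?R"
    using T(1)[OF zw z(3)] T(1)[OF z(1) wu] eq e
    by (intro tangent_space_eqI[of _ A "m (m (?p, ?q), ?r)" _ e]) (auto simp: mem_tangent_bundle fst_eq)
  with fst_eq show ?thesis
    by (simp add: prod_eq_iff)
qed

private lemma zero_tangent: "p \<in> points A \<Longrightarrow> (p, \<lambda>c. 0) \<in> tangent_bundle A"
  using linear_0[OF linear_jac[OF A]] by (auto simp: mem_tangent_bundle tangent_space_def)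

private abbreviation (input) "E \<equiv> (\<one>\<^bsub>G\<^esub>, \<lambda>c. 0)"

text \<open>The vector at the unit is zero, so only the derivative in the second argument
  contributes. It is the derivative of left multiplication by the unit, that is, of the
  identity.\<close>

lemma tangent_mult_one:
  assumes z: "z \<in> tangent_bundle A"
  shows "tangent_mult A m (E, z) = z"
proof -
  note T = tangent_mult[OF B A sm] and E = zero_tangent[OF m_one(1)]
  let ?p = "fst z" and ?e = "\<one>\<^bsub>G\<^esub>"
  have p: "?p \<in> points A" and v: "snd z \<in> tangent_space A ?p"
    using z by (auto simp: mem_tangent_bundle)
  obtain c where c: "c \<in> A" "?p \<in> fst c"
    using pointsE[OF p] .
  obtain d where d: "d \<in> A" "?e \<in> fst d"
    using pointsE[OF m_one(1)] .
  note W = smooth_atlas_open[OF A c(1)]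
  note chart = chart_inv_prod_chart[OF A A] chart_inv_left[OF A]
  \<comment> \<open>The inclusion at the unit; its derivative \<open>(0, b)\<close> is the pair
    formed by the zero vector of \<open>E\<close> and an arbitrary vector in the coordinates of the
    second factor.\<close>
  have "((\<lambda>y. (snd d ?e, y)) has_derivative (\<lambda>b. (0, b))) (at (snd c ?p))"
    by (intro has_derivative_Pair has_derivative_const has_derivative_ident)
  from has_derivative_compose[OF this mult_has_derivative[OF d(1) c(1) c(1) d(2) c(2)]]
  have "((\<lambda>y. (snd c \<circ> m \<circ> chart_inv (prod_chart d c)) (snd d ?e, y)) has_derivative
      (\<lambda>b. local_differential m (?e, ?p) (prod_chart d c) c (0, b))) (at (snd c ?p))"
    using m_one(2)[OF p] c by simp
  then have "((\<lambda>y. y) has_derivative (\<lambda>b. local_differential m (?e, ?p) (prod_chart d c) c (0, b))) (at (snd c ?p))"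
    by (rule has_derivative_transform_within_open[OF _ W])
       (use c d m_one(2) in_points[OF c(1)] in \<open>auto simp: chart\<close>)
  then have "local_differential m (?e, ?p) (prod_chart d c) c (0, b) = b" for b
    using has_derivative_unique[OF _ has_derivative_ident] by metis
  then have "snd (tangent_mult A m (E, z)) c = snd z c"
    using T(3)[OF E z, of d c c] c d m_one(2)[OF p] by simp
  then have "snd (tangent_mult A m (E, z)) = snd z"
    using T(1,2)[OF E z] v c m_one(2)[OF p]
    by (intro tangent_space_eqI[of _ A ?p _ c]) (auto simp: mem_tangent_bundle)
  then show ?thesis
    using T(2)[OF E z] m_one(2)[OF p] by (simp add: prod_eq_iff)
qed

text \<open>The product of the inverse of \<open>x\<close> with \<open>x\<close> does not depend on
  \<open>x\<close>, so its derivative vanishes; by the chain rule this derivative computes the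
  product of the two tangent vectors.\<close>

lemma tangent_mult_inv:
  assumes z: "z \<in> tangent_bundle A"
  shows "tangent_mult A m (tangent_map A A (\<lambda>x. inv\<^bsub>G\<^esub> x) z, z) = E"
proof -
  note T = tangent_mult[OF B A sm] and E = zero_tangent[OF m_one(1)]
  let ?i = "\<lambda>x. inv\<^bsub>G\<^esub> x" and ?p = "fst z" and ?e = "\<one>\<^bsub>G\<^esub>"
  let ?w = "tangent_map A A ?i z"
  note w = tangent_map_in[OF A A si z]
  have p: "?p \<in> points A" and v: "snd z \<in> tangent_space A ?p"
    using z by (auto simp: mem_tangent_bundle)
  obtain c where c: "c \<in> A" "?p \<in> fst c"
    using pointsE[OF p] .
  obtain c' where c': "c' \<in> A" "?i ?p \<in> fst c'"
    using pointsE[OF m_inv(1)[OF p]] .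
  obtain d where d: "d \<in> A" "?e \<in> fst d"
    using pointsE[OF m_one(1)] .
  let ?f = "snd c' \<circ> ?i \<circ> chart_inv c" and ?F = "local_differential ?i ?p c c'"
  let ?K = "local_differential m (?i ?p, ?p) (prod_chart c' c) d"
  have f: "(?f has_derivative ?F) (at (snd c ?p))"
    using local_differential_has_derivative[OF A si c(1) c'(1) c(2) c'(2)] .
  have fp: "?f (snd c ?p) = snd c' (?i ?p)"
    using c by (simp add: chart_inv_left[OF A])
  have "(snd d \<circ> m \<circ> chart_inv (prod_chart c' c) has_derivative ?K) (at (?f (snd c ?p), snd c ?p))"
    unfolding fp using c c' d m_inv(2)[OF p] by (intro mult_has_derivative) auto
  from has_derivative_compose[OF has_derivative_Pair[OF f has_derivative_ident] this]
  have "((\<lambda>x. (snd d \<circ> m \<circ> chart_inv (prod_chart c' c)) (?f x, x)) has_derivative (\<lambda>a. ?K (?F a, a))) (at (snd c ?p))" .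
  moreover have "open (snd c ` (fst c \<inter> ?i -` fst c'))"
    using smooth_map_open[OF A A si c(1) c'(1)] .
  moreover have "snd c ?p \<in> snd c ` (fst c \<inter> ?i -` fst c')"
    using c c' by auto
  moreover have "(snd d \<circ> m \<circ> chart_inv (prod_chart c' c)) (?f x, x) = snd d ?e"
    if "x \<in> snd c ` (fst c \<inter> ?i -` fst c')" for x
    using that c c' m_inv(2) in_points[OF c(1)]
    by (auto simp: chart_inv_prod_chart[OF A A] chart_inv_left[OF A])
  ultimately have D: "((\<lambda>x. snd d ?e) has_derivative (\<lambda>a. ?K (?F a, a))) (at (snd c ?p))"
    by (rule has_derivative_transform_within_open)
  have K: "?K (?F a, a) = 0" for a
    using fun_cong[OF has_derivative_unique[OF D has_derivative_const], of a] .
  have "snd ?w c' = ?F (snd z c)"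
    using snd_tangent_map[OF A A si c v, of c'] c' by simp
  then have "snd (tangent_mult A m (?w, z)) d = 0"
    using T(3)[OF w z, of c' c d] c c' d m_inv(2)[OF p] K by simp
  then have "snd (tangent_mult A m (?w, z)) = snd E"
    using T(1,2)[OF w z] E m_inv(2)[OF p]
    by (intro tangent_space_eqI[OF _ _ d]) (simp_all add: mem_tangent_bundle)
  then show ?thesis
    using T(2)[OF w z] m_inv(2)[OF p] by (simp add: prod_eq_iff)
qed

lemma lie_group_tangent: "lie_group (prod_basis B B) (tangent_atlas A) (tangent_mult A m)"
proof -
  let ?T = "group_of (tangent_bundle A) (tangent_mult A m)" and ?i = "\<lambda>x. inv\<^bsub>G\<^esub> x"
  note w = tangent_map_in[OF A A si]
  have inv: "\<exists>w\<in>tangent_bundle A. tangent_mult A m (w, z) = E" if "z \<in> tangent_bundle A" for z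
    using tangent_mult_inv[OF that] w[OF that] by blast
  have grp: "group ?T" and one: "\<one>\<^bsub>?T\<^esub> = E"
    using group_ofI[of "tangent_bundle A" "tangent_mult A m" E, OF tangent_mult(1)[OF B A sm]
        tangent_mult_assoc zero_tangent[OF m_one(1)] tangent_mult_one inv]
    by simp_all
  \<comment> \<open>The inverse in \<open>?T\<close> is defined by a description; uniqueness of
    inverses identifies it with the tangent map of the inversion, whose smoothness is known.\<close>
  have "tangent_map A A ?i z = inv\<^bsub>?T\<^esub> z" if "z \<in> tangent_bundle A" for z
    using group.inv_equality[OF grp, of "tangent_map A A ?i z" z] tangent_mult_inv[OF that] w[OF that] that one
    by simp
  then have "smooth_map (tangent_atlas A) (tangent_atlas A) (\<lambda>z. inv\<^bsub>?T\<^esub> z)"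
    using smooth_map_cong[OF smooth_atlas_tangent[OF B A] smooth_atlas_tangent[OF B A] smooth_map_tangent[OF B B A A si]]
    by (simp add: points_tangent_atlas)
  then show ?thesis
    using grp lie smooth_manifold_tangent[of B A] smooth_map_tangent_mult[OF B A sm]
    by (simp add: lie_group_def points_tangent_atlas)
qed

end

section \<open>Bivectors in coordinates\<close>

text \<open>The pairings are Kronecker deltas on \<open>B\<close> and vanish at the index
  \<open>0\<close>, in accord with the convention for components.\<close>

lemma coordinate_sum_inner:
  assumes "coordinate_basis B" "a \<in> insert 0 B"
  shows "(\<Sum>i\<in>B. (i \<bullet> a) * g i) = (if a \<in> B then g a else (0::real))"
proof (cases "a \<in> B")
  case True
  have "(\<Sum>i\<in>B. (i \<bullet> a) * g i) = (\<Sum>i\<in>B. if i = a then g i else 0)"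
    using True inner_coordinate_basis[OF assms(1)] by (intro sum.cong) auto
  also have "\<dots> = g a"
    using True finite_coordinate_basis[OF assms(1)] by simp
  finally show ?thesis
    using True by simp
qed (use assms(2) in simp)

lemma coordinate_sum_inner2:
  assumes "coordinate_basis B" "a \<in> insert 0 B" "b \<in> insert 0 B"
    and "\<And>i j. \<not> (i \<in> B \<and> j \<in> B) \<Longrightarrow> w i j = 0"
  shows "(\<Sum>i\<in>B. \<Sum>j\<in>B. (i \<bullet> a) * (j \<bullet> b) * w i j) = (w a b :: real)"
proof -
  have inner: "(\<Sum>j\<in>B. (j \<bullet> b) * w i j) = w i b" for i
    using coordinate_sum_inner[OF assms(1,3), of "w i"] assms(4)[of i b] by auto
  have "(\<Sum>i\<in>B. \<Sum>j\<in>B. (i \<bullet> a) * (j \<bullet> b) * w i j) = (\<Sum>i\<in>B. (i \<bullet> a) * (\<Sum>j\<in>B. (j \<bullet> b) * w i j))"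
    by (simp add: sum_distrib_left mult.assoc)
  also have "\<dots> = w a b"
    unfolding inner using coordinate_sum_inner[OF assms(1,2), of "\<lambda>i. w i b"] assms(4)[of a b] by auto
  finally show ?thesis .
qed

lemma push_bivector_zero [simp]:
  "push_bivector B L w 0 l = 0" "push_bivector B L w k 0 = 0"
  by (simp_all add: push_bivector_def)

lemma push_bivector_cong:
  assumes "\<And>i j. i \<in> B \<Longrightarrow> j \<in> B \<Longrightarrow> w i j = w' i j"
  shows "push_bivector B L w k l = push_bivector B L w' k l"
  unfolding push_bivector_def using assms by (intro sum.cong refl) simp

text \<open>Functoriality of the second exterior power: each \<open>L (M a)\<close> is expanded over
  the intermediate basis \<open>C\<close>, then the finite sums are reordered.\<close>

lemma push_bivector_compose:
  assumes C: "coordinate_basis C" and L: "linear L"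
  shows "push_bivector C L (push_bivector B M w) k l = push_bivector B (\<lambda>v. L (M v)) w k l"
proof -
  have LM: "L (M a) \<bullet> k = (\<Sum>i\<in>C. (M a \<bullet> i) * (L i \<bullet> k))" for a k
    by (subst linear_coordinate_sum[OF C L]) (simp add: inner_sum_left)
  have "push_bivector B (\<lambda>v. L (M v)) w k l
      = (\<Sum>a\<in>B. \<Sum>b\<in>B. (\<Sum>i\<in>C. (M a \<bullet> i) * (L i \<bullet> k)) * (\<Sum>j\<in>C. (M b \<bullet> j) * (L j \<bullet> l)) * w a b)"
    unfolding push_bivector_def LM ..
  also have "\<dots> = (\<Sum>a\<in>B. \<Sum>b\<in>B. \<Sum>i\<in>C. \<Sum>j\<in>C. (L i \<bullet> k) * (L j \<bullet> l) * ((M a \<bullet> i) * (M b \<bullet> j) * w a b))"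
    unfolding sum_product unfolding sum_distrib_right by (intro sum.cong refl) (simp add: algebra_simps)
  also have "\<dots> = (\<Sum>a\<in>B. \<Sum>i\<in>C. \<Sum>j\<in>C. \<Sum>b\<in>B. (L i \<bullet> k) * (L j \<bullet> l) * ((M a \<bullet> i) * (M b \<bullet> j) * w a b))"
    by (intro sum.cong refl, subst sum.swap, intro sum.cong refl, subst sum.swap, rule refl)
  also have "\<dots> = (\<Sum>i\<in>C. \<Sum>j\<in>C. \<Sum>a\<in>B. \<Sum>b\<in>B. (L i \<bullet> k) * (L j \<bullet> l) * ((M a \<bullet> i) * (M b \<bullet> j) * w a b))"
    by (subst sum.swap, intro sum.cong refl, subst sum.swap, rule refl)
  also have "\<dots> = push_bivector C L (push_bivector B M w) k l"
    unfolding push_bivector_def sum_distrib_left ..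
  finally show ?thesis ..
qed

text \<open>Smoothness and antisymmetry are required for all indices, with vanishing outside
  \<open>B\<close>, so that components may be evaluated and differentiated at the index
  \<open>0\<close> too.\<close>

definition local_bivector ::
    "'e::real_inner set \<Rightarrow> 'e set \<Rightarrow> ('e \<Rightarrow> 'e \<Rightarrow> 'e \<Rightarrow> real) \<Rightarrow> bool" where
  "local_bivector B S P \<longleftrightarrow> open S \<and> (\<forall>i j. smooth_on S (P i j)) \<and>
     (\<forall>x\<in>S. \<forall>i j. P i j x = - P j i x) \<and> (\<forall>x\<in>S. \<forall>i j. \<not> (i \<in> B \<and> j \<in> B) \<longrightarrow> P i j x = 0)"

text \<open>For a \<open>local_bivector\<close> and basis vectors \<open>I\<close>, \<open>J\<close>
  at most one summand is nonzero: the first two give the mixed blocks, the third the block of two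
  fibre directions, and nothing is left for two base directions.\<close>

definition lift_comp ::
    "('e::real_inner \<Rightarrow> 'e \<Rightarrow> 'e \<Rightarrow> real) \<Rightarrow> 'e \<times> 'e \<Rightarrow> 'e \<times> 'e \<Rightarrow> 'e \<times> 'e \<Rightarrow> real" where
  "lift_comp P z I J = P (fst I) (snd J) (fst z) + P (snd I) (fst J) (fst z)
     + partial (snd z) (P (snd I) (snd J)) (fst z)"

lemma partial_cong_open:
  assumes "open S" "x \<in> S" "\<And>y. y \<in> S \<Longrightarrow> f y = g y" "f differentiable (at x)"
  shows "partial v f x = partial v g x"
  unfolding partial_def using frechet_derivative_transform_within_open[OF assms(4,1,2,3)] by simp

lemma partial_zero_open:
  assumes "open S" "x \<in> S" "\<And>y. y \<in> S \<Longrightarrow> f y = (0::real)"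
  shows "partial v f x = 0"
  using partial_cong_open[OF assms(1,2), of "\<lambda>_. 0" f v] assms(3) by (simp add: partial_def)

lemma local_bivectorD:
  assumes "local_bivector B S P"
  shows "open S" "smooth_on S (P i j)" "x \<in> S \<Longrightarrow> P i j x = - P j i x"
    "x \<in> S \<Longrightarrow> \<not> (i \<in> B \<and> j \<in> B) \<Longrightarrow> P i j x = 0"
  using assms unfolding local_bivector_def by blast+

text \<open>The pointwise relations hold on an open set, so they may be differentiated.\<close>

lemma local_bivector_partial:
  assumes P: "local_bivector B S P" and x: "x \<in> S"
  shows "partial v (P i j) x = - partial v (P j i) x"
    "\<not> (i \<in> B \<and> j \<in> B) \<Longrightarrow> partial v (P i j) x = 0"
proof -
  have d: "P j i differentiable (at x)"
    using smooth_on_differentiable[OF local_bivectorD(2)[OF P] x] .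
  have "partial v (P i j) x = partial v (\<lambda>y. - P j i y) x"
    by (rule partial_cong_open[OF local_bivectorD(1)[OF P] x local_bivectorD(3)[OF P]
        smooth_on_differentiable[OF local_bivectorD(2)[OF P] x]])
  also have "\<dots> = - partial v (P j i) x"
    using partial_eqI[OF has_derivative_minus[OF has_derivative_partial[OF d]]] .
  finally show "partial v (P i j) x = - partial v (P j i) x" .
  show "partial v (P i j) x = 0" if "\<not> (i \<in> B \<and> j \<in> B)"
    by (rule partial_zero_open[OF local_bivectorD(1)[OF P] x local_bivectorD(4)[OF P _ that]])
qed

lemma lift_comp_antisym:
  assumes "local_bivector B S P" "fst z \<in> S"
  shows "lift_comp P z I J = - lift_comp P z J I"
  using local_bivectorD(3)[OF assms(1,2), of "fst I" "snd J"] local_bivectorD(3)[OF assms(1,2), of "snd I" "fst J"]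
    local_bivector_partial(1)[OF assms, of "snd z" "snd I" "snd J"]
  by (simp add: lift_comp_def)

lemma lift_comp_zero:
  assumes "coordinate_basis B" "local_bivector B S P" "fst z \<in> S"
  shows "lift_comp P z 0 J = 0" "lift_comp P z I 0 = 0"
  using local_bivectorD(4)[OF assms(2,3)] local_bivector_partial(2)[OF assms(2,3)]
    zero_notin_coordinate_basis[OF assms(1)]
  by (simp_all add: lift_comp_def)

lemma prod_basis_fst_snd:
  assumes "I \<in> insert 0 (prod_basis B C)"
  shows "fst I \<in> insert 0 B" "snd I \<in> insert 0 C"
  using assms by (auto simp: prod_basis_def)

lemma local_tangent_lift_eq:
  assumes B: "coordinate_basis B" and P: "local_bivector B S P" and z: "fst z \<in> S"
    and I: "I \<in> prod_basis B B" and J: "J \<in> prod_basis B B"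
  shows "local_tangent_lift B P z I J = lift_comp P z I J"
proof -
  obtain x \<xi> where zx: "z = (x, \<xi>)"
    by (cases z)
  have x: "x \<in> S"
    using z by (simp add: zx)
  let ?Q = "\<lambda>i j. partial \<xi> (P i j) x"
  have IJ: "fst I \<in> insert 0 B" "snd I \<in> insert 0 B" "fst J \<in> insert 0 B" "snd J \<in> insert 0 B"
    using prod_basis_fst_snd I J by blast+
  have Q: "(\<Sum>k\<in>B. partial k (P i j) x * (\<xi> \<bullet> k)) = ?Q i j" for i j
    using partial_coordinate_sum[OF B smooth_on_differentiable[OF local_bivectorD(2)[OF P] x], of \<xi> i j]
    by (simp add: mult.commute)
  have sP: "(\<Sum>i\<in>B. \<Sum>j\<in>B. (i \<bullet> a) * (j \<bullet> b) * P i j x) = P a b x"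
    and sQ: "(\<Sum>i\<in>B. \<Sum>j\<in>B. (i \<bullet> a) * (j \<bullet> b) * ?Q i j) = ?Q a b"
    if "a \<in> insert 0 B" "b \<in> insert 0 B" for a b
    by (rule coordinate_sum_inner2[OF B that]; rule local_bivectorD(4)[OF P x] local_bivector_partial(2)[OF P x]; assumption)+
  have "(\<Sum>i\<in>B. \<Sum>j\<in>B. P i j x * wedge (i, 0) (0, j) I J)
      = (\<Sum>i\<in>B. \<Sum>j\<in>B. (i \<bullet> fst I) * (j \<bullet> snd J) * P i j x) - (\<Sum>i\<in>B. \<Sum>j\<in>B. (i \<bullet> fst J) * (j \<bullet> snd I) * P i j x)"
    unfolding sum_subtractf[symmetric]
    by (intro sum.cong refl) (simp add: wedge_def inner_prod_def algebra_simps)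
  \<comment> \<open>The second sum carries a minus sign, which antisymmetry of \<open>P\<close>
    turns into an exchange of its indices.\<close>
  also have "\<dots> = P (fst I) (snd J) x + P (snd I) (fst J) x"
    using local_bivectorD(3)[OF P x, of "snd I" "fst J"] 
    unfolding sP[OF IJ(1,4)] sP[OF IJ(3,2)] by simp
  finally have 1: "(\<Sum>i\<in>B. \<Sum>j\<in>B. P i j x * wedge (i, 0) (0, j) I J) = P (fst I) (snd J) x + P (snd I) (fst J) x" .
  have "(\<Sum>i\<in>B. \<Sum>j\<in>B. \<Sum>k\<in>B. partial k (P i j) x * (\<xi> \<bullet> k) * wedge (0, i) (0, j) I J)
      = (\<Sum>i\<in>B. \<Sum>j\<in>B. ?Q i j * wedge (0, i) (0, j) I J)"
    unfolding sum_distrib_right[symmetric] Q ..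
  also have "\<dots> = (\<Sum>i\<in>B. \<Sum>j\<in>B. (i \<bullet> snd I) * (j \<bullet> snd J) * ?Q i j) - (\<Sum>i\<in>B. \<Sum>j\<in>B. (i \<bullet> snd J) * (j \<bullet> snd I) * ?Q i j)"
    unfolding sum_subtractf[symmetric]
    by (intro sum.cong refl) (simp add: wedge_def inner_prod_def algebra_simps)
  \<comment> \<open>Both terms of the wedge contribute the same amount; the factor 2 cancels the 1/2
    in \<open>local_tangent_lift\<close>.\<close>
  also have "\<dots> = 2 * ?Q (snd I) (snd J)"
    using local_bivector_partial(1)[OF P x, of \<xi> "snd J" "snd I"] 
    unfolding sQ[OF IJ(2,4)] sQ[OF IJ(4,2)] by simp
  finally show ?thesis
    using 1 by (simp add: local_tangent_lift_def zx lift_comp_def)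
qed

lemma lift_comp_has_derivative:
  assumes B: "coordinate_basis B" and P: "local_bivector B S P" and x: "x \<in> S"
  shows "((\<lambda>z. lift_comp P z I J) has_derivative (\<lambda>(a, b).
      partial a (P (fst I) (snd J)) x + partial a (P (snd I) (fst J)) x
      + (partial a (partial \<xi> (P (snd I) (snd J))) x + partial b (P (snd I) (snd J)) x))) (at (x, \<xi>))"
proof -
  note sm = local_bivectorD(2)[OF P]
  have D: "((\<lambda>z. P i j (fst z)) has_derivative (\<lambda>z. partial (fst z) (P i j) x)) (at (x, \<xi>))" for i j
    by (rule has_derivative_compose_fst[OF has_derivative_partial[OF smooth_on_differentiable[OF sm x]]])
  show ?thesis
    using has_derivative_add[OF has_derivative_add[OF D D] frechet_derivative_fst_arg[OF B local_bivectorD(1)[OF P] sm x]]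
    by (simp add: lift_comp_def partial_def[of "snd _"] split_def)
qed

lemma smooth_on_lift_comp:
  assumes B: "coordinate_basis B" and P: "local_bivector B S P"
  shows "smooth_on (S \<times> UNIV) (\<lambda>z. lift_comp P z I J)"
proof -
  note sm = local_bivectorD(2)[OF P] and S = local_bivectorD(1)[OF P]
  have o: "open (S \<times> (UNIV :: 'a set))"
    using S by (simp add: open_Times)
  have "smooth_on (S \<times> UNIV) (\<lambda>z. (P (fst I) (snd J) (fst z) + P (snd I) (fst J) (fst z))
      + (\<lambda>(x, \<xi>). frechet_derivative (P (snd I) (snd J)) (at x) \<xi>) z)"
    by (intro smooth_on_add o smooth_on_compose_fst[OF B S] smooth_on_frechet_derivative[OF B S] sm open_UNIV)
  then show ?thesis
    by (simp add: lift_comp_def partial_def split_def)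
qed

lemma push_bivector_lift_comp:
  fixes f :: "'e::real_inner \<Rightarrow> 'f::real_inner"
  assumes B: "coordinate_basis B" and C: "coordinate_basis C"
    and P: "local_bivector B S P" and Q: "local_bivector C T Q"
    and f: "smooth_on S f" "f ` S \<subseteq> T"
    and push: "\<And>x k l. x \<in> S \<Longrightarrow> k \<in> C \<Longrightarrow> l \<in> C \<Longrightarrow>
      Q k l (f x) = push_bivector B (frechet_derivative f (at x)) (\<lambda>i j. P i j x) k l"
    and z: "fst z \<in> S" and K: "K \<in> prod_basis C C" and L: "L \<in> prod_basis C C"
  shows "lift_comp Q (tangent_fun f z) K L
    = push_bivector (prod_basis B B) (frechet_derivative (tangent_fun f) (at z)) (lift_comp P z) K L"
proof -
  obtain x \<xi> where zx: "z = (x, \<xi>)"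
    by (cases z)
  have x: "x \<in> S"
    using z by (simp add: zx)
  have S: "open S"
    using local_bivectorD(1)[OF P] .
  note zB = zero_notin_coordinate_basis[OF B] and zC = zero_notin_coordinate_basis[OF C]
  let ?D = "\<lambda>i. partial i f x" and ?D2 = "\<lambda>i. partial \<xi> (partial i f) x"
  obtain a b a' b' where KL: "K = (a, b)" "L = (a', b')"
    by (cases K, cases L)
  have ab: "a \<in> insert 0 C" "b \<in> insert 0 C" "a' \<in> insert 0 C" "b' \<in> insert 0 C"
    using prod_basis_fst_snd K L KL by fastforce+
  \<comment> \<open>Extends \<open>push\<close> to the index \<open>0\<close>, where both sides
    vanish.\<close>
  have Qf: "Q k l (f y) = (\<Sum>i\<in>B. \<Sum>j\<in>B. (partial i f y \<bullet> k) * (partial j f y \<bullet> l) * P i j y)"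
    if "k \<in> insert 0 C" "l \<in> insert 0 C" "y \<in> S" for k l y
  proof (cases "k \<in> C \<and> l \<in> C")
    case True
    then show ?thesis
      using push[OF that(3)] by (simp add: push_bivector_def partial_def)
  next
    case False
    then have "k = 0 \<or> l = 0" "Q k l (f y) = 0"
      using that f(2) local_bivectorD(4)[OF Q, of "f y" k l] by auto
    then show ?thesis
      by auto
  qed
  have df: "f differentiable (at x)" "partial i f differentiable (at x)"
    and dP: "P i j differentiable (at x)" for i j
    using smooth_on_differentiable smooth_on_partial f(1) local_bivectorD(2)[OF P] x by metis+
  have "(Q b b' has_derivative (\<lambda>v. partial v (Q b b') (f x))) (at (f x))"
    using smooth_on_differentiable[OF local_bivectorD(2)[OF Q]] f(2) x by (intro has_derivative_partial) auto
  from has_derivative_compose[OF has_derivative_partial[OF df(1)] this]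
  \<comment> \<open>The function \<open>Q b b' (f y)\<close> of \<open>y\<close> is differentiated
    at \<open>x\<close> once by the chain rule and once, through \<open>Qf\<close>, by the product
    rule; equating the values on \<open>\<xi>\<close> gives \<open>dQ\<close>.\<close>
  have 1: "((\<lambda>y. Q b b' (f y)) has_derivative (\<lambda>v. partial (partial v f x) (Q b b') (f x))) (at x)" .
  have "((\<lambda>y. \<Sum>i\<in>B. \<Sum>j\<in>B. (partial i f y \<bullet> b) * (partial j f y \<bullet> b') * P i j y) has_derivative
      (\<lambda>v. \<Sum>i\<in>B. \<Sum>j\<in>B. (?D i \<bullet> b) * (?D j \<bullet> b') * partial v (P i j) x
        + ((?D i \<bullet> b) * (partial v (partial j f) x \<bullet> b') + (partial v (partial i f) x \<bullet> b) * (?D j \<bullet> b')) * P i j x)) (at x)"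
    by (intro has_derivative_sum has_derivative_mult has_derivative_inner_left has_derivative_partial df dP)
  then have "((\<lambda>y. Q b b' (f y)) has_derivative
      (\<lambda>v. \<Sum>i\<in>B. \<Sum>j\<in>B. (?D i \<bullet> b) * (?D j \<bullet> b') * partial v (P i j) x
        + ((?D i \<bullet> b) * (partial v (partial j f) x \<bullet> b') + (partial v (partial i f) x \<bullet> b) * (?D j \<bullet> b')) * P i j x)) (at x)"
    by (rule has_derivative_transform_within_open[OF _ S x]) (simp add: Qf[OF ab(2,4)])
  from fun_cong[OF has_derivative_unique[OF 1 this], of \<xi>]
  have dQ: "partial (?D \<xi>) (Q b b') (f x) = (\<Sum>i\<in>B. \<Sum>j\<in>B. (?D i \<bullet> b) * (?D j \<bullet> b') * partial \<xi> (P i j) x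
        + ((?D i \<bullet> b) * (?D2 j \<bullet> b') + (?D2 i \<bullet> b) * (?D j \<bullet> b')) * P i j x)" .
  have "tangent_fun f z = (f x, ?D \<xi>)"
    by (simp add: zx tangent_fun_def partial_def)
  then have "lift_comp Q (tangent_fun f z) K L = Q a b' (f x) + Q b a' (f x) + partial (?D \<xi>) (Q b b') (f x)"
    by (simp add: lift_comp_def KL)
  also have "\<dots> = (\<Sum>i\<in>B. \<Sum>j\<in>B. (?D i \<bullet> a) * (?D j \<bullet> b') * P i j x) + (\<Sum>i\<in>B. \<Sum>j\<in>B. (?D i \<bullet> b) * (?D j \<bullet> a') * P i j x)
      + (\<Sum>i\<in>B. \<Sum>j\<in>B. (?D i \<bullet> b) * (?D j \<bullet> b') * partial \<xi> (P i j) x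
        + ((?D i \<bullet> b) * (?D2 j \<bullet> b') + (?D2 i \<bullet> b) * (?D j \<bullet> b')) * P i j x)"
    unfolding dQ Qf[OF ab(1,4) x] Qf[OF ab(2,3) x] ..
  \<comment> \<open>The two terms with \<open>?D2\<close> are absorbed, one into each of the first
    two sums. The brackets are then the pairings of the image of \<open>(i, 0)\<close> or
    \<open>(j, 0)\<close> under the Jacobian of the tangent map with \<open>K\<close> or
    \<open>L\<close>.\<close>
  also have "\<dots> = (\<Sum>i\<in>B. \<Sum>j\<in>B. (?D i \<bullet> a + ?D2 i \<bullet> b) * (?D j \<bullet> b') * P i j x)
      + ((\<Sum>i\<in>B. \<Sum>j\<in>B. (?D i \<bullet> b) * (?D j \<bullet> a' + ?D2 j \<bullet> b') * P i j x)
      + (\<Sum>i\<in>B. \<Sum>j\<in>B. (?D i \<bullet> b) * (?D j \<bullet> b') * partial \<xi> (P i j) x))"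
    unfolding sum.distrib[symmetric] by (intro sum.cong refl) (simp add: algebra_simps)
  also have "\<dots> = push_bivector (prod_basis B B) (\<lambda>(u, v). (?D u, ?D2 u + ?D v)) (lift_comp P z) K L"
  proof -
    \<comment> \<open>For the images of \<open>(i, 0)\<close> and \<open>(0, j)\<close>: the empty
      slot contributes nothing.\<close>
    have 0: "?D 0 = 0" "?D2 0 = 0"
      using linear_0[OF linear_partial[OF df(1)]] partial_commute[OF S x f(1), of \<xi> 0]
        linear_0[OF linear_partial[OF df(2)[of \<xi>]]] by simp_all
    have lP: "lift_comp P z (i, 0) (j, 0) = 0" "lift_comp P z (i, 0) (0, j) = P i j x"
      "lift_comp P z (0, i) (j, 0) = P i j x" "lift_comp P z (0, i) (0, j) = partial \<xi> (P i j) x" for i j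
      using local_bivectorD(4)[OF P x] local_bivector_partial(2)[OF P x] zB by (simp_all add: lift_comp_def zx)
    show ?thesis
      unfolding push_bivector_def
      by (simp add: sum_prod_basis[OF B B] lP KL 0 sum.distrib inner_add_left)
  qed
  also have "(\<lambda>(u, v). (?D u, ?D2 u + ?D v)) = frechet_derivative (tangent_fun f) (at z)"
    using frechet_derivative_at[OF has_derivative_tangent_fun[OF B S f(1) x, of \<xi>]] by (simp add: zx)
  finally show ?thesis .
qed

lemma schouten_lift_comp:
  fixes P :: "'e::real_inner \<Rightarrow> 'e \<Rightarrow> 'e \<Rightarrow> real"
  assumes B: "coordinate_basis B" and P: "local_bivector B S P"
    and poisson: "\<And>x i j k. x \<in> S \<Longrightarrow> i \<in> B \<Longrightarrow> j \<in> B \<Longrightarrow> k \<in> B \<Longrightarrow> schouten B P P i j k x = 0"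
    and z: "fst z \<in> S" and I: "I \<in> prod_basis B B" and J: "J \<in> prod_basis B B" and K: "K \<in> prod_basis B B"
  shows "schouten (prod_basis B B) (\<lambda>I J z. lift_comp P z I J) (\<lambda>I J z. lift_comp P z I J) I J K z = 0"
proof -
  obtain x \<xi> where zx: "z = (x, \<xi>)"
    by (cases z)
  have x: "x \<in> S"
    using z by (simp add: zx)
  have S: "open S"
    using local_bivectorD(1)[OF P] .
  note zB = zero_notin_coordinate_basis[OF B]
  \<comment> \<open>One term of the Jacobi identity: the Schouten bracket of \<open>P\<close> with
    itself is twice the cyclic sum of \<open>N\<close>.\<close>
  define N where "N i j k y = (\<Sum>l\<in>B. P i l y * partial l (P j k) y)" for i j k y
  \<comment> \<open>The Jacobi identity on \<open>insert 0 B\<close>; if some index is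
    \<open>0\<close>, every term contains a vanishing component or a vanishing derivative of
    one.\<close>
  have cyc: "N i j k y + N j k i y + N k i j y = 0"
    if "i \<in> insert 0 B" "j \<in> insert 0 B" "k \<in> insert 0 B" "y \<in> S" for i j k y
  proof (cases "i \<in> B \<and> j \<in> B \<and> k \<in> B")
    case True
    have "schouten B P P i j k y = 2 * (N i j k y + N j k i y + N k i j y)"
      unfolding schouten_def N_def by (simp add: sum.distrib sum_distrib_left)
    then show ?thesis
      using poisson[OF that(4)] True by simp
  next
    case False
    then show ?thesis
      using that local_bivectorD(4)[OF P that(4)] local_bivector_partial(2)[OF P that(4)] by (auto simp: N_def zB)
  qed
  have dP: "P i j differentiable (at x)" "partial l (P i j) differentiable (at x)" for i j l
    using smooth_on_differentiable smooth_on_partial local_bivectorD(2)[OF P] x by metis+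
  \<comment> \<open>The derivative of \<open>N i j k\<close> at \<open>x\<close> along
    \<open>\<xi>\<close>, with the second derivatives in the order in which they occur in the
    bracket of the lift.\<close>
  define DN where "DN i j k = (\<Sum>l\<in>B. P i l x * partial l (partial \<xi> (P j k)) x + partial \<xi> (P i l) x * partial l (P j k) x)" for i j k
  have dN: "(N i j k has_derivative (\<lambda>v. \<Sum>l\<in>B. P i l x * partial v (partial l (P j k)) x + partial v (P i l) x * partial l (P j k) x)) (at x)" for i j k
    unfolding N_def[abs_def] by (intro has_derivative_sum has_derivative_mult has_derivative_partial dP)
  have DN: "(\<Sum>l\<in>B. P i l x * partial \<xi> (partial l (P j k)) x + partial \<xi> (P i l) x * partial l (P j k) x) = DN i j k" for i j k
    unfolding DN_def by (intro sum.cong refl) (simp add: partial_commute[OF S x local_bivectorD(2)[OF P], of \<xi>])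
  \<comment> \<open>The Jacobi identity holds on the open set \<open>S\<close>, so its derivative
    along \<open>\<xi>\<close> vanishes as well.\<close>
  have cycD: "DN i j k + DN j k i + DN k i j = 0"
    if "i \<in> insert 0 B" "j \<in> insert 0 B" "k \<in> insert 0 B" for i j k
  proof -
    have 1: "partial \<xi> (\<lambda>y. N i j k y + N j k i y + N k i j y) x = DN i j k + DN j k i + DN k i j"
      using partial_eqI[OF has_derivative_add[OF has_derivative_add[OF dN[of i j k] dN[of j k i]] dN[of k i j]], of \<xi>]
      by (simp only: DN)
    have "partial \<xi> (\<lambda>y. N i j k y + N j k i y + N k i j y) x = 0"
      using cyc[OF that] by (rule partial_zero_open[OF S x])
    then show ?thesis
      using 1 by simp
  qed
  \<comment> \<open>One summand of the bracket of the lift, with the directions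
    \<open>(l, 0)\<close> and \<open>(0, l)\<close> summed separately. The factor
    \<open>N a b' c'\<close> and the second half of \<open>DN\<close> come from the latter.\<close>
  have E: "(\<Sum>L\<in>prod_basis B B. lift_comp P z (a, a') L * partial L (\<lambda>z. lift_comp P z (b, b') (c, c')) z)
      = N a' b c' x + N a' b' c x + N a b' c' x + DN a' b' c'" for a a' b b' c c'
  proof -
    have W: "lift_comp P z (a, a') (l, 0) = P a' l x" "lift_comp P z (a, a') (0, l) = P a l x + partial \<xi> (P a' l) x" for l
      using local_bivectorD(4)[OF P x] local_bivector_partial(2)[OF P x] zB by (simp_all add: lift_comp_def zx)
    have D: "partial (u, v) (\<lambda>z. lift_comp P z (b, b') (c, c')) z
        = partial u (P b c') x + partial u (P b' c) x + (partial u (partial \<xi> (P b' c')) x + partial v (P b' c') x)" for u v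
      using partial_eqI[OF lift_comp_has_derivative[OF B P x], of "(u, v)"] by (simp add: zx)
    have 0: "partial 0 g x = 0" if "g differentiable (at x)" for g :: "'e \<Rightarrow> real"
      using linear_0[OF linear_partial[OF that]] .
    show ?thesis
      unfolding sum_prod_basis[OF B B] W D N_def DN_def sum.distrib[symmetric]
      by (intro sum.cong refl) (simp add: 0 dP algebra_simps)
  qed
  obtain a a' b b' c c' where abc: "I = (a, a')" "J = (b, b')" "K = (c, c')"
    by (cases I, cases J, cases K)
  have mem: "a \<in> insert 0 B" "a' \<in> insert 0 B" "b \<in> insert 0 B" "b' \<in> insert 0 B" "c \<in> insert 0 B" "c' \<in> insert 0 B"
    using prod_basis_fst_snd I J K abc by fastforce+
  have "schouten (prod_basis B B) (\<lambda>I J z. lift_comp P z I J) (\<lambda>I J z. lift_comp P z I J) I J K z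
      = 2 * ((\<Sum>L\<in>prod_basis B B. lift_comp P z I L * partial L (\<lambda>z. lift_comp P z J K) z)
         + (\<Sum>L\<in>prod_basis B B. lift_comp P z J L * partial L (\<lambda>z. lift_comp P z K I) z)
         + (\<Sum>L\<in>prod_basis B B. lift_comp P z K L * partial L (\<lambda>z. lift_comp P z I J) z))"
    unfolding schouten_def by (simp add: sum.distrib sum_distrib_left)
  \<comment> \<open>Regrouped by which of the three indices contributes its base entry, the last
    group having none. Each group is a cyclic sum.\<close>
  also have "\<dots> = 2 * ((N a' b c' x + N b c' a' x + N c' a' b x) + (N a' b' c x + N b' c a' x + N c a' b' x)
      + (N a b' c' x + N b' c' a x + N c' a b' x) + (DN a' b' c' + DN b' c' a' + DN c' a' b'))"
    unfolding abc E by simp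
  also have "\<dots> = 0"
    using cyc[OF mem(2,3,6) x] cyc[OF mem(2,4,5) x] cyc[OF mem(1,4,6) x] cycD[OF mem(2,4,6)] by simp
  finally show ?thesis .
qed

section \<open>Poisson maps in charts\<close>

lemma bivector_spaceD:
  assumes "w \<in> bivector_space B A p"
  shows "\<not> (c \<in> A \<and> p \<in> fst c \<and> i \<in> B \<and> j \<in> B) \<Longrightarrow> w c i j = 0"
    and "w c i j = - w c j i"
    and "c \<in> A \<Longrightarrow> d \<in> A \<Longrightarrow> p \<in> fst c \<Longrightarrow> p \<in> fst d \<Longrightarrow> k \<in> B \<Longrightarrow> l \<in> B \<Longrightarrow>
      w d k l = push_bivector B (jac c d p) (w c) k l"
  using assms unfolding bivector_space_def mem_Collect_eq by blast+

lemma bivector_fieldD: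
  assumes "bivector_field B A \<Lambda>"
  shows "p \<in> points A \<Longrightarrow> \<Lambda> p \<in> bivector_space B A p"
    and "c \<in> A \<Longrightarrow> i \<in> B \<Longrightarrow> j \<in> B \<Longrightarrow> smooth_on (snd c ` fst c) (components c \<Lambda> i j)"
  using assms unfolding bivector_field_def by blast+

lemma local_bivector_components:
  assumes A: "smooth_atlas A" and \<Lambda>: "bivector_field B A \<Lambda>" and c: "c \<in> A"
  shows "local_bivector B (snd c ` fst c) (components c \<Lambda>)"
proof -
  have sp: "\<Lambda> (chart_inv c x) \<in> bivector_space B A (chart_inv c x)" if "x \<in> snd c ` fst c" for x
    using bivector_fieldD(1)[OF \<Lambda> in_points[OF c chart_inv_in[OF that]]] .
  have zero: "components c \<Lambda> i j x = 0" if "x \<in> snd c ` fst c" "\<not> (i \<in> B \<and> j \<in> B)" for x i j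
    unfolding components_def using bivector_spaceD(1)[OF sp[OF that(1)]] that(2) by blast
  have "smooth_on (snd c ` fst c) (components c \<Lambda> i j)" for i j
  proof (cases "i \<in> B \<and> j \<in> B")
    case False
    show ?thesis
      by (rule smooth_on_cong[OF smooth_atlas_open[OF A c] smooth_on_const[of _ 0]]) (simp add: zero[OF _ False])
  qed (use bivector_fieldD(2)[OF \<Lambda> c] in blast)
  moreover have "components c \<Lambda> i j x = - components c \<Lambda> j i x" if "x \<in> snd c ` fst c" for x i j
    unfolding components_def by (rule bivector_spaceD(2)[OF sp[OF that]])
  ultimately show ?thesis
    unfolding local_bivector_def using smooth_atlas_open[OF A c] zero by blast
qed

text \<open>\<open>bivector_map\<close> uses a chart chosen by \<open>SOME\<close>; the
  transformation law of bivectors and functoriality of \<open>push_bivector\<close> remove the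
  choice.\<close>

lemma bivector_map_chart:
  assumes B: "coordinate_basis B"
    and A: "smooth_atlas A" "smooth_atlas A'" and \<phi>: "smooth_map A A' \<phi>"
    and w: "w \<in> bivector_space B A p" and c: "c \<in> A" "p \<in> fst c" and d: "d \<in> A'" "\<phi> p \<in> fst d"
    and kl: "k \<in> B'" "l \<in> B'"
  shows "bivector_map B A B' A' \<phi> p w d k l = push_bivector B (local_differential \<phi> p c d) (w c) k l"
proof -
  let ?c = "chart_at A p"
  note c' = chart_at[OF in_points[OF c]]
  have "push_bivector B (local_differential \<phi> p ?c d) (w ?c) k l
      = push_bivector B (local_differential \<phi> p ?c d) (push_bivector B (jac c ?c p) (w c)) k l"
    by (rule push_bivector_cong) (rule bivector_spaceD(3)[OF w c(1) c'(1) c(2) c'(2)])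
  also have "\<dots> = push_bivector B (\<lambda>v. local_differential \<phi> p ?c d (jac c ?c p v)) (w c) k l"
    by (rule push_bivector_compose[OF B linear_local_differential[OF A(1) \<phi> c'(1) d(1) c'(2) d(2)]])
  also have "\<dots> = push_bivector B (local_differential \<phi> p c d) (w c) k l"
    unfolding local_differential_change_chart(1)[OF A \<phi> c(1) c'(1) d(1,1) c(2) c'(2) d(2,2)] ..
  finally show ?thesis
    using d kl by (simp add: bivector_map_def)
qed

lemma poisson_mapD:
  assumes B: "coordinate_basis B"
    and A: "smooth_atlas A" "smooth_atlas A'" and \<phi>: "poisson_map B A \<Lambda> B' A' \<Lambda>' \<phi>"
    and w: "\<Lambda> p \<in> bivector_space B A p" and c: "c \<in> A" "p \<in> fst c" and d: "d \<in> A'" "\<phi> p \<in> fst d"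
    and kl: "k \<in> B'" "l \<in> B'"
  shows "\<Lambda>' (\<phi> p) d k l = push_bivector B (local_differential \<phi> p c d) (\<Lambda> p c) k l"
proof -
  have sm: "smooth_map A A' \<phi>" and "bivector_map B A B' A' \<phi> p (\<Lambda> p) = \<Lambda>' (\<phi> p)"
    using \<phi> in_points[OF c] unfolding poisson_map_def by blast+
  then show ?thesis
    using bivector_map_chart[OF B A sm w c d, of k B' l] kl by simp
qed

text \<open>Both sides obey the transformation law of bivectors at \<open>\<phi> p\<close>, so
  agreement in one chart around that point implies it in all; for other charts and indices both are
  \<open>0\<close>.\<close>

lemma poisson_mapI:
  assumes B: "coordinate_basis B" "coordinate_basis B'"
    and A: "smooth_atlas A" "smooth_atlas A'" and \<phi>: "smooth_map A A' \<phi>"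
    and w: "\<And>p. p \<in> points A \<Longrightarrow> \<Lambda> p \<in> bivector_space B A p"
    and w': "\<And>p. p \<in> points A' \<Longrightarrow> \<Lambda>' p \<in> bivector_space B' A' p"
    and loc: "\<And>p. p \<in> points A \<Longrightarrow> \<exists>c\<in>A. \<exists>d\<in>A'. p \<in> fst c \<and> \<phi> p \<in> fst d \<and> (\<forall>k\<in>B'. \<forall>l\<in>B'.
      \<Lambda>' (\<phi> p) d k l = push_bivector B (local_differential \<phi> p c d) (\<Lambda> p c) k l)"
  shows "poisson_map B A \<Lambda> B' A' \<Lambda>' \<phi>"
  unfolding poisson_map_def
proof (intro conjI ballI \<phi> ext)
  fix p e k l assume p: "p \<in> points A"
  note sp = w[OF p] and sp' = w'[OF smooth_map_in_points[OF \<phi> A p]]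
  show "bivector_map B A B' A' \<phi> p (\<Lambda> p) e k l = \<Lambda>' (\<phi> p) e k l"
  proof (cases "e \<in> A' \<and> \<phi> p \<in> fst e \<and> k \<in> B' \<and> l \<in> B'")
    case True
    obtain c d where c: "c \<in> A" "p \<in> fst c" and d: "d \<in> A'" "\<phi> p \<in> fst d"
      and eq: "\<And>k l. k \<in> B' \<Longrightarrow> l \<in> B' \<Longrightarrow> \<Lambda>' (\<phi> p) d k l = push_bivector B (local_differential \<phi> p c d) (\<Lambda> p c) k l"
      using loc[OF p] by blast
    have e: "e \<in> A'" "\<phi> p \<in> fst e" and kl: "k \<in> B'" "l \<in> B'"
      using True by auto
    have "\<Lambda>' (\<phi> p) e k l = push_bivector B' (jac d e (\<phi> p)) (\<Lambda>' (\<phi> p) d) k l"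
      using bivector_spaceD(3)[OF sp' d(1) e(1) d(2) e(2) kl] .
    also have "\<dots> = push_bivector B' (jac d e (\<phi> p)) (push_bivector B (local_differential \<phi> p c d) (\<Lambda> p c)) k l"
      by (rule push_bivector_cong) (rule eq)
    also have "\<dots> = push_bivector B (\<lambda>v. jac d e (\<phi> p) (local_differential \<phi> p c d v)) (\<Lambda> p c) k l"
      by (rule push_bivector_compose[OF B(2) linear_jac[OF A(2) d(1) e(1) d(2) e(2)]])
    also have "\<dots> = push_bivector B (local_differential \<phi> p c e) (\<Lambda> p c) k l"
      unfolding local_differential_change_chart(2)[OF A \<phi> c(1,1) d(1) e(1) c(2,2) d(2) e(2)] ..
    also have "\<dots> = bivector_map B A B' A' \<phi> p (\<Lambda> p) e k l"
      using bivector_map_chart[OF B(1) A \<phi> sp c e kl] by simp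
    finally show ?thesis ..
  next
    case False
    then show ?thesis
      using bivector_spaceD(1)[OF sp' False] by (simp only: bivector_map_def if_False)
  qed
qed

lemma poisson_map_compose:
  fixes A :: "('a, 'e::real_inner) atlas" and A' :: "('b, 'f::real_inner) atlas"
    and A'' :: "('c, 'g::real_inner) atlas"
  assumes B: "coordinate_basis (B :: 'e set)" "coordinate_basis (B' :: 'f set)"
      "coordinate_basis (B'' :: 'g set)"
    and A: "smooth_atlas A" "smooth_atlas A'" "smooth_atlas A''"
    and w: "\<And>p. p \<in> points A \<Longrightarrow> \<Lambda> p \<in> bivector_space B A p"
      "\<And>p. p \<in> points A' \<Longrightarrow> \<Lambda>' p \<in> bivector_space B' A' p"
      "\<And>p. p \<in> points A'' \<Longrightarrow> \<Lambda>'' p \<in> bivector_space B'' A'' p"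
    and \<phi>: "poisson_map B A \<Lambda> B' A' \<Lambda>' \<phi>" and \<psi>: "poisson_map B' A' \<Lambda>' B'' A'' \<Lambda>'' \<psi>"
  shows "poisson_map B A \<Lambda> B'' A'' \<Lambda>'' (\<psi> \<circ> \<phi>)"
proof -
  have sm: "smooth_map A A' \<phi>" "smooth_map A' A'' \<psi>"
    using \<phi> \<psi> by (auto simp: poisson_map_def)
  show ?thesis
  proof (rule poisson_mapI[OF B(1,3) A(1,3) smooth_map_compose[OF B A sm] w(1,3)])
    fix p assume p: "p \<in> points A"
    note p' = smooth_map_in_points[OF sm(1) A(1,2) p]
    obtain c d where cd: "c \<in> A" "d \<in> A'" "p \<in> fst c" "\<phi> p \<in> fst d"
      using smooth_map_local_chart[OF A(1,2) sm(1) p] .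
    obtain e where e: "e \<in> A''" "\<psi> (\<phi> p) \<in> fst e"
      using pointsE[OF smooth_map_in_points[OF sm(2) A(2,3) p']] .
    have "\<Lambda>'' (\<psi> (\<phi> p)) e k l = push_bivector B (local_differential (\<lambda>x. \<psi> (\<phi> x)) p c e) (\<Lambda> p c) k l"
      if kl: "k \<in> B''" "l \<in> B''" for k l
    proof -
      have "\<Lambda>'' (\<psi> (\<phi> p)) e k l = push_bivector B' (local_differential \<psi> (\<phi> p) d e) (\<Lambda>' (\<phi> p) d) k l"
        using poisson_mapD[OF B(2) A(2,3) \<psi> w(2)[OF p'] cd(2,4) e kl] .
      also have "\<dots> = push_bivector B' (local_differential \<psi> (\<phi> p) d e) (push_bivector B (local_differential \<phi> p c d) (\<Lambda> p c)) k l"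
        by (rule push_bivector_cong) (rule poisson_mapD[OF B(1) A(1,2) \<phi> w(1)[OF p] cd(1,3,2,4)])
      also have "\<dots> = push_bivector B (local_differential (\<lambda>x. \<psi> (\<phi> x)) p c e) (\<Lambda> p c) k l"
        unfolding local_differential_compose[OF A sm cd(1,3,2,4) e] o_def
        by (rule push_bivector_compose[OF B(2) linear_local_differential[OF A(2) sm(2) cd(2) e(1) cd(4) e(2)]])
      finally show ?thesis .
    qed
    then show "\<exists>c\<in>A. \<exists>d\<in>A''. p \<in> fst c \<and> (\<psi> \<circ> \<phi>) p \<in> fst d \<and> (\<forall>k\<in>B''. \<forall>l\<in>B''.
        \<Lambda>'' ((\<psi> \<circ> \<phi>) p) d k l = push_bivector B (local_differential (\<psi> \<circ> \<phi>) p c d) (\<Lambda> p c) k l)"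
      using cd e by (intro bexI[of _ c] bexI[of _ e]) (auto simp: o_def)
  qed
qed

section \<open>The tangent lift of a Poisson structure\<close>

text \<open>Undoes the \<open>inv_into\<close> in the definition of \<open>tangent_lift\<close>.
  Equality of charts includes the values of the coordinate function off its domain, hence the
  evaluation at an arbitrary vector over every \<open>p\<close>.\<close>

lemma inj_on_tangent_chart_atlas:
  assumes A: "smooth_atlas A"
  shows "inj_on (tangent_chart A) A"
proof (rule inj_onI)
  fix c d assume c: "c \<in> A" and d: "d \<in> A" and eq: "tangent_chart A c = tangent_chart A d"
  have "snd c p = snd d p" for p
    using arg_cong[OF eq, of "\<lambda>C. fst (snd C (p, undefined))"] by (simp add: snd_tangent_chart)
  moreover have "fst c \<subseteq> fst d" if c: "c \<in> A" and eq: "tangent_chart A c = tangent_chart A d" for c d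
  proof
    fix p assume p: "p \<in> fst c"
    \<comment> \<open>The zero vector witnesses that the fibre over \<open>p\<close> is not
      empty.\<close>
    have "(p, tangent_vec A p c 0) \<in> fst (tangent_chart A c)"
      using tangent_vec_in[OF A c p] p by (simp add: mem_tangent_chart)
    then show "p \<in> fst d"
      unfolding eq by (simp add: mem_tangent_chart)
  qed
  ultimately show "c = d"
    using c d eq by (intro prod_eqI ext subset_antisym) metis+
qed

lemma tangent_lift_chart:
  assumes B: "coordinate_basis B" and A: "smooth_atlas A" and \<Lambda>: "bivector_field B A \<Lambda>"
    and c: "c \<in> A" and z: "z \<in> fst (tangent_chart A c)"
    and I: "I \<in> insert 0 (prod_basis B B)" and J: "J \<in> insert 0 (prod_basis B B)"
  shows "tangent_lift B A \<Lambda> z (tangent_chart A c) I J = lift_comp (components c \<Lambda>) (snd (tangent_chart A c) z) I J"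
proof -
  note lb = local_bivector_components[OF A \<Lambda> c]
  have x: "fst (snd (tangent_chart A c) z) \<in> snd c ` fst c"
    using z by (simp add: snd_tangent_chart mem_tangent_chart)
  show ?thesis
  proof (cases "I \<in> prod_basis B B \<and> J \<in> prod_basis B B")
    case True
    then show ?thesis
      using c z local_tangent_lift_eq[OF B lb x]
      by (simp add: tangent_lift_def tangent_chart_in inv_into_f_f[OF inj_on_tangent_chart_atlas[OF A]])
  next
    case False
    then have "I = 0 \<or> J = 0"
      using I J by blast
    then have "lift_comp (components c \<Lambda>) (snd (tangent_chart A c) z) I J = 0"
      using lift_comp_zero[OF B lb x] by blast
    then show ?thesis
      using False by (auto simp: tangent_lift_def)
  qed
qed

lemma tangent_lift_outside:
  "\<not> (C \<in> tangent_atlas A \<and> z \<in> fst C \<and> I \<in> prod_basis B B \<and> J \<in> prod_basis B B) \<Longrightarrow> tangent_lift B A \<Lambda> z C I J = 0"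
  unfolding tangent_lift_def by (rule if_not_P)

lemma lift_comp_poisson_map:
  fixes A :: "('a, 'e::real_inner) atlas" and A' :: "('b, 'f::real_inner) atlas"
  assumes B: "coordinate_basis (B :: 'e set)" "coordinate_basis (B' :: 'f set)"
    and A: "smooth_atlas A" "smooth_atlas A'"
    and \<Lambda>: "bivector_field B A \<Lambda>" and \<Lambda>': "bivector_field B' A' \<Lambda>'"
    and \<phi>: "poisson_map B A \<Lambda> B' A' \<Lambda>' \<phi>"
    and c: "c \<in> A" and d: "d \<in> A'" and x: "x \<in> snd c ` (fst c \<inter> \<phi> -` fst d)"
    and K: "K \<in> prod_basis B' B'" and L: "L \<in> prod_basis B' B'"
  defines "f \<equiv> snd d \<circ> \<phi> \<circ> chart_inv c"
  shows "lift_comp (components d \<Lambda>') (tangent_fun f (x, \<xi>)) K L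
    = push_bivector (prod_basis B B) (frechet_derivative (tangent_fun f) (at (x, \<xi>)))
        (lift_comp (components c \<Lambda>) (x, \<xi>)) K L"
proof -
  have sm: "smooth_map A A' \<phi>"
    using \<phi> by (simp add: poisson_map_def)
  let ?S = "snd c ` (fst c \<inter> \<phi> -` fst d)"
  have P: "local_bivector B ?S (components c \<Lambda>)"
    using local_bivector_components[OF A(1) \<Lambda> c] smooth_map_open[OF A sm c d]
    unfolding local_bivector_def by (blast intro: smooth_on_subset)
  show ?thesis
  proof (rule push_bivector_lift_comp[OF B P local_bivector_components[OF A(2) \<Lambda>' d] _ _ _ _ K L])
    show "smooth_on ?S f"
      unfolding f_def using smooth_map_smooth_on[OF sm c d] .
    show "f ` ?S \<subseteq> snd d ` fst d"
      using chart_inv_left[OF A(1) c] by (auto simp: f_def)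
    show "fst (x, \<xi>) \<in> ?S"
      using x by simp
    fix y k l assume "y \<in> ?S" and kl: "k \<in> B'" "l \<in> B'"
    then obtain p where p: "p \<in> fst c" "\<phi> p \<in> fst d" "y = snd c p"
      by auto
    have "\<Lambda>' (\<phi> p) d k l = push_bivector B (local_differential \<phi> p c d) (\<Lambda> p c) k l"
      using poisson_mapD[OF B(1) A \<phi> bivector_fieldD(1)[OF \<Lambda> in_points[OF c p(1)]] c p(1) d p(2) kl] .
    then show "components d \<Lambda>' k l (f y) = push_bivector B (frechet_derivative f (at y)) (\<lambda>i j. components c \<Lambda> i j y) k l"
      using p chart_inv_left[OF A(1) c p(1)] chart_inv_left[OF A(2) d p(2)]
      by (simp add: components_def f_def local_differential_def)
  qed
qed

text \<open>Used for \<open>\<Phi> = T\<phi>\<close>, and for \<open>\<phi> = id\<close> with \<open>\<Phi> = id\<close>, where it is the transformation law of \<open>d\<^sub>T\<Lambda>\<close>.\<close>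

lemma tangent_lift_poisson_map:
  fixes A :: "('a, 'e::real_inner) atlas" and A' :: "('b, 'f::real_inner) atlas"
  assumes B: "coordinate_basis (B :: 'e set)" "coordinate_basis (B' :: 'f set)"
    and A: "smooth_atlas A" "smooth_atlas A'"
    and \<Lambda>: "bivector_field B A \<Lambda>" and \<Lambda>': "bivector_field B' A' \<Lambda>'"
    and \<phi>: "poisson_map B A \<Lambda> B' A' \<Lambda>' \<phi>"
    and c: "c \<in> A" and d: "d \<in> A'"
    and z: "z \<in> fst (tangent_chart A c)" "\<phi> (fst z) \<in> fst d" "\<Phi> z \<in> fst (tangent_chart A' d)"
    and \<Phi>: "\<And>x \<xi>. x \<in> snd c ` (fst c \<inter> \<phi> -` fst d) \<Longrightarrow>
      snd (tangent_chart A' d) (\<Phi> (chart_inv (tangent_chart A c) (x, \<xi>))) = tangent_fun (snd d \<circ> \<phi> \<circ> chart_inv c) (x, \<xi>)"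
    and K: "K \<in> prod_basis B' B'" and L: "L \<in> prod_basis B' B'"
  shows "tangent_lift B' A' \<Lambda>' (\<Phi> z) (tangent_chart A' d) K L
    = push_bivector (prod_basis B B) (local_differential \<Phi> z (tangent_chart A c) (tangent_chart A' d))
        (tangent_lift B A \<Lambda> z (tangent_chart A c)) K L"
proof -
  let ?C = "tangent_chart A c" and ?D = "tangent_chart A' d" and ?x = "snd (tangent_chart A c) z"
  let ?f = "snd d \<circ> \<phi> \<circ> chart_inv c" and ?S = "snd c ` (fst c \<inter> \<phi> -` fst d)"
  have sm: "smooth_map A A' \<phi>"
    using \<phi> by (simp add: poisson_map_def)
  have x: "fst ?x \<in> ?S"
    using z by (simp add: snd_tangent_chart mem_tangent_chart)
  have inv: "chart_inv ?C ?x = z"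
    using chart_inv_left[OF smooth_atlas_tangent[OF B(1) A(1)] tangent_chart_in[OF c] z(1)] .
  \<comment> \<open>In the induced charts \<open>\<Phi>\<close> coincides with
    \<open>tangent_fun ?f\<close> on a whole neighbourhood, so their derivatives agree.\<close>
  have ld: "local_differential \<Phi> z ?C ?D = frechet_derivative (tangent_fun ?f) (at ?x)"
  proof (rule local_differential_eqI)
    have S: "open ?S"
      using smooth_map_open[OF A sm c d] .
    then show "open (?S \<times> (UNIV :: 'e set))"
      by (simp add: open_Times)
    show "?x \<in> ?S \<times> UNIV"
      using x by (simp add: mem_Times_iff)
    then show "(tangent_fun ?f has_derivative frechet_derivative (tangent_fun ?f) (at ?x)) (at ?x)"
      by (rule smooth_on_has_derivative[OF smooth_on_tangent_fun[OF B(1) S smooth_map_smooth_on[OF sm c d]]])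
    fix y assume "y \<in> ?S \<times> (UNIV :: 'e set)"
    then show "tangent_fun ?f y = snd ?D (\<Phi> (chart_inv ?C y))"
      using \<Phi>[of "fst y" "snd y"] by (simp add: mem_Times_iff)
  qed
  have "tangent_lift B' A' \<Lambda>' (\<Phi> z) ?D K L = lift_comp (components d \<Lambda>') (snd ?D (\<Phi> z)) K L"
    using K L by (simp add: tangent_lift_chart[OF B(2) A(2) \<Lambda>' d z(3)])
  also have "snd ?D (\<Phi> z) = tangent_fun ?f ?x"
    using \<Phi>[OF x, of "snd ?x"] inv by simp
  also have "lift_comp (components d \<Lambda>') (tangent_fun ?f ?x) K L
      = push_bivector (prod_basis B B) (local_differential \<Phi> z ?C ?D) (lift_comp (components c \<Lambda>) ?x) K L"
    using lift_comp_poisson_map[OF B A \<Lambda> \<Lambda>' \<phi> c d x K L, of "snd ?x"] ld by simp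
  also have "\<dots> = push_bivector (prod_basis B B) (local_differential \<Phi> z ?C ?D) (tangent_lift B A \<Lambda> z ?C) K L"
    by (rule push_bivector_cong) (simp add: tangent_lift_chart[OF B(1) A(1) \<Lambda> c z(1)])
  finally show ?thesis .
qed

text \<open>Rephrases the transformation law of a bivector so that the lifting lemma for Poisson
  maps applies to it as well.\<close>

lemma poisson_map_id:
  assumes "coordinate_basis B" "smooth_atlas A" "\<And>p. p \<in> points A \<Longrightarrow> \<Lambda> p \<in> bivector_space B A p"
  shows "poisson_map B A \<Lambda> B A \<Lambda> (\<lambda>x. x)"
proof (rule poisson_mapI[OF assms(1,1,2,2) smooth_map_id[OF assms(2)] assms(3,3)])
  fix p assume p: "p \<in> points A"
  obtain c where c: "c \<in> A" "p \<in> fst c"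
    using pointsE[OF p] .
  show "\<exists>c\<in>A. \<exists>d\<in>A. p \<in> fst c \<and> p \<in> fst d \<and> (\<forall>k\<in>B. \<forall>l\<in>B.
      \<Lambda> p d k l = push_bivector B (local_differential (\<lambda>x. x) p c d) (\<Lambda> p c) k l)"
    unfolding local_differential_id
    using c bivector_spaceD(3)[OF assms(3)[OF p] c(1,1) c(2,2)]
    by (intro bexI[of _ c] conjI ballI)
qed

lemma bivector_field_tangent_lift:
  fixes A :: "('a, 'e::real_inner) atlas"
  assumes B: "coordinate_basis (B :: 'e set)" and A: "smooth_atlas A" and \<Lambda>: "bivector_field B A \<Lambda>"
  shows "bivector_field (prod_basis B B) (tangent_atlas A) (tangent_lift B A \<Lambda>)"
  unfolding bivector_field_def
proof (intro conjI ballI)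
  let ?T = "tangent_lift B A \<Lambda>" and ?B = "prod_basis B B"
  fix z assume "z \<in> points (tangent_atlas A)"
  show "?T z \<in> bivector_space ?B (tangent_atlas A) z"
    unfolding bivector_space_def mem_Collect_eq
  proof (intro conjI allI ballI impI)
    fix C I J assume "\<not> (C \<in> tangent_atlas A \<and> z \<in> fst C \<and> I \<in> ?B \<and> J \<in> ?B)"
    then show "?T z C I J = 0"
      by (rule tangent_lift_outside)
  next
    fix C I J
    show "?T z C I J = - ?T z C J I"
    proof (cases "C \<in> tangent_atlas A \<and> z \<in> fst C \<and> I \<in> ?B \<and> J \<in> ?B")
      case True
      then obtain c where c: "c \<in> A" "C = tangent_chart A c"
        using tangent_atlasE by blast
      with True have z: "z \<in> fst (tangent_chart A c)" and IJ: "I \<in> insert 0 ?B" "J \<in> insert 0 ?B"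
        by auto
      have "fst (snd (tangent_chart A c) z) \<in> snd c ` fst c"
        using z by (simp add: snd_tangent_chart mem_tangent_chart)
      from lift_comp_antisym[OF local_bivector_components[OF A \<Lambda> c(1)] this]
      show ?thesis
        unfolding c(2) tangent_lift_chart[OF B A \<Lambda> c(1) z IJ] tangent_lift_chart[OF B A \<Lambda> c(1) z IJ(2,1)] .
    next
      case False
      then have "?T z C I J = 0" "?T z C J I = 0"
        by (auto intro!: tangent_lift_outside)
      then show ?thesis
        by simp
    qed
  next
    fix C D K L assume "C \<in> tangent_atlas A" "D \<in> tangent_atlas A" and zC: "z \<in> fst C" and zD: "z \<in> fst D"
      and KL: "K \<in> ?B" "L \<in> ?B"
    then obtain c d where c: "c \<in> A" "C = tangent_chart A c" and d: "d \<in> A" "D = tangent_chart A d"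
      using tangent_atlasE by metis
    have zc: "z \<in> fst (tangent_chart A c)" and zd: "z \<in> fst (tangent_chart A d)"
      using zC zD c d by auto
    have id: "poisson_map B A \<Lambda> B A \<Lambda> (\<lambda>x. x)"
      by (rule poisson_map_id[OF B A bivector_fieldD(1)[OF \<Lambda>]])
    show "?T z D K L = push_bivector ?B (jac C D z) (?T z C) K L"
      using tangent_lift_poisson_map[where \<Phi> = "\<lambda>x. x", OF B B A A \<Lambda> \<Lambda> id c(1) d(1) zc _ zd _ KL]
        zd tangent_chart_transition[OF A c(1) d(1)]
      unfolding c(2) d(2) local_differential_id by (simp add: mem_tangent_chart vimage_def comp_def)
  qed
next
  let ?T = "tangent_lift B A \<Lambda>" and ?B = "prod_basis B B"
  fix C I J assume "C \<in> tangent_atlas A" and IJ: "I \<in> ?B" "J \<in> ?B"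
  then obtain c where c: "c \<in> A" "C = tangent_chart A c"
    using tangent_atlasE by metis
  have im: "snd C ` fst C = snd c ` fst c \<times> UNIV"
    using tangent_chart_image_Int[OF A c(1), of c] by (simp add: c(2))
  note o = smooth_atlas_open[OF smooth_atlas_tangent[OF B A] tangent_chart_in[OF c(1)], folded c(2)]
  have "smooth_on (snd C ` fst C) (\<lambda>z. lift_comp (components c \<Lambda>) z I J)"
    unfolding im by (rule smooth_on_lift_comp[OF B local_bivector_components[OF A \<Lambda> c(1)]])
  then show "smooth_on (snd C ` fst C) (components C ?T I J)"
  proof (rule smooth_on_cong[OF o])
    fix x assume x: "x \<in> snd C ` fst C"
    have "chart_inv C x \<in> fst (tangent_chart A c)"
      using chart_inv_in[OF x] by (simp add: c(2))
    from tangent_lift_chart[OF B A \<Lambda> c(1) this]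
    show "lift_comp (components c \<Lambda>) x I J = components C ?T I J x"
      using IJ chart_inv_right[OF x] by (simp add: components_def c(2))
  qed
qed

text \<open>The bracket contains first derivatives, so the components have to agree on a
  neighbourhood.\<close>

lemma schouten_cong_open:
  assumes W: "open W" "x \<in> W" and eq: "\<And>i j y. i \<in> B \<Longrightarrow> j \<in> B \<Longrightarrow> y \<in> W \<Longrightarrow> P i j y = Q i j y"
    and d: "\<And>i j. i \<in> B \<Longrightarrow> j \<in> B \<Longrightarrow> P i j differentiable (at x)"
    and ijk: "i \<in> B" "j \<in> B" "k \<in> B"
  shows "schouten B P P i j k x = schouten B Q Q i j k x"
proof -
  have "partial l (P i j) x = partial l (Q i j) x" if "i \<in> B" "j \<in> B" for i j l
    using partial_cong_open[OF W eq[OF that] d[OF that]] .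
  then show ?thesis
    unfolding schouten_def using ijk eq[OF _ _ W(2)] by (intro sum.cong refl) simp
qed

lemma poisson_manifold_tangent_lift:
  fixes A :: "('a, 'e::real_inner) atlas"
  assumes "poisson_manifold B A \<Lambda>"
  shows "poisson_manifold (prod_basis B B) (tangent_atlas A) (tangent_lift B A \<Lambda>)"
proof -
  have M: "smooth_manifold B A" and \<Lambda>: "bivector_field B A \<Lambda>"
    and sch: "\<And>c x i j k. c \<in> A \<Longrightarrow> x \<in> snd c ` fst c \<Longrightarrow> i \<in> B \<Longrightarrow> j \<in> B \<Longrightarrow> k \<in> B \<Longrightarrow>
      schouten B (components c \<Lambda>) (components c \<Lambda>) i j k x = 0"
    using assms unfolding poisson_manifold_def by blast+
  have B: "coordinate_basis B" and A: "smooth_atlas A"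
    using M by (auto simp: smooth_manifold_def)
  let ?T = "tangent_lift B A \<Lambda>" and ?B = "prod_basis B B"
  have "schouten ?B (components C ?T) (components C ?T) I J K x = 0"
    if C: "C \<in> tangent_atlas A" and x: "x \<in> snd C ` fst C" and IJK: "I \<in> ?B" "J \<in> ?B" "K \<in> ?B" for C x I J K
  proof -
    obtain c where c: "c \<in> A" "C = tangent_chart A c"
      using C tangent_atlasE by metis
    have im: "snd C ` fst C = snd c ` fst c \<times> UNIV"
      using tangent_chart_image_Int[OF A c(1), of c] by (simp add: c(2))
    note lb = local_bivector_components[OF A \<Lambda> c(1)]
    let ?W = "\<lambda>I J z. lift_comp (components c \<Lambda>) z I J"
    have "schouten ?B ?W ?W I J K x = schouten ?B (components C ?T) (components C ?T) I J K x"
    proof (rule schouten_cong_open[OF _ x _ _ IJK])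
      show "open (snd C ` fst C)"
        using smooth_atlas_open[OF smooth_atlas_tangent[OF B A] C] .
      show "?W I J differentiable (at x)" for I J
        using smooth_on_differentiable[OF smooth_on_lift_comp[OF B lb]] x unfolding im by blast
      fix I J y assume "I \<in> ?B" "J \<in> ?B" and y: "y \<in> snd C ` fst C"
      moreover have "chart_inv C y \<in> fst (tangent_chart A c)"
        using chart_inv_in[OF y] by (simp add: c(2))
      ultimately show "?W I J y = components C ?T I J y"
        using tangent_lift_chart[OF B A \<Lambda> c(1), of "chart_inv C y" I J] chart_inv_right[OF y]
        by (simp add: components_def c(2))
    qed
    moreover have "schouten ?B ?W ?W I J K x = 0"
      using x im by (intro schouten_lift_comp[OF B lb sch[OF c(1)] _ IJK]) auto
    ultimately show ?thesis
      by simp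
  qed
  then show ?thesis
    unfolding poisson_manifold_def
    by (intro conjI ballI smooth_manifold_tangent[OF M] bivector_field_tangent_lift[OF B A \<Lambda>])
qed

lemma poisson_map_tangent:
  fixes A :: "('a, 'e::real_inner) atlas" and A' :: "('b, 'f::real_inner) atlas"
  assumes B: "coordinate_basis (B :: 'e set)" "coordinate_basis (B' :: 'f set)"
    and A: "smooth_atlas A" "smooth_atlas A'"
    and \<Lambda>: "bivector_field B A \<Lambda>" and \<Lambda>': "bivector_field B' A' \<Lambda>'"
    and \<phi>: "poisson_map B A \<Lambda> B' A' \<Lambda>' \<phi>"
  shows "poisson_map (prod_basis B B) (tangent_atlas A) (tangent_lift B A \<Lambda>)
    (prod_basis B' B') (tangent_atlas A') (tangent_lift B' A' \<Lambda>') (tangent_map A A' \<phi>)"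
proof -
  have sm: "smooth_map A A' \<phi>"
    using \<phi> by (simp add: poisson_map_def)
  note TA = smooth_atlas_tangent[OF B(1) A(1)] smooth_atlas_tangent[OF B(2) A(2)]
  let ?B = "prod_basis B B" and ?B' = "prod_basis B' B'"
  let ?T = "tangent_lift B A \<Lambda>" and ?T' = "tangent_lift B' A' \<Lambda>'" and ?\<phi> = "tangent_map A A' \<phi>"
  show ?thesis
  proof (rule poisson_mapI[OF coordinate_basis_prod_basis[OF B(1,1)] coordinate_basis_prod_basis[OF B(2,2)] TA
        smooth_map_tangent[OF B A sm] bivector_fieldD(1)[OF bivector_field_tangent_lift[OF B(1) A(1) \<Lambda>]]
        bivector_fieldD(1)[OF bivector_field_tangent_lift[OF B(2) A(2) \<Lambda>']]])
    fix z assume "z \<in> points (tangent_atlas A)"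
    then have zT: "z \<in> tangent_bundle A"
      by (simp add: points_tangent_atlas)
    then have z: "fst z \<in> points A" "snd z \<in> tangent_space A (fst z)"
      by (auto simp: mem_tangent_bundle)
    obtain c d where cd: "c \<in> A" "d \<in> A'" "fst z \<in> fst c" "\<phi> (fst z) \<in> fst d"
      using smooth_map_local_chart[OF A sm z(1)] .
    let ?C = "tangent_chart A c" and ?D = "tangent_chart A' d"
    have zC: "z \<in> fst ?C"
      using cd z by (simp add: mem_tangent_chart)
    have zD: "?\<phi> z \<in> fst ?D"
      using tangent_map_in[OF A sm zT] cd by (simp add: mem_tangent_chart mem_tangent_bundle)
    show "\<exists>C\<in>tangent_atlas A. \<exists>D\<in>tangent_atlas A'. z \<in> fst C \<and> ?\<phi> z \<in> fst D \<and> (\<forall>K\<in>?B'. \<forall>L\<in>?B'.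
        ?T' (?\<phi> z) D K L = push_bivector ?B (local_differential ?\<phi> z C D) (?T z C) K L)"
      using tangent_lift_poisson_map[OF B A \<Lambda> \<Lambda>' \<phi> cd(1,2) zC cd(4) zD tangent_map_chart[OF A sm cd(1,2)]]
        tangent_chart_in[OF cd(1)] tangent_chart_in[OF cd(2)] zC zD
      by (intro bexI[of _ ?C] bexI[of _ ?D]) simp_all
  qed
qed

section \<open>Product Poisson structures\<close>

text \<open>The product bivector is a sum of images under the inclusions of the factors; smoothness
  of these gives access to \<open>bivector_map_chart\<close>.\<close>

lemma smooth_map_Pair_right:
  fixes A :: "('a, 'e::real_inner) atlas" and A' :: "('b, 'f::real_inner) atlas"
  assumes B: "coordinate_basis (B :: 'e set)" "coordinate_basis (B' :: 'f set)"
    and A: "smooth_atlas A" "smooth_atlas A'" and q: "q \<in> points A'"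
  shows "smooth_map A (prod_atlas A A') (\<lambda>x. (x, q))"
proof (rule smooth_map_chartI[OF B(1) coordinate_basis_prod_basis[OF B] A(1) smooth_atlas_prod[OF B A]])
  fix p assume "p \<in> points A"
  then obtain c d where cd: "c \<in> A" "p \<in> fst c" "d \<in> A'" "q \<in> fst d"
    using pointsE q by metis
  have "smooth_on (snd c ` fst c) (\<lambda>x. (x, snd d q))"
    by (intro smooth_on_Pair smooth_atlas_open[OF A(1) cd(1)] smooth_on_const smooth_on_bounded_linear bounded_linear_ident)
  then show "\<exists>c\<in>A. \<exists>C\<in>prod_atlas A A'. \<exists>f. p \<in> fst c \<and> (\<lambda>x. (x, q)) ` fst c \<subseteq> fst C \<and>
      smooth_on (snd c ` fst c) f \<and> (\<forall>w\<in>fst c. f (snd c w) = snd C ((\<lambda>x. (x, q)) w))"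
    using cd prod_chart_in[OF cd(1,3)]
    by (intro bexI[of _ c] bexI[of _ "prod_chart c d"] exI[of _ "\<lambda>x. (x, snd d q)"]) auto
qed

lemma smooth_map_Pair_left:
  fixes A :: "('a, 'e::real_inner) atlas" and A' :: "('b, 'f::real_inner) atlas"
  assumes B: "coordinate_basis (B :: 'e set)" "coordinate_basis (B' :: 'f set)"
    and A: "smooth_atlas A" "smooth_atlas A'" and p: "p \<in> points A"
  shows "smooth_map A' (prod_atlas A A') (\<lambda>y. (p, y))"
proof (rule smooth_map_chartI[OF B(2) coordinate_basis_prod_basis[OF B] A(2) smooth_atlas_prod[OF B A]])
  fix q assume "q \<in> points A'"
  then obtain c d where cd: "c \<in> A" "p \<in> fst c" "d \<in> A'" "q \<in> fst d"
    using pointsE p by metis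
  have "smooth_on (snd d ` fst d) (\<lambda>y. (snd c p, y))"
    by (intro smooth_on_Pair smooth_atlas_open[OF A(2) cd(3)] smooth_on_const smooth_on_bounded_linear bounded_linear_ident)
  then show "\<exists>d\<in>A'. \<exists>C\<in>prod_atlas A A'. \<exists>f. q \<in> fst d \<and> (\<lambda>y. (p, y)) ` fst d \<subseteq> fst C \<and>
      smooth_on (snd d ` fst d) f \<and> (\<forall>w\<in>fst d. f (snd d w) = snd C ((\<lambda>y. (p, y)) w))"
    using cd prod_chart_in[OF cd(1,3)]
    by (intro bexI[of _ d] bexI[of _ "prod_chart c d"] exI[of _ "\<lambda>y. (snd c p, y)"]) auto
qed

lemma bivector_space_zero:
  assumes "coordinate_basis B" "w \<in> bivector_space B A p"
  shows "w c 0 j = 0" "w c i 0 = 0"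
  using bivector_spaceD(1)[OF assms(2), of c] zero_notin_coordinate_basis[OF assms(1)] by blast+

text \<open>The component matrix is block diagonal: a basis vector of the product has one zero
  entry, so two basis vectors of the same factor leave one summand and mixed ones leave
  none.\<close>

lemma prod_bivector_chart:
  fixes A :: "('a, 'e::real_inner) atlas" and A' :: "('b, 'f::real_inner) atlas"
  assumes B: "coordinate_basis (B :: 'e set)" "coordinate_basis (B' :: 'f set)"
    and A: "smooth_atlas A" "smooth_atlas A'"
    and w: "\<Lambda> p \<in> bivector_space B A p" and w': "\<Lambda>' q \<in> bivector_space B' A' q"
    and c: "c \<in> A" "p \<in> fst c" and d: "d \<in> A'" "q \<in> fst d"
    and I: "I \<in> insert 0 (prod_basis B B')" and J: "J \<in> insert 0 (prod_basis B B')"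
  shows "prod_bivector B A \<Lambda> B' A' \<Lambda>' (p, q) (prod_chart c d) I J
    = \<Lambda> p c (fst I) (fst J) + \<Lambda>' q d (snd I) (snd J)"
proof (cases "I \<in> prod_basis B B' \<and> J \<in> prod_basis B B'")
  case True
  let ?P = "prod_atlas A A'" and ?B = "prod_basis B B'"
  note P = smooth_atlas_prod[OF B A]
  have ld: "local_differential (\<lambda>x. (x, q)) p c (prod_chart c d) = (\<lambda>v. (v, 0))"
    by (rule local_differential_eqI[of "\<lambda>x. (x, snd d q)" _ _ _ "snd c ` fst c"])
       (use c in \<open>auto intro!: has_derivative_Pair has_derivative_ident has_derivative_const smooth_atlas_open[OF A(1)]
          simp: chart_inv_left[OF A(1)]\<close>)
  have ld': "local_differential (\<lambda>y. (p, y)) q d (prod_chart c d) = (\<lambda>v. (0, v))"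
    by (rule local_differential_eqI[of "\<lambda>y. (snd c p, y)" _ _ _ "snd d ` fst d"])
       (use d in \<open>auto intro!: has_derivative_Pair has_derivative_ident has_derivative_const smooth_atlas_open[OF A(2)]
          simp: chart_inv_left[OF A(2)]\<close>)
  have 1: "bivector_map B A ?B ?P (\<lambda>x. (x, q)) p (\<Lambda> p) (prod_chart c d) I J = \<Lambda> p c (fst I) (fst J)"
  proof -
    have "bivector_map B A ?B ?P (\<lambda>x. (x, q)) p (\<Lambda> p) (prod_chart c d) I J
        = push_bivector B (\<lambda>v. (v, 0)) (\<Lambda> p c) I J"
      unfolding ld[symmetric] using c d True
      by (intro bivector_map_chart[OF B(1) A(1) P smooth_map_Pair_right[OF B A in_points[OF d]] w c prod_chart_in[OF c(1) d(1)]]) auto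
    also have "\<dots> = \<Lambda> p c (fst I) (fst J)"
      unfolding push_bivector_def inner_prod_def
      using coordinate_sum_inner2[OF B(1) prod_basis_fst_snd(1)[OF I] prod_basis_fst_snd(1)[OF J], of "\<Lambda> p c"]
        bivector_spaceD(1)[OF w, of c] by simp
    finally show ?thesis .
  qed
  have 2: "bivector_map B' A' ?B ?P (\<lambda>y. (p, y)) q (\<Lambda>' q) (prod_chart c d) I J = \<Lambda>' q d (snd I) (snd J)"
  proof -
    have "bivector_map B' A' ?B ?P (\<lambda>y. (p, y)) q (\<Lambda>' q) (prod_chart c d) I J
        = push_bivector B' (\<lambda>v. (0, v)) (\<Lambda>' q d) I J"
      unfolding ld'[symmetric] using c d True
      by (intro bivector_map_chart[OF B(2) A(2) P smooth_map_Pair_left[OF B A in_points[OF c]] w' d prod_chart_in[OF c(1) d(1)]]) auto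
    also have "\<dots> = \<Lambda>' q d (snd I) (snd J)"
      unfolding push_bivector_def inner_prod_def
      using coordinate_sum_inner2[OF B(2) prod_basis_fst_snd(2)[OF I] prod_basis_fst_snd(2)[OF J], of "\<Lambda>' q d"]
        bivector_spaceD(1)[OF w', of d] by simp
    finally show ?thesis .
  qed
  show ?thesis
    by (simp add: prod_bivector_def 1 2)
next
  case False
  then have "I = 0 \<or> J = 0"
    using I J by blast
  then have "\<Lambda> p c (fst I) (fst J) = 0" "\<Lambda>' q d (snd I) (snd J) = 0"
    using bivector_space_zero[OF B(1) w, of c] bivector_space_zero[OF B(2) w', of d] by (elim disjE; simp)+
  moreover have "prod_bivector B A \<Lambda> B' A' \<Lambda>' (p, q) (prod_chart c d) I J = 0"
    using False by (auto simp: prod_bivector_def bivector_map_def)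
  ultimately show ?thesis
    by simp
qed

text \<open>The cross terms vanish, since \<open>(i, 0)\<close> and \<open>(0, j)\<close> share no
  nonzero entry and the components are zero at the index \<open>0\<close>.\<close>

lemma push_bivector_prod:
  assumes B: "coordinate_basis B" "coordinate_basis B'" and T: "T 0 = 0" "T' 0 = 0"
    and w: "\<And>i. w i 0 = 0" "\<And>i. w 0 i = 0" "\<And>i. w' i 0 = 0" "\<And>i. w' 0 i = 0"
  shows "push_bivector (prod_basis B B') (\<lambda>z. (T (fst z), T' (snd z)))
      (\<lambda>I J. w (fst I) (fst J) + w' (snd I) (snd J)) K L
    = push_bivector B T w (fst K) (fst L) + push_bivector B' T' w' (snd K) (snd L)"
  by (simp add: push_bivector_def sum_prod_basis[OF B] T w inner_prod_def)

lemma bivector_field_prod: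
  fixes A :: "('a, 'e::real_inner) atlas" and A' :: "('b, 'f::real_inner) atlas"
  assumes B: "coordinate_basis (B :: 'e set)" "coordinate_basis (B' :: 'f set)"
    and A: "smooth_atlas A" "smooth_atlas A'"
    and \<Lambda>: "bivector_field B A \<Lambda>" and \<Lambda>': "bivector_field B' A' \<Lambda>'"
  shows "bivector_field (prod_basis B B') (prod_atlas A A') (prod_bivector B A \<Lambda> B' A' \<Lambda>')"
  unfolding bivector_field_def
proof (intro conjI ballI)
  let ?\<Theta> = "prod_bivector B A \<Lambda> B' A' \<Lambda>'" and ?B = "prod_basis B B'" and ?P = "prod_atlas A A'"
  fix z assume "z \<in> points ?P"
  then obtain p q where z: "z = (p, q)" and p: "p \<in> points A" and q: "q \<in> points A'"
    by (auto simp: points_prod_atlas)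
  note w = bivector_fieldD(1)[OF \<Lambda> p] and w' = bivector_fieldD(1)[OF \<Lambda>' q]
  note chart = prod_bivector_chart[OF B A, where \<Lambda> = \<Lambda> and \<Lambda>' = \<Lambda>', OF w w']
  have zero: "?\<Theta> z C I J = 0" if "\<not> (C \<in> ?P \<and> z \<in> fst C \<and> I \<in> ?B \<and> J \<in> ?B)" for C I J
    using that unfolding prod_bivector_def bivector_map_def z by auto
  show "?\<Theta> z \<in> bivector_space ?B ?P z"
    unfolding bivector_space_def mem_Collect_eq
  proof (intro conjI allI ballI impI zero, assumption)
    fix C I J
    show "?\<Theta> z C I J = - ?\<Theta> z C J I"
    proof (cases "C \<in> ?P \<and> z \<in> fst C \<and> I \<in> ?B \<and> J \<in> ?B")
      case True
      then obtain c d where cd: "c \<in> A" "d \<in> A'" "C = prod_chart c d"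
        using prod_atlasE by blast
      then have mem: "p \<in> fst c" "q \<in> fst d" and IJ: "I \<in> insert 0 ?B" "J \<in> insert 0 ?B"
        using True by (auto simp: z)
      show ?thesis
        using bivector_spaceD(2)[OF w, of c "fst I" "fst J"] bivector_spaceD(2)[OF w', of d "snd I" "snd J"]
        unfolding z cd(3) chart[OF cd(1) mem(1) cd(2) mem(2) IJ] chart[OF cd(1) mem(1) cd(2) mem(2) IJ(2,1)] by simp
    next
      case False
      then have "?\<Theta> z C I J = 0" "?\<Theta> z C J I = 0"
        by (auto intro!: zero)
      then show ?thesis
        by simp
    qed
  next
    fix C D K L assume "C \<in> ?P" "D \<in> ?P" and zC: "z \<in> fst C" and zD: "z \<in> fst D" and KL: "K \<in> ?B" "L \<in> ?B"
    then obtain c c' d d' where c: "c \<in> A" "c' \<in> A'" "C = prod_chart c c'" and d: "d \<in> A" "d' \<in> A'" "D = prod_chart d d'"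
      using prod_atlasE by metis
    have mem: "p \<in> fst c" "q \<in> fst c'" "p \<in> fst d" "q \<in> fst d'"
      using zC zD by (auto simp: z c d)
    note J1 = linear_0[OF linear_jac[OF A(1) c(1) d(1) mem(1,3)]] and J2 = linear_0[OF linear_jac[OF A(2) c(2) d(2) mem(2,4)]]
    \<comment> \<open>One of \<open>fst K\<close> and \<open>snd K\<close> is \<open>0\<close>, so
      the transformation laws of the factors are first extended to that index.\<close>
    have tr: "\<Lambda> p d k l = push_bivector B (jac c d p) (\<Lambda> p c) k l" if "k \<in> insert 0 B" "l \<in> insert 0 B" for k l
      using that bivector_spaceD(3)[OF w c(1) d(1) mem(1,3)] bivector_space_zero[OF B(1) w, of d] by auto
    have tr': "\<Lambda>' q d' k l = push_bivector B' (jac c' d' q) (\<Lambda>' q c') k l" if "k \<in> insert 0 B'" "l \<in> insert 0 B'" for k l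
      using that bivector_spaceD(3)[OF w' c(2) d(2) mem(2,4)] bivector_space_zero[OF B(2) w', of d'] by auto
    have KL0: "K \<in> insert 0 ?B" "L \<in> insert 0 ?B"
      using KL by auto
    note fs = prod_basis_fst_snd[OF KL0(1)] prod_basis_fst_snd[OF KL0(2)]
    have "?\<Theta> z D K L = \<Lambda> p d (fst K) (fst L) + \<Lambda>' q d' (snd K) (snd L)"
      unfolding z d(3) by (rule chart[OF d(1) mem(3) d(2) mem(4) KL0])
    also have "\<dots> = push_bivector B (jac c d p) (\<Lambda> p c) (fst K) (fst L) + push_bivector B' (jac c' d' q) (\<Lambda>' q c') (snd K) (snd L)"
      using tr[OF fs(1,3)] tr'[OF fs(2,4)] by simp
    also have "\<dots> = push_bivector ?B (jac C D z) (\<lambda>I J. \<Lambda> p c (fst I) (fst J) + \<Lambda>' q c' (snd I) (snd J)) K L"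
      unfolding z c(3) d(3) jac_prod_chart[OF A c(1,2) d(1,2) mem]
      using bivector_space_zero[OF B(1) w, of c] bivector_space_zero[OF B(2) w', of c']
      by (intro push_bivector_prod[OF B, where T = "jac c d p" and T' = "jac c' d' q", OF J1 J2, symmetric])
    also have "\<dots> = push_bivector ?B (jac C D z) (?\<Theta> z C) K L"
      unfolding z c(3) by (rule push_bivector_cong) (simp add: chart[OF c(1) mem(1) c(2) mem(2)])
    finally show "?\<Theta> z D K L = push_bivector ?B (jac C D z) (?\<Theta> z C) K L" .
  qed
next
  let ?\<Theta> = "prod_bivector B A \<Lambda> B' A' \<Lambda>'" and ?B = "prod_basis B B'" and ?P = "prod_atlas A A'"
  fix C I J assume "C \<in> ?P" and IJ: "I \<in> ?B" "J \<in> ?B"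
  then obtain c d where cd: "c \<in> A" "d \<in> A'" "C = prod_chart c d"
    using prod_atlasE by metis
  have im: "snd C ` fst C = (snd c ` fst c) \<times> (snd d ` fst d)"
    by (simp add: cd(3) prod_chart_image)
  note P = local_bivector_components[OF A(1) \<Lambda> cd(1)] and Q = local_bivector_components[OF A(2) \<Lambda>' cd(2)]
  have o: "open ((snd c ` fst c) \<times> (snd d ` fst d))"
    by (intro open_Times smooth_atlas_open[OF A(1) cd(1)] smooth_atlas_open[OF A(2) cd(2)])
  have "smooth_on ((snd c ` fst c) \<times> (snd d ` fst d))
      (\<lambda>z. components c \<Lambda> (fst I) (fst J) (fst z) + components d \<Lambda>' (snd I) (snd J) (snd z))"
    by (intro smooth_on_add o smooth_on_compose_fst[OF B(1)] smooth_on_compose_snd[OF B(2)]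
        local_bivectorD(2)[OF P] local_bivectorD(2)[OF Q] local_bivectorD(1)[OF P] local_bivectorD(1)[OF Q])
  then show "smooth_on (snd C ` fst C) (components C ?\<Theta> I J)"
    unfolding im
  proof (rule smooth_on_cong[OF o])
    fix z assume "z \<in> (snd c ` fst c) \<times> (snd d ` fst d)"
    then obtain p q where p: "p \<in> fst c" and q: "q \<in> fst d" and z: "z = (snd c p, snd d q)"
      by auto
    show "components c \<Lambda> (fst I) (fst J) (fst z) + components d \<Lambda>' (snd I) (snd J) (snd z) = components C ?\<Theta> I J z"
      using p q IJ
        prod_bivector_chart[OF B A, where \<Lambda> = \<Lambda> and \<Lambda>' = \<Lambda>', OF bivector_fieldD(1)[OF \<Lambda> in_points[OF cd(1) p]] bivector_fieldD(1)[OF \<Lambda>' in_points[OF cd(2) q]] cd(1) p cd(2) q]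
      by (simp add: components_def z cd(3) chart_inv_prod_chart[OF A cd(1,2)] chart_inv_left[OF A(1) cd(1)] chart_inv_left[OF A(2) cd(2)])
  qed
qed

text \<open>The derivative term calls for agreement near the point; agreement on
  \<open>insert 0 B\<close> covers the empty slots of \<open>K\<close> and \<open>L\<close>.\<close>

lemma lift_comp_cong_open:
  assumes S: "open S" "fst z \<in> S" and eq: "\<And>i j y. i \<in> insert 0 B \<Longrightarrow> j \<in> insert 0 B \<Longrightarrow> y \<in> S \<Longrightarrow> P i j y = Q i j y"
    and d: "\<And>i j. P i j differentiable (at (fst z))" and K: "K \<in> prod_basis B B" and L: "L \<in> prod_basis B B"
  shows "lift_comp P z K L = lift_comp Q z K L"
proof -
  have KL: "fst K \<in> insert 0 B" "snd K \<in> insert 0 B" "fst L \<in> insert 0 B" "snd L \<in> insert 0 B"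
    using prod_basis_fst_snd K L by blast+
  have "partial (snd z) (P (snd K) (snd L)) (fst z) = partial (snd z) (Q (snd K) (snd L)) (fst z)"
    by (rule partial_cong_open[OF S eq[OF KL(2,4)] d])
  then show ?thesis
    unfolding lift_comp_def using eq[OF KL(1,4) S(2)] eq[OF KL(2,3) S(2)] by simp
qed

text \<open>The two summands depend on separate variables, so the derivative along a pair of
  velocities is the sum of the two derivatives; the swaps only regroup coordinates by
  factor.\<close>

lemma lift_comp_prod:
  assumes "\<And>i j. P i j differentiable (at (fst (fst Z)))" "\<And>i j. Q i j differentiable (at (snd (fst Z)))"
  shows "lift_comp (\<lambda>I J y. P (fst I) (fst J) (fst y) + Q (snd I) (snd J) (snd y)) Z K L
    = lift_comp P (fst (tangent_swap Z)) (fst (tangent_swap K)) (fst (tangent_swap L))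
    + lift_comp Q (snd (tangent_swap Z)) (snd (tangent_swap K)) (snd (tangent_swap L))"
proof -
  have "((\<lambda>y. P i j (fst y) + Q k l (snd y)) has_derivative
      (\<lambda>v. partial (fst v) (P i j) (fst (fst Z)) + partial (snd v) (Q k l) (snd (fst Z)))) (at (fst (fst Z), snd (fst Z)))" for i j k l
    by (intro has_derivative_add has_derivative_compose_fst[OF has_derivative_partial[OF assms(1)]]
        has_derivative_compose_snd[OF has_derivative_partial[OF assms(2)]])
  from partial_eqI[OF this] show ?thesis
    by (simp add: lift_comp_def tangent_swap_def)
qed

lemma tangent_swap_prod_basis:
  assumes "K \<in> prod_basis (prod_basis B C) (prod_basis B C)"
  shows "tangent_swap K \<in> prod_basis (prod_basis B B) (prod_basis C C)"
  using assms by (elim prod_basis_cases) (auto simp: tangent_swap_def prod_basis_def image_iff zero_prod_def)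

text \<open>Makes the push-forward along the swap an evaluation at swapped indices.\<close>

lemma inner_tangent_swap: "tangent_swap z \<bullet> w = z \<bullet> tangent_swap w"
  by (simp add: tangent_swap_def inner_prod_def)

lemma poisson_map_tangent_prod_iso:
  fixes A :: "('a, 'e::real_inner) atlas" and A' :: "('b, 'f::real_inner) atlas"
  assumes B: "coordinate_basis (B :: 'e set)" "coordinate_basis (B' :: 'f set)"
    and A: "smooth_atlas A" "smooth_atlas A'"
    and \<Lambda>: "bivector_field B A \<Lambda>" and \<Lambda>': "bivector_field B' A' \<Lambda>'"
  defines "\<Theta> \<equiv> prod_bivector B A \<Lambda> B' A' \<Lambda>'"
  shows "poisson_map (prod_basis (prod_basis B B) (prod_basis B' B')) (prod_atlas (tangent_atlas A) (tangent_atlas A'))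
      (prod_bivector (prod_basis B B) (tangent_atlas A) (tangent_lift B A \<Lambda>)
        (prod_basis B' B') (tangent_atlas A') (tangent_lift B' A' \<Lambda>'))
      (prod_basis (prod_basis B B') (prod_basis B B')) (tangent_atlas (prod_atlas A A'))
      (tangent_lift (prod_basis B B') (prod_atlas A A') \<Theta>)
      (tangent_prod_iso A A')"
proof -
  let ?P = "prod_atlas A A'" and ?BP = "prod_basis B B'" and ?BB = "prod_basis B B" and ?BB' = "prod_basis B' B'"
  let ?T = "tangent_lift B A \<Lambda>" and ?T' = "tangent_lift B' A' \<Lambda>'"
  let ?S = "prod_bivector ?BB (tangent_atlas A) ?T ?BB' (tangent_atlas A') ?T'" and ?iso = "tangent_prod_iso A A'"
  note BB = coordinate_basis_prod_basis[OF B(1,1)] and BB' = coordinate_basis_prod_basis[OF B(2,2)]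
    and BP = coordinate_basis_prod_basis[OF B]
  note TA = smooth_atlas_tangent[OF B(1) A(1)] and TA' = smooth_atlas_tangent[OF B(2) A(2)]
    and P = smooth_atlas_prod[OF B A]
  note T = bivector_field_tangent_lift[OF B(1) A(1) \<Lambda>] and T' = bivector_field_tangent_lift[OF B(2) A(2) \<Lambda>']
    and Pi = bivector_field_prod[OF B A \<Lambda> \<Lambda>', folded \<Theta>_def]
  note BBB = coordinate_basis_prod_basis[OF BB BB'] and S = bivector_field_prod[OF BB BB' TA TA' T T']
  show ?thesis
  proof (rule poisson_mapI[OF BBB coordinate_basis_prod_basis[OF BP BP] smooth_atlas_prod[OF BB BB' TA TA']
        smooth_atlas_tangent[OF BP P] smooth_map_tangent_prod_iso[OF B A] bivector_fieldD(1)[OF S]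
        bivector_fieldD(1)[OF bivector_field_tangent_lift[OF BP P Pi]]])
    fix Z assume Z: "Z \<in> points (prod_atlas (tangent_atlas A) (tangent_atlas A'))"
    obtain z z' where Zz: "Z = (z, z')"
      by (cases Z)
    have z: "z \<in> tangent_bundle A" and z': "z' \<in> tangent_bundle A'"
      using Z by (auto simp: Zz points_prod_atlas points_tangent_atlas)
    have zp: "z \<in> points (tangent_atlas A)" and zp': "z' \<in> points (tangent_atlas A')"
      using z z' by (simp_all add: points_tangent_atlas)
    obtain c d where cd: "c \<in> A" "d \<in> A'" "fst z \<in> fst c" "fst z' \<in> fst d"
      using z z' pointsE unfolding mem_tangent_bundle by metis
    let ?C = "prod_chart (tangent_chart A c) (tangent_chart A' d)" and ?D = "tangent_chart ?P (prod_chart c d)"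
    let ?W = "((snd c ` fst c) \<times> (UNIV :: 'e set)) \<times> ((snd d ` fst d) \<times> (UNIV :: 'f set))"
    have zc: "z \<in> fst (tangent_chart A c)" and zd: "z' \<in> fst (tangent_chart A' d)"
      using z z' cd by (simp_all add: mem_tangent_chart mem_tangent_bundle)
    let ?X = "snd ?C Z"
    have X: "?X \<in> ?W"
      using cd by (simp add: Zz snd_tangent_chart)
    have ZC: "Z \<in> fst ?C"
      using zc zd by (simp add: Zz)
    note C = prod_chart_in[OF tangent_chart_in[OF cd(1)] tangent_chart_in[OF cd(2)]]
    have inv: "chart_inv ?C ?X = Z"
      using chart_inv_left[OF smooth_atlas_prod[OF BB BB' TA TA'] C ZC] .
    have iso: "?iso Z \<in> fst ?D" "snd ?D (?iso Z) = tangent_swap ?X"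
      using tangent_prod_iso_chart[OF B A cd(1,2) X] unfolding inv by simp_all
    \<comment> \<open>In charts the identification is the linear swap, hence its own
      derivative.\<close>
    have ld: "local_differential ?iso Z ?C ?D = tangent_swap"
    proof (rule local_differential_eqI)
      show "(tangent_swap has_derivative tangent_swap) (at (snd ?C Z))"
        by (rule bounded_linear_imp_has_derivative[OF bounded_linear_tangent_swap])
      show "open ?W"
        by (intro open_Times open_UNIV smooth_atlas_open[OF A(1) cd(1)] smooth_atlas_open[OF A(2) cd(2)])
      show "snd ?C Z \<in> ?W"
        by (rule X)
      show "tangent_swap x = snd ?D (?iso (chart_inv ?C x))" if "x \<in> ?W" for x
        using tangent_prod_iso_chart(2)[OF B A cd(1,2) that] by simp
    qed
    have "tangent_lift ?BP ?P \<Theta> (?iso Z) ?D K L = push_bivector (prod_basis ?BB ?BB') tangent_swap (?S Z ?C) K L"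
      if K: "K \<in> prod_basis ?BP ?BP" and L: "L \<in> prod_basis ?BP ?BP" for K L
    proof -
      let ?K = "tangent_swap K" and ?L = "tangent_swap L"
      note K' = tangent_swap_prod_basis[OF K] and L' = tangent_swap_prod_basis[OF L]
      have K0: "?K \<in> insert 0 (prod_basis ?BB ?BB')" and L0: "?L \<in> insert 0 (prod_basis ?BB ?BB')"
        using K' L' by auto
      note KL = prod_basis_fst_snd[OF K0] prod_basis_fst_snd[OF L0]
      note lP = local_bivector_components[OF A(1) \<Lambda> cd(1)] and lQ = local_bivector_components[OF A(2) \<Lambda>' cd(2)]
        and lR = local_bivector_components[OF P Pi prod_chart_in[OF cd(1,2)]]
      have im: "snd (prod_chart c d) ` fst (prod_chart c d) = (snd c ` fst c) \<times> (snd d ` fst d)"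
        by (simp add: prod_chart_image)
      have Xim: "fst (tangent_swap ?X) \<in> (snd c ` fst c) \<times> (snd d ` fst d)"
        using cd by (simp add: Zz snd_tangent_chart tangent_swap_def)
      \<comment> \<open>Self-adjointness moves the swap onto \<open>K\<close> and \<open>L\<close>,
        and the Kronecker sums then select the component at the swapped indices.\<close>
      have "push_bivector (prod_basis ?BB ?BB') tangent_swap (?S Z ?C) K L = ?S Z ?C ?K ?L"
        unfolding push_bivector_def inner_tangent_swap
        by (rule coordinate_sum_inner2[OF BBB K0 L0]) (rule bivector_spaceD(1)[OF bivector_fieldD(1)[OF S Z]], blast)
      also have "\<dots> = ?T z (tangent_chart A c) (fst ?K) (fst ?L) + ?T' z' (tangent_chart A' d) (snd ?K) (snd ?L)"
        unfolding Zz
        by (rule prod_bivector_chart[OF BB BB' TA TA', where \<Lambda> = ?T and \<Lambda>' = ?T',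
              OF bivector_fieldD(1)[OF T zp] bivector_fieldD(1)[OF T' zp']
              tangent_chart_in[OF cd(1)] zc tangent_chart_in[OF cd(2)] zd K0 L0])
      also have "\<dots> = lift_comp (components c \<Lambda>) (fst ?X) (fst ?K) (fst ?L) + lift_comp (components d \<Lambda>') (snd ?X) (snd ?K) (snd ?L)"
        unfolding tangent_lift_chart[OF B(1) A(1) \<Lambda> cd(1) zc KL(1,3)] tangent_lift_chart[OF B(2) A(2) \<Lambda>' cd(2) zd KL(2,4)]
        by (simp add: Zz)
      \<comment> \<open>The sum of the lifts is the lift of the sum, and the summed expression
        agrees near the point with the components of the product bivector.\<close>
      also have "\<dots> = lift_comp (\<lambda>I J y. components c \<Lambda> (fst I) (fst J) (fst y) + components d \<Lambda>' (snd I) (snd J) (snd y)) (tangent_swap ?X) K L"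
        using Xim smooth_on_differentiable[OF local_bivectorD(2)[OF lP]] smooth_on_differentiable[OF local_bivectorD(2)[OF lQ]]
        by (subst lift_comp_prod) (auto simp: mem_Times_iff)
      also have "\<dots> = lift_comp (components (prod_chart c d) \<Theta>) (tangent_swap ?X) K L"
      proof (rule lift_comp_cong_open[OF _ Xim _ _ K L, symmetric])
        show "open ((snd c ` fst c) \<times> (snd d ` fst d))"
          using local_bivectorD(1)[OF lR] unfolding im .
        show "components (prod_chart c d) \<Theta> i j differentiable (at (fst (tangent_swap ?X)))" for i j
          by (rule smooth_on_differentiable[OF local_bivectorD(2)[OF lR]]) (use Xim im in simp)
        fix I J y assume IJ: "I \<in> insert 0 ?BP" "J \<in> insert 0 ?BP" and "y \<in> (snd c ` fst c) \<times> (snd d ` fst d)"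
        then obtain p q where p: "p \<in> fst c" and q: "q \<in> fst d" and y: "y = (snd c p, snd d q)"
          by auto
        show "components (prod_chart c d) \<Theta> I J y
            = components c \<Lambda> (fst I) (fst J) (fst y) + components d \<Lambda>' (snd I) (snd J) (snd y)"
          using p q prod_bivector_chart[OF B A, where \<Lambda> = \<Lambda> and \<Lambda>' = \<Lambda>', OF bivector_fieldD(1)[OF \<Lambda> in_points[OF cd(1) p]]
              bivector_fieldD(1)[OF \<Lambda>' in_points[OF cd(2) q]] cd(1) p cd(2) q IJ]
          by (simp add: components_def y \<Theta>_def chart_inv_prod_chart[OF A cd(1,2)]
              chart_inv_left[OF A(1) cd(1)] chart_inv_left[OF A(2) cd(2)])
      qed
      also have "\<dots> = tangent_lift ?BP ?P \<Theta> (?iso Z) ?D K L"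
        using K L unfolding iso(2)[symmetric]
        by (intro tangent_lift_chart[OF BP P Pi prod_chart_in[OF cd(1,2)] iso(1), symmetric]) auto
      finally show ?thesis ..
    qed
    then show "\<exists>C\<in>prod_atlas (tangent_atlas A) (tangent_atlas A'). \<exists>D\<in>tangent_atlas ?P. Z \<in> fst C \<and> ?iso Z \<in> fst D \<and>
        (\<forall>K\<in>prod_basis ?BP ?BP. \<forall>L\<in>prod_basis ?BP ?BP. tangent_lift ?BP ?P \<Theta> (?iso Z) D K L
          = push_bivector (prod_basis ?BB ?BB') (local_differential ?iso Z C D) (?S Z C) K L)"
      using C ZC iso(1) tangent_chart_in[OF prod_chart_in[OF cd(1,2)]]
      by (intro bexI[of _ ?C] bexI[of _ ?D] conjI ballI) (simp_all only: ld)
  qed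
qed

theorem theorem7p1:
  fixes B :: "'e::real_inner set"
    and A :: "('a, 'e) atlas"
    and m :: "'a \<times> 'a \<Rightarrow> 'a"
    and \<Lambda> :: "'a \<Rightarrow> ('a, 'e) bivector"
  assumes "poisson_lie_group B A m \<Lambda>"
  shows "poisson_lie_group (prod_basis B B) (tangent_atlas A) (tangent_mult A m) (tangent_lift B A \<Lambda>)"
proof -
  have lie: "lie_group B A m" and poi: "poisson_manifold B A \<Lambda>"
    and m: "poisson_map (prod_basis B B) (prod_atlas A A) (prod_bivector B A \<Lambda> B A \<Lambda>) B A \<Lambda> m"
    using assms by (auto simp: poisson_lie_group_def)
  have B: "coordinate_basis B" and A: "smooth_atlas A" and \<Lambda>: "bivector_field B A \<Lambda>"
    using poi by (auto simp: poisson_manifold_def smooth_manifold_def)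
  note BB = coordinate_basis_prod_basis[OF B B] and P = smooth_atlas_prod[OF B B A A]
    and TA = smooth_atlas_tangent[OF B A] and T = bivector_field_tangent_lift[OF B A \<Lambda>]
    and Pi = bivector_field_prod[OF B B A A \<Lambda> \<Lambda>]
  note BBBB = coordinate_basis_prod_basis[OF BB BB]
  have "poisson_map (prod_basis (prod_basis B B) (prod_basis B B)) (prod_atlas (tangent_atlas A) (tangent_atlas A))
      (prod_bivector (prod_basis B B) (tangent_atlas A) (tangent_lift B A \<Lambda>)
        (prod_basis B B) (tangent_atlas A) (tangent_lift B A \<Lambda>))
      (prod_basis B B) (tangent_atlas A) (tangent_lift B A \<Lambda>)
      (tangent_map (prod_atlas A A) A m \<circ> tangent_prod_iso A A)"
    by (rule poisson_map_compose[OF BBBB BBBB BB smooth_atlas_prod[OF BB BB TA TA] smooth_atlas_tangent[OF BB P] TA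
        bivector_fieldD(1)[OF bivector_field_prod[OF BB BB TA TA T T]]
        bivector_fieldD(1)[OF bivector_field_tangent_lift[OF BB P Pi]] bivector_fieldD(1)[OF T]
        poisson_map_tangent_prod_iso[OF B B A A \<Lambda> \<Lambda>] poisson_map_tangent[OF BB B P A Pi \<Lambda> m]])
  then show ?thesis
    using lie_group_tangent[OF lie] poisson_manifold_tangent_lift[OF poi]
    by (simp add: poisson_lie_group_def tangent_mult_def)
qed

end
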